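(* Assume that $H$ generates a holomorphic Hamiltonian $\mathbb{R}$-action, i.e. the flow of $\xi_H$ preserves $J$. Let $z_c$ be a Morse critical point of $H$ and $E=H(z_c)$. Then: (1) The $L^2$-normalized peak section $s_{k,z_c}(z)=C(z_c)\,\Pi_k(z,z_c)$ is an eigensection of $\hat H_k$ with eigenvalue $H(z_c)$, and all other eigensections, orthogonal to $s_{k,z_c}$, vanish at $z_c$. (2) If $s_{k,j}\in H^0(M,L^k)$ is an eigensection of $\hat H_k$ with eigenvalue $\mu_{k,j}<E$, then $s_{k,j}$ vanishes on $W^+(z_c)$. (3) If $s_{k,j}\in H^0(M,L^k)$ is an eigensection of $\hat H_k$ with eigenvalue $\mu_{k,j}>E$, then $s_{k,j}$ vanishes on $W^-(z_c)$.
   Context: Setting. $(L,h)\to(M,\omega,J)$ is a polarized compact Kähler manifold: $L$ is a positive Hermitian holomorphic line bundle with $\omega=-i\partial\bar\partial\log h$. $H^0(M,L^k)$ is the space of holomorphic sections of $L^k$, with the $L^2$ inner product defined by $h^k$ and the volume form $\omega^m/m!$ ($m=\dim_{\mathbb{C}}M$); $\Pi_k:L^2(M,L^k)\to H^0(M,L^k)$ is the orthogonal projection, and $\Pi_k(z,w)$ is its Schwartz kernel (the Bergman kernel). $\Pi_k(\cdot,z_c)$ is regarded as a holomorphic section of $L^k$ by fixing a unit vector in the fiber over $z_c$; $C(z_c)$ is the constant making its $L^2$ norm equal to $1$ (in (1), $k$ is such that $\Pi_k(z_c,z_c)\neq0$, so that the normalization makes sense). $H:M\to\mathbb{R}$ is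 a smooth function, $\xi_H$ its Hamiltonian vector field and $\nabla H$ its gradient, with conventions $g(X,Y)=\omega(X,JY)$ and $dH(Y)=\omega(\xi_H,Y)=g(\nabla H,Y)$, so $\nabla H=J\xi_H$. Since $\xi_H$ preserves $J$, the Berezin–Toeplitz quantization $\hat H_k=\Pi_k\circ(H+\frac{i}{k}\nabla_{\xi_H})\circ\Pi_k$ reduces to the Kostant quantization $\hat H_k=\frac{i}{k}\nabla_{\xi_H}+H:H^0(M,L^k)\to H^0(M,L^k)$, where $\nabla$ is the Chern connection on $L^k$. The stable/unstable manifolds of $z_c$ are $$W^{\pm}(z_c)=\{z\in M:\lim_{t\to\infty}\exp(\mp t\nabla H)z=z_c\},$$ where $\exp(t\nabla H)$ is the time-$t$ gradient flow; thus $H|_{W^-(z_c)}\le H(z_c)\le H|_{W^+(z_c)}$. *)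

theory Defs
  imports "HOL-Analysis.Analysis"
begin

section \<open>Smooth and holomorphic functions on open subsets of \<open>\<complex>\<^sup>m\<close>\<close>

primrec Ck_on :: "nat \<Rightarrow> ('e::real_normed_vector \<Rightarrow> 'b::real_normed_vector) \<Rightarrow> 'e set \<Rightarrow> bool" where
  "Ck_on 0 f S \<longleftrightarrow> continuous_on S f"
| "Ck_on (Suc n) f S \<longleftrightarrow>
     (\<forall>x\<in>S. f differentiable (at x)) \<and> (\<forall>v. Ck_on n (\<lambda>x. frechet_derivative f (at x) v) S)"

definition smooth_on :: "('e::real_normed_vector \<Rightarrow> 'b::real_normed_vector) \<Rightarrow> 'e set \<Rightarrow> bool" where
  "smooth_on f S \<longleftrightarrow> (\<forall>n. Ck_on n f S)"

definition holo_on :: "(complex^'m::finite \<Rightarrow> complex) \<Rightarrow> (complex^'m) set \<Rightarrow> bool" where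
  "holo_on f S \<longleftrightarrow>
     (\<forall>x\<in>S. \<exists>D. (f has_derivative D) (at x) \<and> (\<forall>c v. D (c *s v) = c * D v))"

text \<open>The Wirtinger derivatives \<open>\<partial>/\<partial>z\<^sub>j\<close> and \<open>\<partial>/\<partial>(cnj z\<^sub>j)\<close>.\<close>

definition wirtinger :: "'m::finite \<Rightarrow> (complex^'m \<Rightarrow> complex) \<Rightarrow> complex^'m \<Rightarrow> complex" where
  "wirtinger j f x = (frechet_derivative f (at x) (axis j 1)
                      - \<i> * frechet_derivative f (at x) (axis j \<i>)) / 2"

definition wirtinger_bar :: "'m::finite \<Rightarrow> (complex^'m \<Rightarrow> complex) \<Rightarrow> complex^'m \<Rightarrow> complex" where
  "wirtinger_bar j f x = (frechet_derivative f (at x) (axis j 1)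
                          + \<i> * frechet_derivative f (at x) (axis j \<i>)) / 2"


section \<open>Complex manifolds\<close>

text \<open>
  The manifold is the whole (Hausdorff) type \<open>'a\<close>. A chart is a pair of a domain and a
  coordinate map, whose values outside the domain are irrelevant.
\<close>

type_synonym ('a, 'm) chart = "'a set \<times> ('a \<Rightarrow> complex^'m)"

definition chart_img :: "('a, 'm::finite) chart \<Rightarrow> 'a set \<Rightarrow> (complex^'m) set" where
  "chart_img c U = snd c ` (fst c \<inter> U)"

definition chart_inv :: "('a, 'm::finite) chart \<Rightarrow> complex^'m \<Rightarrow> 'a" where
  "chart_inv c = inv_into (fst c) (snd c)"

definition holo_fun :: "('a, 'm::finite) chart set \<Rightarrow> 'a set \<Rightarrow> ('a \<Rightarrow> complex) \<Rightarrow> bool" where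
  "holo_fun A U f \<longleftrightarrow> (\<forall>c\<in>A. holo_on (f \<circ> chart_inv c) (chart_img c U))"

definition smooth_fun ::
  "('a, 'm::finite) chart set \<Rightarrow> 'a set \<Rightarrow> ('a \<Rightarrow> 'b::real_normed_vector) \<Rightarrow> bool" where
  "smooth_fun A U f \<longleftrightarrow> (\<forall>c\<in>A. smooth_on (f \<circ> chart_inv c) (chart_img c U))"

definition holo_map :: "('a::topological_space, 'm::finite) chart set \<Rightarrow> ('a \<Rightarrow> 'a) \<Rightarrow> bool" where
  "holo_map A F \<longleftrightarrow> continuous_on UNIV F \<and>
     (\<forall>d\<in>A. \<forall>j. holo_fun A (F -` fst d) (\<lambda>p. snd d (F p) $ j))"

definition complex_atlas :: "('a::topological_space, 'm::finite) chart set \<Rightarrow> bool" where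
  "complex_atlas A \<longleftrightarrow>
     (\<Union>c\<in>A. fst c) = UNIV \<and>
     (\<forall>c\<in>A. open (fst c) \<and> open (snd c ` fst c) \<and>
        homeomorphism (fst c) (snd c ` fst c) (snd c) (chart_inv c)) \<and>
     (\<forall>d\<in>A. \<forall>j. holo_fun A (fst d) (\<lambda>p. snd d p $ j))"

definition chart_at :: "('a, 'm::finite) chart set \<Rightarrow> 'a \<Rightarrow> ('a, 'm) chart" where
  "chart_at A p = (SOME c. c \<in> A \<and> p \<in> fst c)"

text \<open>
  A tangent vector at \<open>p\<close> is the family of its coordinate vectors in all charts around \<open>p\<close>
  (and \<open>0\<close> at all other indices), related by the differentials of the coordinate changes.
  Tangent vectors are added and scaled componentwise; \<open>J\<close> is multiplication by \<open>\<i>\<close>.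
\<close>

type_synonym ('a, 'm) tvec = "('a, 'm) chart \<Rightarrow> complex^'m"

definition tangent_space :: "('a, 'm::finite) chart set \<Rightarrow> 'a \<Rightarrow> ('a, 'm) tvec set" where
  "tangent_space A p = {X.
     (\<forall>c. \<not> (c \<in> A \<and> p \<in> fst c) \<longrightarrow> X c = 0) \<and>
     (\<forall>c\<in>A. \<forall>d\<in>A. p \<in> fst c \<and> p \<in> fst d \<longrightarrow>
        X d = frechet_derivative (snd d \<circ> chart_inv c) (at (snd c p)) (X c))}"

definition cplx_J :: "('a, 'm::finite) tvec \<Rightarrow> ('a, 'm) tvec" where
  "cplx_J X = (\<lambda>c. \<i> *s X c)"

text \<open>The differential \<open>df\<^sub>p(X)\<close>, which is the same in every chart around \<open>p\<close>.\<close>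

definition differential ::
  "('a, 'm::finite) chart set \<Rightarrow> ('a \<Rightarrow> 'b::real_normed_vector) \<Rightarrow> 'a \<Rightarrow> ('a, 'm) tvec \<Rightarrow> 'b" where
  "differential A f p X =
     (let c = chart_at A p in frechet_derivative (f \<circ> chart_inv c) (at (snd c p)) (X c))"

text \<open>The \<open>(1,0)\<close>-part \<open>\<partial>f\<close> of \<open>df\<close>.\<close>

definition del :: "('a, 'm::finite) chart set \<Rightarrow> ('a \<Rightarrow> complex) \<Rightarrow> 'a \<Rightarrow> ('a, 'm) tvec \<Rightarrow> complex" where
  "del A f p X = (differential A f p X - \<i> * differential A f p (cplx_J X)) / 2"

definition morse_critical_point ::
  "('a, 'm::finite) chart set \<Rightarrow> ('a \<Rightarrow> real) \<Rightarrow> 'a \<Rightarrow> bool" where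
  "morse_critical_point A H p \<longleftrightarrow>
     (\<forall>X\<in>tangent_space A p. differential A H p X = 0) \<and>
     (\<forall>c\<in>A. p \<in> fst c \<longrightarrow>
        (\<forall>v. (\<forall>w. frechet_derivative
                      (\<lambda>x. frechet_derivative (H \<circ> chart_inv c) (at x) w) (at (snd c p)) v = 0)
             \<longrightarrow> v = 0))"


section \<open>Flows and stable sets\<close>

definition integral_curve :: "('a::topological_space, 'm::finite) chart set \<Rightarrow>
    ('a \<Rightarrow> ('a, 'm) tvec) \<Rightarrow> (real \<Rightarrow> 'a) \<Rightarrow> bool" where
  "integral_curve A X \<gamma> \<longleftrightarrow> continuous_on UNIV \<gamma> \<and>
     (\<forall>t. \<forall>c\<in>A. \<gamma> t \<in> fst c \<longrightarrow>
        ((\<lambda>s. snd c (\<gamma> s)) has_vector_derivative X (\<gamma> t) c) (at t))"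

definition is_flow :: "('a::topological_space, 'm::finite) chart set \<Rightarrow>
    ('a \<Rightarrow> ('a, 'm) tvec) \<Rightarrow> (real \<Rightarrow> 'a \<Rightarrow> 'a) \<Rightarrow> bool" where
  "is_flow A X \<Phi> \<longleftrightarrow>
     (\<forall>p. \<Phi> 0 p = p) \<and> (\<forall>s t p. \<Phi> (s + t) p = \<Phi> s (\<Phi> t p)) \<and>
     (\<forall>p. integral_curve A X (\<lambda>t. \<Phi> t p))"

text \<open>
  The sets of points \<open>z\<close> with \<open>exp(-tX) z \<rightarrow> p\<close>, respectively \<open>exp(tX) z \<rightarrow> p\<close>, as
  \<open>t \<rightarrow> \<infinity>\<close>; here \<open>exp(tX) z = \<gamma> t\<close> for the integral curve \<open>\<gamma>\<close> of \<open>X\<close> through \<open>z\<close>.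
  Such a curve exists and is unique for every smooth vector field on a compact manifold.
\<close>

definition limit_set_plus :: "('a::topological_space, 'm::finite) chart set \<Rightarrow>
    ('a \<Rightarrow> ('a, 'm) tvec) \<Rightarrow> 'a \<Rightarrow> 'a set" where
  "limit_set_plus A X p =
     {z. \<exists>\<gamma>. integral_curve A X \<gamma> \<and> \<gamma> 0 = z \<and> ((\<lambda>t. \<gamma> (- t)) \<longlongrightarrow> p) at_top}"

definition limit_set_minus :: "('a::topological_space, 'm::finite) chart set \<Rightarrow>
    ('a \<Rightarrow> ('a, 'm) tvec) \<Rightarrow> 'a \<Rightarrow> 'a set" where
  "limit_set_minus A X p =
     {z. \<exists>\<gamma>. integral_curve A X \<gamma> \<and> \<gamma> 0 = z \<and> (\<gamma> \<longlongrightarrow> p) at_top}"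


section \<open>Hermitian holomorphic line bundles\<close>

text \<open>
  A line bundle is given by a cover \<open>triv_dom i\<close> with frames \<open>e\<^sub>i\<close>: an element of the fibre
  over \<open>z\<close> is written \<open>u\<^sub>i e\<^sub>i(z)\<close> in every trivialization around \<open>z\<close>, and
  \<open>u\<^sub>i = trans i j z * u\<^sub>j\<close>. The metric \<open>h\<close> is given by \<open>weight i = |e\<^sub>i|\<^sup>2\<close>.
\<close>

record ('a, 'i) herm_line_bundle =
  triv_dom :: "'i \<Rightarrow> 'a set"
  trans :: "'i \<Rightarrow> 'i \<Rightarrow> 'a \<Rightarrow> complex"
  weight :: "'i \<Rightarrow> 'a \<Rightarrow> real"

definition herm_holo_line_bundle ::
  "('a::topological_space, 'm::finite) chart set \<Rightarrow> ('a, 'i) herm_line_bundle \<Rightarrow> bool" where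
  "herm_holo_line_bundle A B \<longleftrightarrow>
     (\<Union>i. triv_dom B i) = UNIV \<and>
     (\<forall>i. open (triv_dom B i)) \<and>
     (\<forall>i j. holo_fun A (triv_dom B i \<inter> triv_dom B j) (trans B i j)) \<and>
     (\<forall>i j. \<forall>z\<in>triv_dom B i \<inter> triv_dom B j. trans B i j z \<noteq> 0) \<and>
     (\<forall>i. \<forall>z\<in>triv_dom B i. trans B i i z = 1) \<and>
     (\<forall>i j l. \<forall>z\<in>triv_dom B i \<inter> triv_dom B j \<inter> triv_dom B l.
        trans B i j z * trans B j l z = trans B i l z) \<and>
     (\<forall>i. smooth_fun A (triv_dom B i) (weight B i)) \<and>
     (\<forall>i. \<forall>z\<in>triv_dom B i. weight B i z > 0) \<and>
     (\<forall>i j. \<forall>z\<in>triv_dom B i \<inter> triv_dom B j.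
        weight B j z = (cmod (trans B i j z))\<^sup>2 * weight B i z)"

text \<open>\<open>L\<^sup>k\<close> with the metric \<open>h\<^sup>k\<close>.\<close>

definition tensor_power :: "('a, 'i) herm_line_bundle \<Rightarrow> nat \<Rightarrow> ('a, 'i) herm_line_bundle" where
  "tensor_power B k = \<lparr> triv_dom = triv_dom B,
     trans = (\<lambda>i j z. trans B i j z ^ k), weight = (\<lambda>i z. weight B i z ^ k) \<rparr>"

definition triv_at :: "('a, 'i) herm_line_bundle \<Rightarrow> 'a \<Rightarrow> 'i" where
  "triv_at B z = (SOME i. z \<in> triv_dom B i)"

definition fibre :: "('a, 'i) herm_line_bundle \<Rightarrow> 'a \<Rightarrow> ('i \<Rightarrow> complex) set" where
  "fibre B z = {u. (\<forall>i. z \<notin> triv_dom B i \<longrightarrow> u i = 0) \<and>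
     (\<forall>i j. z \<in> triv_dom B i \<and> z \<in> triv_dom B j \<longrightarrow> u i = trans B i j z * u j)}"

definition frame :: "('a, 'i) herm_line_bundle \<Rightarrow> 'i \<Rightarrow> 'a \<Rightarrow> 'i \<Rightarrow> complex" where
  "frame B j z = (\<lambda>i. if z \<in> triv_dom B i then trans B i j z else 0)"

definition herm :: "('a, 'i) herm_line_bundle \<Rightarrow> 'a \<Rightarrow> ('i \<Rightarrow> complex) \<Rightarrow> ('i \<Rightarrow> complex) \<Rightarrow> complex" where
  "herm B z u v = (let i = triv_at B z in of_real (weight B i z) * u i * cnj (v i))"

type_synonym ('a, 'i) sect = "'a \<Rightarrow> 'i \<Rightarrow> complex"

definition holo_sections ::
  "('a, 'm::finite) chart set \<Rightarrow> ('a, 'i) herm_line_bundle \<Rightarrow> ('a, 'i) sect set" where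
  "holo_sections A B = {s. (\<forall>z. s z \<in> fibre B z) \<and>
     (\<forall>i. holo_fun A (triv_dom B i) (\<lambda>z. s z i))}"

text \<open>
  The Chern connection: \<open>\<nabla> e\<^sub>i = (\<partial> log |e\<^sub>i|\<^sup>2) e\<^sub>i\<close>. The value is an element of the fibre over \<open>z\<close>.
\<close>

definition chern_connection :: "('a, 'm::finite) chart set \<Rightarrow> ('a, 'i) herm_line_bundle \<Rightarrow>
    ('a, 'm) tvec \<Rightarrow> ('a, 'i) sect \<Rightarrow> ('a, 'i) sect" where
  "chern_connection A B X s z = (\<lambda>i. if z \<in> triv_dom B i
     then differential A (\<lambda>w. s w i) z X
          + del A (\<lambda>w. of_real (ln (weight B i w))) z X * s z i
     else 0)"


section \<open>The polarized Kaehler structure\<close>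

text \<open>
  The coefficients \<open>a\<^sub>j\<^sub>k = - (\<partial>/\<partial>z\<^sub>j) (\<partial>/\<partial>(cnj z\<^sub>k)) log h\<close> in the chart \<open>c\<close>. The form
  \<open>- \<i> \<partial> (cnj \<partial>) log h\<close> is \<open>\<omega> = \<i> \<Sum> a\<^sub>j\<^sub>k dz\<^sub>j \<and> cnj dz\<^sub>k\<close>, where
  \<open>(\<alpha> \<and> \<beta>)(X, Y) = \<alpha> X \<beta> Y - \<alpha> Y \<beta> X\<close>. The \<open>a\<^sub>j\<^sub>k\<close> do not depend on the trivialization.
\<close>

definition kahler_coeffs :: "('a, 'i) herm_line_bundle \<Rightarrow> ('a, 'm::finite) chart \<Rightarrow> 'a \<Rightarrow> complex^'m^'m" where
  "kahler_coeffs L c p = (let u = (\<lambda>x. complex_of_real (ln (weight L (triv_at L p) (chart_inv c x))))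
     in (\<chi> j k. - wirtinger j (wirtinger_bar k u) (snd c p)))"

text \<open>The sum below is already real, so \<open>Re\<close> only changes its type.\<close>

definition kahler_form :: "('a, 'm::finite) chart set \<Rightarrow> ('a, 'i) herm_line_bundle \<Rightarrow> 'a \<Rightarrow>
    ('a, 'm) tvec \<Rightarrow> ('a, 'm) tvec \<Rightarrow> real" where
  "kahler_form A L p X Y = (let c = chart_at A p; a = kahler_coeffs L c p in
     Re (\<i> * (\<Sum>j\<in>UNIV. \<Sum>k\<in>UNIV.
          a $ j $ k * (X c $ j * cnj (Y c $ k) - Y c $ j * cnj (X c $ k)))))"

definition kahler_metric :: "('a, 'm::finite) chart set \<Rightarrow> ('a, 'i) herm_line_bundle \<Rightarrow> 'a \<Rightarrow>
    ('a, 'm) tvec \<Rightarrow> ('a, 'm) tvec \<Rightarrow> real" where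
  "kahler_metric A L p X Y = kahler_form A L p X (cplx_J Y)"

definition polarized_kahler_manifold ::
  "('a::t2_space, 'm::finite) chart set \<Rightarrow> ('a, 'i) herm_line_bundle \<Rightarrow> bool" where
  "polarized_kahler_manifold A L \<longleftrightarrow>
     complex_atlas A \<and> herm_holo_line_bundle A L \<and>
     (\<forall>p. \<forall>X\<in>tangent_space A p. X \<noteq> (\<lambda>c. 0) \<longrightarrow> kahler_metric A L p X X > 0)"

text \<open>
  The Borel measure of the volume form \<open>\<omega>\<^sup>m/m!\<close>. In a chart, \<open>\<omega> = \<i> \<Sum> a\<^sub>j\<^sub>k dz\<^sub>j \<and> cnj dz\<^sub>k\<close>
  gives \<open>\<omega>\<^sup>m/m! = det a \<Prod>\<^sub>j (\<i> dz\<^sub>j \<and> cnj dz\<^sub>j)\<close>, and \<open>\<i> dz \<and> cnj dz = 2 dx \<and> dy\<close>. The determinant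
  is real and positive. The measure is determined by this local description.
\<close>

definition is_liouville_measure ::
  "('a::topological_space, 'm::finite) chart set \<Rightarrow> ('a, 'i) herm_line_bundle \<Rightarrow> 'a measure \<Rightarrow> bool" where
  "is_liouville_measure A L vol \<longleftrightarrow> sets vol = sets borel \<and>
     (\<forall>c\<in>A. \<forall>E\<in>sets borel. E \<subseteq> fst c \<longrightarrow>
        emeasure vol E = (\<integral>\<^sup>+x\<in>snd c ` E.
          ennreal (2 ^ CARD('m) * Re (det (kahler_coeffs L c (chart_inv c x)))) \<partial>lborel))"

definition hamiltonian_field :: "('a, 'm::finite) chart set \<Rightarrow> ('a, 'i) herm_line_bundle \<Rightarrow>
    ('a \<Rightarrow> real) \<Rightarrow> 'a \<Rightarrow> ('a, 'm) tvec" where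
  "hamiltonian_field A L H p = (THE X. X \<in> tangent_space A p \<and>
     (\<forall>Y\<in>tangent_space A p. differential A H p Y = kahler_form A L p X Y))"

definition gradient_field :: "('a, 'm::finite) chart set \<Rightarrow> ('a, 'i) herm_line_bundle \<Rightarrow>
    ('a \<Rightarrow> real) \<Rightarrow> 'a \<Rightarrow> ('a, 'm) tvec" where
  "gradient_field A L H p = (THE X. X \<in> tangent_space A p \<and>
     (\<forall>Y\<in>tangent_space A p. differential A H p Y = kahler_metric A L p X Y))"

definition generates_holo_action :: "('a::topological_space, 'm::finite) chart set \<Rightarrow>
    ('a, 'i) herm_line_bundle \<Rightarrow> ('a \<Rightarrow> real) \<Rightarrow> bool" where
  "generates_holo_action A L H \<longleftrightarrow>
     (\<exists>\<Phi>. is_flow A (hamiltonian_field A L H) \<Phi> \<and> (\<forall>t. holo_map A (\<Phi> t)))"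

definition W_plus :: "('a::topological_space, 'm::finite) chart set \<Rightarrow>
    ('a, 'i) herm_line_bundle \<Rightarrow> ('a \<Rightarrow> real) \<Rightarrow> 'a \<Rightarrow> 'a set" where
  "W_plus A L H p = limit_set_plus A (gradient_field A L H) p"

definition W_minus :: "('a::topological_space, 'm::finite) chart set \<Rightarrow>
    ('a, 'i) herm_line_bundle \<Rightarrow> ('a \<Rightarrow> real) \<Rightarrow> 'a \<Rightarrow> 'a set" where
  "W_minus A L H p = limit_set_minus A (gradient_field A L H) p"


section \<open>The Bergman kernel and the quantized Hamiltonian\<close>

definition L2_inner :: "('a, 'i) herm_line_bundle \<Rightarrow> 'a measure \<Rightarrow> ('a, 'i) sect \<Rightarrow> ('a, 'i) sect \<Rightarrow> complex" where
  "L2_inner B vol s t = (\<integral>z. herm B z (s z) (t z) \<partial>vol)"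

definition L2_norm :: "('a, 'i) herm_line_bundle \<Rightarrow> 'a measure \<Rightarrow> ('a, 'i) sect \<Rightarrow> real" where
  "L2_norm B vol s = sqrt (Re (L2_inner B vol s s))"

definition L2_sections :: "('a, 'i) herm_line_bundle \<Rightarrow> 'a measure \<Rightarrow> ('a, 'i) sect set" where
  "L2_sections B vol = {s. (\<forall>z. s z \<in> fibre B z) \<and>
     (\<forall>i. (\<lambda>z. s z i) \<in> borel_measurable vol) \<and>
     integrable vol (\<lambda>z. herm B z (s z) (s z))}"

definition is_bergman_projection :: "('a, 'm::finite) chart set \<Rightarrow> ('a, 'i) herm_line_bundle \<Rightarrow>
    'a measure \<Rightarrow> (('a, 'i) sect \<Rightarrow> ('a, 'i) sect) \<Rightarrow> bool" where
  "is_bergman_projection A B vol P \<longleftrightarrow> (\<forall>s\<in>L2_sections B vol.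
     P s \<in> holo_sections A B \<and>
     (\<forall>t\<in>holo_sections A B. L2_inner B vol (\<lambda>z i. s z i - P s z i) t = 0))"

text \<open>
  \<open>K z w\<close> is a linear map from the fibre over \<open>w\<close> to the fibre over \<open>z\<close>, with
  \<open>P s z = \<integral> K z w (s w) dvol(w)\<close>. Continuity of its matrix entries in the local frames
  singles out the values of \<open>K\<close> at points, which the integral alone fixes only almost everywhere.
\<close>

definition is_schwartz_kernel :: "('a::topological_space, 'i) herm_line_bundle \<Rightarrow> 'a measure \<Rightarrow>
    (('a, 'i) sect \<Rightarrow> ('a, 'i) sect) \<Rightarrow> ('a \<Rightarrow> 'a \<Rightarrow> ('i \<Rightarrow> complex) \<Rightarrow> 'i \<Rightarrow> complex) \<Rightarrow> bool" where
  "is_schwartz_kernel B vol P K \<longleftrightarrow>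
     (\<forall>z w. \<forall>u\<in>fibre B w. K z w u \<in> fibre B z) \<and>
     (\<forall>z w. \<forall>u\<in>fibre B w. \<forall>v\<in>fibre B w. \<forall>a b.
        K z w (\<lambda>i. a * u i + b * v i) = (\<lambda>i. a * K z w u i + b * K z w v i)) \<and>
     (\<forall>i j. continuous_on (triv_dom B i \<times> triv_dom B j) (\<lambda>(z, w). K z w (frame B j w) i)) \<and>
     (\<forall>s\<in>L2_sections B vol. \<forall>z i. has_bochner_integral vol (\<lambda>w. K z w (s w) i) (P s z i))"

text \<open>\<open>C(w) K(\<cdot>, w)\<close>, made into a section by means of a unit vector \<open>e\<close> in the fibre over \<open>w\<close>.\<close>

definition peak_section :: "('a, 'i) herm_line_bundle \<Rightarrow> 'a measure \<Rightarrow>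
    ('a \<Rightarrow> 'a \<Rightarrow> ('i \<Rightarrow> complex) \<Rightarrow> 'i \<Rightarrow> complex) \<Rightarrow> 'a \<Rightarrow> ('i \<Rightarrow> complex) \<Rightarrow> ('a, 'i) sect" where
  "peak_section B vol K w e =
     (\<lambda>z i. of_real (inverse (L2_norm B vol (\<lambda>z. K z w e))) * K z w e i)"

text \<open>The Kostant quantization \<open>(\<i>/k) \<nabla>\<^sub>\<xi> + H\<close>.\<close>

definition quantum_hamiltonian :: "('a, 'm::finite) chart set \<Rightarrow> ('a, 'i) herm_line_bundle \<Rightarrow>
    nat \<Rightarrow> ('a \<Rightarrow> real) \<Rightarrow> ('a, 'i) sect \<Rightarrow> ('a, 'i) sect" where
  "quantum_hamiltonian A L k H s = (\<lambda>z i.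
     \<i> / of_nat k * chern_connection A (tensor_power L k) (hamiltonian_field A L H z) s z i
     + of_real (H z) * s z i)"

definition eigensection :: "('a, 'm::finite) chart set \<Rightarrow> ('a, 'i) herm_line_bundle \<Rightarrow>
    nat \<Rightarrow> ('a \<Rightarrow> real) \<Rightarrow> ('a, 'i) sect \<Rightarrow> complex \<Rightarrow> bool" where
  "eigensection A L k H s \<mu> \<longleftrightarrow>
     s \<in> holo_sections A (tensor_power L k) \<and> s \<noteq> (\<lambda>z i. 0) \<and>
     quantum_hamiltonian A L k H s = (\<lambda>z i. \<mu> * s z i)"

definition vanishes_on :: "('a, 'i) sect \<Rightarrow> 'a set \<Rightarrow> bool" where
  "vanishes_on s S \<longleftrightarrow> (\<forall>z\<in>S. s z = (\<lambda>i. 0))"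

end

theory Submission
  imports Defs "HOL-Complex_Analysis.Cauchy_Integral_Formula"
begin

text \<open>
  In a chart and a frame with weight \<open>exp u\<close>, both the Kaehler form and the equation
  \<open>dH = \<omega>(\<xi>, \<cdot>)\<close> are expressed by the real Hessian of \<open>u\<close>, and \<open>\<nabla>H = J \<xi>\<close>.

  For an eigensection \<open>s\<close> with eigenvalue \<open>\<mu>\<close>, holomorphy turns the covariant derivative along
  \<open>\<xi>\<close> into one along \<open>\<nabla>H\<close>, so that \<open>|s|\<^sup>2\<close> satisfies \<open>f' = 2k (\<mu> - H) f\<close> on gradient lines.
  If a line converges to \<open>z\<^sub>c\<close> in the right direction and \<open>\<mu> \<noteq> H(z\<^sub>c)\<close> has the right sign, then a
  nonzero \<open>f\<close> would grow exponentially, although it converges to \<open>|s(z\<^sub>c)|\<^sup>2\<close>.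

  For the peak section, the projection is self-adjoint, so its continuous kernel is Hermitian
  symmetric; this makes \<open>K(\<cdot>, z\<^sub>c) e\<close> a holomorphic section that represents evaluation at \<open>z\<^sub>c\<close>.
  The quantum Hamiltonian preserves holomorphic sections, because \<open>\<xi>\<close> is a limit of difference
  quotients of holomorphic maps and \<open>\<partial>u(\<xi>) - \<i> H\<close> is holomorphic. It is symmetric, because
  \<open>\<xi>\<close> preserves \<open>\<omega>\<close> and hence is divergence free for \<open>\<omega>\<^sup>m/m!\<close>. It acts on the fibre over the
  critical point as multiplication by \<open>H(z\<^sub>c)\<close>, so \<open>K(\<cdot>, z\<^sub>c) e\<close> is an eigensection by duality.
\<close>

text \<open>The field \<open>hamiltonian_field\<close> is a pointwise definite description and
  carries no regularity by itself. Continuity is obtained by perturbing the linear system that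
  defines it; it makes the flow quotients converge uniformly, and Cauchy estimates then yield
  holomorphy and all derivatives at once. For this purpose limits and derivatives of holomorphic
  functions of several variables are reduced to one variable on complex lines.

  The rate \<open>2k (\<mu> - H)\<close> arises as follows. The eigenvalue equation says that the
  covariant derivative of \<open>s\<close> along \<xi> is \<open>-\<i> k (\<mu> - H) s\<close>. On
  holomorphic sections the covariant derivative is complex linear in its direction, so along
  \<open>J \<xi>\<close> it is \<open>k (\<mu> - H) s\<close>, and passing to the square of the norm
  doubles the factor.

  The projection is given only by orthogonality to holomorphic sections, the kernel only by
  continuity and an integral formula. Identities between kernel values must therefore be extracted
  from integrals against sections concentrated near points, which is possible because the measure
  charges every nonempty open set.\<close>

abbreviation fd :: "('e::real_normed_vector \<Rightarrow> 'b::real_normed_vector) \<Rightarrow> 'e \<Rightarrow> 'e \<Rightarrow> 'b" where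
  "fd f x \<equiv> frechet_derivative f (at x)"

section \<open>Second derivatives and their symmetry\<close>

definition hess :: "('e::real_normed_vector \<Rightarrow> 'b::real_normed_vector) \<Rightarrow> 'e \<Rightarrow> 'e \<Rightarrow> 'e \<Rightarrow> 'b" where
  "hess f x v w = fd (\<lambda>y. fd f y w) x v"

lemma fd_has_derivative:
  "f differentiable (at x) \<Longrightarrow> (f has_derivative fd f x) (at x)"
  by (simp add: frechet_derivative_works)

lemma fd_eqI: "(f has_derivative D) (at x) \<Longrightarrow> fd f x = D"
  by (rule frechet_derivative_at[symmetric])

lemma fd_cong:
  assumes "open S" "x \<in> S" "\<And>y. y \<in> S \<Longrightarrow> f y = g y"
  shows "fd f x = fd g x"
proof -
  have "(f has_derivative D) (at x) \<longleftrightarrow> (g has_derivative D) (at x)" for D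
    using assms has_derivative_transform_within_open by (metis (no_types, lifting))
  then show ?thesis unfolding frechet_derivative_def by simp
qed

lemma differentiable_cong_open:
  assumes "open S" "x \<in> S" "\<And>y. y \<in> S \<Longrightarrow> f y = g y" "f differentiable (at x)"
  shows "g differentiable (at x)"
  using assms has_derivative_transform_within_open unfolding differentiable_def by (metis (no_types, lifting))

lemma hess_cong:
  assumes "open S" "x \<in> S" "\<And>y. y \<in> S \<Longrightarrow> f y = g y"
  shows "hess f x = hess g x"
proof -
  have "fd (\<lambda>y. fd f y w) x = fd (\<lambda>y. fd g y w) x" for w
    by (rule fd_cong[OF assms(1,2)]) (simp add: fd_cong[OF assms(1) _ assms(3)])
  then show ?thesis unfolding hess_def by simp
qed

text \<open>The mean value theorem along \<open>v\<close> turns the second difference into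
  \<open>h\<close> times an increment of \<open>\<lambda>y. fd f y v\<close>, and differentiability
  of that map at the single point \<open>x\<close> evaluates the increment.\<close>

lemma second_difference_tendsto:
  fixes f :: "'e::real_normed_vector \<Rightarrow> real"
  assumes "open S" "x \<in> S" and df: "\<And>y. y \<in> S \<Longrightarrow> f differentiable (at y)"
    and d2: "(\<lambda>y. fd f y v) differentiable (at x)"
  shows "((\<lambda>h. (f (x + h *\<^sub>R v + h *\<^sub>R w) - f (x + h *\<^sub>R v) - f (x + h *\<^sub>R w) + f x) / h\<^sup>2)
           \<longlongrightarrow> hess f x w v) (at_right 0)"
proof (rule tendstoI)
  fix e :: real assume "e > 0"
  define g where "g y = fd f y v" for y
  define g' where "g' = fd g x"
  have gd: "(g has_derivative g') (at x)"
    using d2 unfolding g_def g'_def by (rule fd_has_derivative)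
  have lin: "linear g'" using gd has_derivative_linear by blast
  \<comment> \<open>\<open>h * C\<close> bounds the summed lengths of the two increments
    \<open>z v + h w\<close> and \<open>z v\<close> at which the remainder is estimated; the
    \<open>1\<close> keeps \<open>C\<close> positive.\<close>
  define C where "C = 2 * norm v + norm w + 1"
  have C: "C > 0" unfolding C_def by (smt (verit) norm_ge_zero)
  have eC: "e / (2*C) > 0" using \<open>e > 0\<close> C by simp
  from gd eC obtain d1 where d1: "d1 > 0"
     "\<And>y. norm (y - x) < d1 \<Longrightarrow> norm (g y - g x - g' (y - x)) \<le> e / (2*C) * norm (y - x)"
    unfolding has_derivative_at_alt by blast
  obtain d2 where d2: "d2 > 0" "ball x d2 \<subseteq> S" using assms(1,2) open_contains_ball by blast
  define d where "d = min d1 d2 / C"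
  have d: "d > 0" using d1 d2 C unfolding d_def by simp
  have "\<bar>(f (x + h *\<^sub>R v + h *\<^sub>R w) - f (x + h *\<^sub>R v) - f (x + h *\<^sub>R w) + f x) / h\<^sup>2 - hess f x w v\<bar> < e"
    if h: "0 < h" "h < d" for h
  proof -
    have small: "norm (s *\<^sub>R v + r *\<^sub>R w) < min d1 d2" if "0 \<le> s" "s \<le> h" "0 \<le> r" "r \<le> h" for s r
    proof -
      have "norm (s *\<^sub>R v + r *\<^sub>R w) \<le> s * norm v + r * norm w"
        using norm_triangle_ineq[of "s *\<^sub>R v" "r *\<^sub>R w"] that by simp
      also have "\<dots> \<le> h * norm v + h * norm w"
        using that by (intro add_mono mult_right_mono) auto
      also have "\<dots> \<le> h * C" unfolding C_def using h by (simp add: algebra_simps)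
      also have "\<dots> < d * C" using h C by simp
      also have "\<dots> = min d1 d2" using C unfolding d_def by simp
      finally show ?thesis .
    qed
    have inS: "x + s *\<^sub>R v + r *\<^sub>R w \<in> S" if "0 \<le> s" "s \<le> h" "0 \<le> r" "r \<le> h" for s r
    proof -
      have "norm (- (s *\<^sub>R v + r *\<^sub>R w)) < d2" using small[OF that] by (simp only: norm_minus_cancel)
      then have "x + s *\<^sub>R v + r *\<^sub>R w \<in> ball x d2"
        by (simp add: dist_norm algebra_simps)
      then show ?thesis using d2 by blast
    qed
    define phi where "phi s = f (x + s *\<^sub>R v + h *\<^sub>R w) - f (x + s *\<^sub>R v)" for s
    have der: "(phi has_real_derivative (g (x + s *\<^sub>R v + h *\<^sub>R w) - g (x + s *\<^sub>R v))) (at s)"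
      if "0 \<le> s" "s \<le> h" for s
    proof -
      have a: "((\<lambda>s. f (x + s *\<^sub>R v + r *\<^sub>R w)) has_real_derivative g (x + s *\<^sub>R v + r *\<^sub>R w)) (at s)"
        if r: "0 \<le> r" "r \<le> h" for r
      proof -
        have fdd: "(f has_derivative fd f (x + s *\<^sub>R v + r *\<^sub>R w)) (at (x + s *\<^sub>R v + r *\<^sub>R w))"
          using inS that \<open>0 \<le> s\<close> \<open>s \<le> h\<close> df fd_has_derivative by blast
        have "((\<lambda>s. x + s *\<^sub>R v + r *\<^sub>R w) has_derivative (\<lambda>t. t *\<^sub>R v)) (at s)"
          by (auto intro!: derivative_eq_intros)
        from has_derivative_compose[OF this fdd]
        have "((\<lambda>s. f (x + s *\<^sub>R v + r *\<^sub>R w)) has_derivative (\<lambda>t. fd f (x + s *\<^sub>R v + r *\<^sub>R w) (t *\<^sub>R v))) (at s)" .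
        moreover have "(\<lambda>t. fd f (x + s *\<^sub>R v + r *\<^sub>R w) (t *\<^sub>R v)) = (*) (g (x + s *\<^sub>R v + r *\<^sub>R w))"
          using has_derivative_linear[OF fdd] unfolding g_def by (auto simp: linear_scale)
        ultimately show ?thesis
          unfolding has_field_derivative_def by simp
      qed
      show ?thesis unfolding phi_def
        using DERIV_diff[OF a[of h] a[of 0]] h by simp
    qed
    have "\<exists>z. 0 < z \<and> z < h \<and> phi h - phi 0 = (h - 0) * (g (x + z *\<^sub>R v + h *\<^sub>R w) - g (x + z *\<^sub>R v))"
      by (rule MVT2) (use der h in auto)
    then obtain z where z: "0 < z" "z < h" "phi h - phi 0 = h * (g (x + z *\<^sub>R v + h *\<^sub>R w) - g (x + z *\<^sub>R v))"
      by auto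
    define E1 where "E1 = g (x + z *\<^sub>R v + h *\<^sub>R w) - g x - g' (z *\<^sub>R v + h *\<^sub>R w)"
    define E2 where "E2 = g (x + z *\<^sub>R v) - g x - g' (z *\<^sub>R v)"
    have E1: "\<bar>E1\<bar> \<le> e / (2*C) * norm (z *\<^sub>R v + h *\<^sub>R w)"
      using d1(2)[of "x + z *\<^sub>R v + h *\<^sub>R w"] small[of z h] z h unfolding E1_def by (simp add: add.assoc)
    have E2: "\<bar>E2\<bar> \<le> e / (2*C) * norm (z *\<^sub>R v)"
      using d1(2)[of "x + z *\<^sub>R v"] small[of z 0] z h unfolding E2_def by simp
    have n1: "norm (z *\<^sub>R v + h *\<^sub>R w) \<le> h * norm v + h * norm w"
      using norm_triangle_ineq[of "z *\<^sub>R v" "h *\<^sub>R w"] z h mult_right_mono[of z h "norm v"] by simp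
    have n2: "norm (z *\<^sub>R v) \<le> h * norm v"
      using z h by (simp add: mult_right_mono)
    have "\<bar>E1\<bar> + \<bar>E2\<bar> \<le> e / (2*C) * (norm (z *\<^sub>R v + h *\<^sub>R w) + norm (z *\<^sub>R v))"
      using E1 E2 by (simp add: distrib_left)
    also have "\<dots> \<le> e / (2*C) * (h * C)"
      using n1 n2 eC h unfolding C_def by (intro mult_left_mono) (auto simp: algebra_simps)
    also have "\<dots> = e * h / 2" using C by (simp add: field_simps)
    finally have EE: "\<bar>E1 - E2\<bar> \<le> e * h / 2" by linarith
    have eq: "g (x + z *\<^sub>R v + h *\<^sub>R w) - g (x + z *\<^sub>R v) = h * g' w + (E1 - E2)"
      unfolding E1_def E2_def by (simp add: linear_add[OF lin] linear_scale[OF lin])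
    have "f (x + h *\<^sub>R v + h *\<^sub>R w) - f (x + h *\<^sub>R v) - f (x + h *\<^sub>R w) + f x = phi h - phi 0"
      unfolding phi_def by simp
    also have "\<dots> = h\<^sup>2 * g' w + h * (E1 - E2)" unfolding z(3) eq by (simp add: power2_eq_square algebra_simps)
    finally have N: "f (x + h *\<^sub>R v + h *\<^sub>R w) - f (x + h *\<^sub>R v) - f (x + h *\<^sub>R w) + f x = h\<^sup>2 * g' w + h * (E1 - E2)" .
    have "hess f x w v = g' w" unfolding hess_def g'_def g_def by simp
    have "(f (x + h *\<^sub>R v + h *\<^sub>R w) - f (x + h *\<^sub>R v) - f (x + h *\<^sub>R w) + f x) / h\<^sup>2 - hess f x w v
       = (E1 - E2) / h"
      using h unfolding N \<open>hess f x w v = g' w\<close> by (simp add: field_simps power2_eq_square)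
    moreover have "\<bar>(E1 - E2) / h\<bar> \<le> e / 2" using EE h by (simp add: field_simps)
    ultimately show ?thesis using \<open>e > 0\<close> by linarith
  qed
  then show "\<forall>\<^sub>F h in at_right 0. dist ((f (x + h *\<^sub>R v + h *\<^sub>R w) - f (x + h *\<^sub>R v) - f (x + h *\<^sub>R w) + f x) / h\<^sup>2) (hess f x w v) < e"
    unfolding eventually_at_right_field dist_real_def using d by auto
qed

text \<open>The second difference is symmetric in \<open>v\<close> and \<open>w\<close>, so its one
  limit equals both mixed derivatives.\<close>

lemma hess_commute:
  fixes f :: "'e::real_normed_vector \<Rightarrow> real"
  assumes "open S" "x \<in> S" "\<And>y. y \<in> S \<Longrightarrow> f differentiable (at y)"
    "(\<lambda>y. fd f y v) differentiable (at x)" "(\<lambda>y. fd f y w) differentiable (at x)"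
  shows "hess f x v w = hess f x w v"
proof -
  have "((\<lambda>h. (f (x + h *\<^sub>R v + h *\<^sub>R w) - f (x + h *\<^sub>R v) - f (x + h *\<^sub>R w) + f x) / h\<^sup>2)
           \<longlongrightarrow> hess f x v w) (at_right 0)"
    using second_difference_tendsto[OF assms(1-3,5), of v] by (simp add: algebra_simps)
  then show ?thesis
    using second_difference_tendsto[OF assms(1-4), of w] tendsto_unique[OF trivial_limit_at_right_real] by blast
qed

lemma linear_Basis_expand:
  fixes f :: "'e::euclidean_space \<Rightarrow> 'b::real_vector"
  assumes "linear f" shows "f u = (\<Sum>b\<in>Basis. (u \<bullet> b) *\<^sub>R f b)"
proof -
  have "f u = f (\<Sum>b\<in>Basis. (u \<bullet> b) *\<^sub>R b)" by (simp add: euclidean_representation)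
  also have "\<dots> = (\<Sum>b\<in>Basis. (u \<bullet> b) *\<^sub>R f b)"
    using assms by (simp only: linear_sum linear_scale)
  finally show ?thesis .
qed

lemma linear_eq_inner_Basis:
  fixes f :: "'e::euclidean_space \<Rightarrow> real"
  assumes "linear f" shows "(\<Sum>b\<in>Basis. f b *\<^sub>R b) \<bullet> u = f u"
  unfolding linear_Basis_expand[OF assms, of u] inner_sum_left
  by (intro sum.cong) (simp_all add: inner_commute[of u])

text \<open>Product rule for a varying linear map applied to a varying vector. Expansion in the
  basis reduces differentiability of the family to that of its values on fixed vectors, which is the
  form in which it is known for \<open>fd u\<close> and \<open>levi u\<close>.\<close>

lemma has_derivative_linear_family:
  fixes G :: "'e::euclidean_space \<Rightarrow> 'f::euclidean_space \<Rightarrow> 'b::real_normed_vector"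
  assumes "open S" "x \<in> S" and lin: "\<And>y. y \<in> S \<Longrightarrow> linear (G y)"
    and dG: "\<And>v. (\<lambda>y. G y v) differentiable (at x)"
    and dX: "(X has_derivative X') (at x)"
  shows "((\<lambda>y. G y (X y)) has_derivative (\<lambda>h. fd (\<lambda>y. G y (X x)) x h + G x (X' h))) (at x)"
proof -
  have expand: "G y u = (\<Sum>b\<in>Basis. (u \<bullet> b) *\<^sub>R G y b)" if "y \<in> S" for y u
    by (rule linear_Basis_expand[OF lin[OF that]])
  have G': "((\<lambda>y. G y v) has_derivative fd (\<lambda>y. G y v) x) (at x)" for v
    using dG fd_has_derivative by blast
  have c: "((\<lambda>y. G y (X x)) has_derivative (\<lambda>h. \<Sum>b\<in>Basis. (X x \<bullet> b) *\<^sub>R fd (\<lambda>y. G y b) x h)) (at x)"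
    by (rule has_derivative_transform_within_open[OF _ assms(1,2), of "\<lambda>y. \<Sum>b\<in>Basis. (X x \<bullet> b) *\<^sub>R G y b"])
       (auto intro!: derivative_eq_intros G' simp: expand[of _ "X x", symmetric])
  have "((\<lambda>y. \<Sum>b\<in>Basis. (X y \<bullet> b) *\<^sub>R G y b) has_derivative
     (\<lambda>h. \<Sum>b\<in>Basis. (X x \<bullet> b) *\<^sub>R fd (\<lambda>y. G y b) x h + (X' h \<bullet> b) *\<^sub>R G x b)) (at x)"
    by (auto intro!: derivative_eq_intros G' dX)
  also have "(\<lambda>h. \<Sum>b\<in>Basis. (X x \<bullet> b) *\<^sub>R fd (\<lambda>y. G y b) x h + (X' h \<bullet> b) *\<^sub>R G x b) =
     (\<lambda>h. fd (\<lambda>y. G y (X x)) x h + G x (X' h))"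
    unfolding fd_eqI[OF c] using expand[OF \<open>x \<in> S\<close>, of "X' h" for h] by (simp add: sum.distrib)
  finally show ?thesis
    by (rule has_derivative_transform_within_open[OF _ assms(1,2)]) (rule expand[symmetric])
qed

section \<open>Calculus of finitely differentiable functions on open sets\<close>

lemma Ck_on_subset: "Ck_on n f S \<Longrightarrow> T \<subseteq> S \<Longrightarrow> Ck_on n f T"
  by (induction n arbitrary: f) (auto intro: continuous_on_subset)

lemma Ck_on_cong:
  assumes "open S" "\<And>x. x \<in> S \<Longrightarrow> f x = g x" "Ck_on n f S"
  shows "Ck_on n g S"
  using assms(2,3)
proof (induction n arbitrary: f g)
  case 0 then show ?case using continuous_on_cong[of S S f g] by simp
next
  case (Suc n)
  have "Ck_on n (\<lambda>x. fd g x v) S" for v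
    by (rule Suc.IH[of "\<lambda>x. fd f x v"]) (use Suc.prems fd_cong[OF assms(1) _ Suc.prems(1)] in auto)
  moreover have "g differentiable (at x)" if "x \<in> S" for x
    using differentiable_cong_open[OF assms(1) that Suc.prems(1)] Suc.prems(2) that by simp
  ultimately show ?case by simp
qed

lemma Ck_on_SucI:
  assumes "open S" "\<And>x. x \<in> S \<Longrightarrow> (f has_derivative D x) (at x)" "\<And>v. Ck_on n (\<lambda>x. D x v) S"
  shows "Ck_on (Suc n) f S"
proof -
  have "Ck_on n (\<lambda>x. fd f x v) S" for v
    by (rule Ck_on_cong[OF assms(1) _ assms(3)[of v]]) (simp add: fd_eqI[OF assms(2)])
  moreover have "f differentiable (at x)" if "x \<in> S" for x
    using assms(2)[OF that] unfolding differentiable_def by blast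
  ultimately show ?thesis by simp
qed

lemma Ck_on_SucD: "Ck_on (Suc n) f S \<Longrightarrow> Ck_on n f S"
proof (induction n arbitrary: f)
  case 0 then show ?case
    by (auto intro!: continuous_at_imp_continuous_on differentiable_imp_continuous_within)
next
  case (Suc n)
  then have "\<forall>v. Ck_on n (\<lambda>x. fd f x v) S" using Suc.IH by simp
  then show ?case using Suc.prems by simp
qed

lemma Ck_on_le: "Ck_on n f S \<Longrightarrow> m \<le> n \<Longrightarrow> Ck_on m f S"
  by (induction n) (auto simp: le_Suc_eq dest: Ck_on_SucD simp del: Ck_on.simps)

lemma Ck_on_imp_continuous_on: "Ck_on n f S \<Longrightarrow> continuous_on S f"
  using Ck_on_le[of n f S 0] by simp

lemma Ck_on_has_derivative: "Ck_on (Suc n) f S \<Longrightarrow> x \<in> S \<Longrightarrow> (f has_derivative fd f x) (at x)"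
  using fd_has_derivative[of f x] by simp

lemma Ck_on_local:
  assumes "\<And>x. x \<in> S \<Longrightarrow> \<exists>U. open U \<and> x \<in> U \<and> Ck_on n f U"
  shows "Ck_on n f S"
  using assms
proof (induction n arbitrary: f)
  case 0
  have "isCont f x" if "x \<in> S" for x
    using 0[OF that] continuous_on_eq_continuous_at by auto
  then show ?case by (simp add: continuous_at_imp_continuous_on)
next
  case (Suc n)
  have "Ck_on n (\<lambda>x. fd f x v) S" for v
    by (rule Suc.IH) (use Suc.prems in fastforce)
  then show ?case using Suc.prems by fastforce
qed

lemma Ck_on_const: "Ck_on n (\<lambda>x. c) S"
  by (induction n arbitrary: c) auto

lemma (in bounded_linear) Ck_on:
  fixes g :: "'e::real_normed_vector \<Rightarrow> 'a"
  assumes "open S" "Ck_on n g S" shows "Ck_on n (\<lambda>x. f (g x)) S"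
  using assms(2)
proof (induction n arbitrary: g)
  case 0 then show ?case using continuous_on by (simp add: continuous_on)
next
  case (Suc n)
  show ?case
    by (rule Ck_on_SucI[OF assms(1), of _ "\<lambda>x v. f (fd g x v)"])
       (use Suc in \<open>auto intro: has_derivative fd_has_derivative\<close>)
qed

lemma Ck_on_add:
  assumes "open S" "Ck_on n f S" "Ck_on n g S" shows "Ck_on n (\<lambda>x. f x + g x) S"
  using assms(2,3)
proof (induction n arbitrary: f g)
  case 0 then show ?case by (auto intro: continuous_intros)
next
  case (Suc n)
  show ?case
    by (rule Ck_on_SucI[OF assms(1), of _ "\<lambda>x v. fd f x v + fd g x v"])
       (use Suc in \<open>auto intro!: derivative_intros fd_has_derivative\<close>)
qed

lemma (in bounded_bilinear) Ck_on:
  fixes f :: "'e::real_normed_vector \<Rightarrow> 'a" and g :: "'e \<Rightarrow> 'b"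
  assumes "open S" "Ck_on n f S" "Ck_on n g S" shows "Ck_on n (\<lambda>x. prod (f x) (g x)) S"
  using assms(2,3)
proof (induction n arbitrary: f g)
  case 0 then show ?case by (simp add: continuous_on)
next
  case (Suc n)
  have fg: "Ck_on n f S" "Ck_on n g S" using Suc.prems Ck_on_SucD by blast+
  show ?case
  proof (rule Ck_on_SucI[OF assms(1), of _ "\<lambda>x v. prod (f x) (fd g x v) + prod (fd f x v) (g x)"])
    show "((\<lambda>x. prod (f x) (g x)) has_derivative (\<lambda>v. prod (f x) (fd g x v) + prod (fd f x v) (g x))) (at x)"
      if "x \<in> S" for x
      using FDERIV[OF Ck_on_has_derivative[OF Suc.prems(1) that] Ck_on_has_derivative[OF Suc.prems(2) that]] .
    show "Ck_on n (\<lambda>x. prod (f x) (fd g x v) + prod (fd f x v) (g x)) S" for v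
      by (intro Ck_on_add[OF assms(1)] Suc.IH) (use Suc.prems fg in auto)
  qed
qed

lemmas Ck_on_mult = bounded_bilinear.Ck_on[OF bounded_bilinear_mult]
lemmas Ck_on_scaleR = bounded_bilinear.Ck_on[OF bounded_bilinear_scaleR]
lemmas Ck_on_of_real = bounded_linear.Ck_on[OF bounded_linear_of_real]
lemmas Ck_on_cnj = bounded_linear.Ck_on[OF bounded_linear_cnj]
lemmas Ck_on_Re = bounded_linear.Ck_on[OF bounded_linear_Re]
lemmas Ck_on_Im = bounded_linear.Ck_on[OF bounded_linear_Im]
lemmas Ck_on_minus = bounded_linear.Ck_on[OF bounded_linear_minus[OF bounded_linear_ident]]

lemma Ck_on_diff:
  assumes "open S" "Ck_on n f S" "Ck_on n g S" shows "Ck_on n (\<lambda>x. f x - g x) S"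
  using Ck_on_add[OF assms(1,2) Ck_on_minus[OF assms(1,3)]] by simp

lemma Ck_on_sum:
  assumes "open S" "\<And>i. i \<in> I \<Longrightarrow> Ck_on n (f i) S" shows "Ck_on n (\<lambda>x. \<Sum>i\<in>I. f i x) S"
  using assms(2) by (induction I rule: infinite_finite_induct) (auto intro: Ck_on_const Ck_on_add[OF assms(1)])

lemma Ck_on_power:
  fixes f :: "'e::real_normed_vector \<Rightarrow> 'b::real_normed_algebra_1"
  assumes "open S" "Ck_on n f S" shows "Ck_on n (\<lambda>x. f x ^ k) S"
  by (induction k) (auto intro: Ck_on_const Ck_on_mult assms)

lemma Ck_on_inverse:
  fixes f :: "'e::real_normed_vector \<Rightarrow> 'b::real_normed_field"
  assumes "open S" "\<And>x. x \<in> S \<Longrightarrow> f x \<noteq> 0" "Ck_on n f S" shows "Ck_on n (\<lambda>x. inverse (f x)) S"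
  using assms(3)
proof (induction n)
  case 0 then show ?case using assms(2) by (auto intro: continuous_intros)
next
  case (Suc n)
  have i: "Ck_on n (\<lambda>x. inverse (f x)) S" using Suc Ck_on_SucD by blast
  show ?case
  proof (rule Ck_on_SucI[OF assms(1), of _ "\<lambda>x v. - (inverse (f x) * fd f x v * inverse (f x))"])
    show "((\<lambda>x. inverse (f x)) has_derivative (\<lambda>v. - (inverse (f x) * fd f x v * inverse (f x)))) (at x)"
      if "x \<in> S" for x
      using Deriv.has_derivative_inverse[OF assms(2)[OF that] Ck_on_has_derivative[OF Suc.prems that]] .
    show "Ck_on n (\<lambda>x. - (inverse (f x) * fd f x v * inverse (f x))) S" for v
      by (intro Ck_on_minus Ck_on_mult assms i) (use Suc.prems in auto)
  qed
qed

lemma Ck_on_ln: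
  fixes f :: "'e::real_normed_vector \<Rightarrow> real"
  assumes "open S" "\<And>x. x \<in> S \<Longrightarrow> f x > 0" "Ck_on n f S" shows "Ck_on n (\<lambda>x. ln (f x)) S"
proof (cases n)
  case 0 then show ?thesis using assms(2,3) by (force intro!: continuous_intros)
next
  case (Suc m)
  show ?thesis unfolding Suc
  proof (rule Ck_on_SucI[OF assms(1), of _ "\<lambda>x v. inverse (f x) * fd f x v"])
    show "((\<lambda>x. ln (f x)) has_derivative (\<lambda>v. inverse (f x) * fd f x v)) (at x)" if "x \<in> S" for x
      using Ck_on_has_derivative[OF assms(3)[unfolded Suc] that] assms(2)[OF that]
      by (auto intro!: derivative_eq_intros simp: field_simps)
    show "Ck_on m (\<lambda>x. inverse (f x) * fd f x v) S" for v
      using assms(2) Ck_on_SucD[OF assms(3)[unfolded Suc]] assms(3)[unfolded Suc]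
      by (intro Ck_on_mult Ck_on_inverse assms(1)) force+
  qed
qed

text \<open>At 0 the difference quotient of the squared positive part is at most
  \<open>\<bar>h\<bar>\<close>, so squaring removes the corner. This is the profile of the bump
  functions.\<close>

lemma Ck_on_pos_part_square:
  fixes f :: "'e::real_normed_vector \<Rightarrow> real"
  assumes "open S" "Ck_on 1 f S" shows "Ck_on 1 (\<lambda>x. (max 0 (f x))\<^sup>2) S"
proof -
  have D: "((\<lambda>y. (max 0 y)\<^sup>2) has_real_derivative 2 * max 0 y) (at y)" for y :: real
  proof (cases "y = 0")
    case True
    have "((\<lambda>h. ((max 0 (0 + h))\<^sup>2 - (max 0 0)\<^sup>2) / h) \<longlongrightarrow> 0) (at (0::real))"
    proof (rule Lim_null_comparison[where g="\<lambda>h. \<bar>h\<bar>"])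
      show "\<forall>\<^sub>F h in at (0::real). norm (((max 0 (0 + h))\<^sup>2 - (max 0 0)\<^sup>2) / h) \<le> \<bar>h\<bar>"
        by (intro always_eventually) (auto simp: max_def power2_eq_square)
      show "((\<lambda>h. \<bar>h\<bar>) \<longlongrightarrow> 0) (at (0::real))" by (rule tendsto_rabs_zero[OF tendsto_ident_at])
    qed
    then show ?thesis unfolding True DERIV_def by simp
  next
    case False
    show ?thesis
    proof (cases "y > 0")
      case True
      have "((\<lambda>y. y\<^sup>2) has_real_derivative 2 * max 0 y) (at y)"
        using True by (auto intro!: derivative_eq_intros)
      then show ?thesis
        by (rule has_field_derivative_transform_within_open[where S="{0<..}"]) (use True in auto)
    next
      case f: False
      have "((\<lambda>y. 0) has_real_derivative 2 * max 0 y) (at y)"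
        using f by (auto intro!: derivative_eq_intros)
      then show ?thesis
        by (rule has_field_derivative_transform_within_open[where S="{..<0}"]) (use f False in auto)
    qed
  qed
  show ?thesis unfolding One_nat_def
  proof (rule Ck_on_SucI[OF assms(1), of _ "\<lambda>x v. 2 * max 0 (f x) * fd f x v"])
    show "((\<lambda>x. (max 0 (f x))\<^sup>2) has_derivative (\<lambda>v. 2 * max 0 (f x) * fd f x v)) (at x)" if "x \<in> S" for x
      using has_derivative_compose[OF Ck_on_has_derivative[OF assms(2)[unfolded One_nat_def] that]
         D[unfolded has_field_derivative_def]] by simp
    show "Ck_on 0 (\<lambda>x. 2 * max 0 (f x) * fd f x v) S" for v
      using assms(2) Ck_on_imp_continuous_on[OF assms(2)] by (auto intro!: continuous_intros)
  qed
qed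

section \<open>Smooth functions and complex coordinate vectors\<close>

lemma smooth_on_differentiable: "smooth_on f S \<Longrightarrow> x \<in> S \<Longrightarrow> f differentiable (at x)"
  unfolding smooth_on_def using Ck_on.simps(2)[of 0 f S] by blast

lemma smooth_on_fd: "smooth_on f S \<Longrightarrow> smooth_on (\<lambda>x. fd f x v) S"
  unfolding smooth_on_def using Ck_on.simps(2)[of _ f S] by blast

lemma smooth_on_hess: "smooth_on f S \<Longrightarrow> smooth_on (\<lambda>x. hess f x v w) S"
  unfolding hess_def by (intro smooth_on_fd)

lemma smooth_on_hess_commute:
  fixes f :: "'e::real_normed_vector \<Rightarrow> real"
  assumes "open S" "smooth_on f S" "x \<in> S"
  shows "hess f x v w = hess f x w v"
  using assms by (intro hess_commute[of S]) (auto intro: smooth_on_differentiable smooth_on_fd)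

lemma smooth_on_linear_fd: "smooth_on f S \<Longrightarrow> x \<in> S \<Longrightarrow> linear (fd f x)"
  by (simp add: linear_frechet_derivative smooth_on_differentiable)

lemma smooth_on_linear_hess1: "smooth_on f S \<Longrightarrow> x \<in> S \<Longrightarrow> linear (\<lambda>v. hess f x v w)"
  unfolding hess_def by (intro smooth_on_linear_fd smooth_on_fd)

lemma smooth_on_linear_hess2:
  fixes f :: "'e::real_normed_vector \<Rightarrow> real"
  assumes "open S" "smooth_on f S" "x \<in> S"
  shows "linear (\<lambda>w. hess f x v w)"
  using smooth_on_linear_hess1[OF assms(2,3), of v] smooth_on_hess_commute[OF assms] by simp

lemma norm_vector_smult [simp]: "norm (c *s (v::complex^'m::finite)) = cmod c * norm v"
  unfolding norm_vec_def by (simp add: norm_mult L2_set_right_distrib)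

lemma smult_i_i [simp]: "\<i> *s (\<i> *s (v::complex^'m::finite)) = - v"
  by (simp add: vec_eq_iff)

lemma linear_smult: "linear (\<lambda>v::complex^'m::finite. c *s v)"
  by (rule linearI) (auto simp: vec_eq_iff algebra_simps)

lemma has_derivative_vecI:
  fixes f :: "'e::real_normed_vector \<Rightarrow> complex^'m::finite"
  assumes "\<And>j. ((\<lambda>x. f x $ j) has_derivative (\<lambda>h. D h $ j)) (at x within S)"
  shows "(f has_derivative D) (at x within S)"
  unfolding has_derivative_componentwise_within[of f D]
proof
  fix b :: "complex^'m" assume "b \<in> Basis"
  then obtain i u where b: "b = axis i u" unfolding Basis_vec_def by blast
  have "((\<lambda>x. (f x $ i) \<bullet> u) has_derivative (\<lambda>h. (D h $ i) \<bullet> u)) (at x within S)"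
    using assms by (intro derivative_intros)
  then show "((\<lambda>x. f x \<bullet> b) has_derivative (\<lambda>h. D h \<bullet> b)) (at x within S)"
    unfolding b by (simp add: inner_axis)
qed

lemma has_derivative_vecD:
  fixes f :: "'e::real_normed_vector \<Rightarrow> complex^'m::finite"
  assumes "(f has_derivative D) F"
  shows "((\<lambda>x. f x $ j) has_derivative (\<lambda>h. D h $ j)) F"
  using bounded_linear.has_derivative[OF bounded_linear_vec_nth assms] .

section \<open>Holomorphic functions of several variables\<close>

lemma holo_on_has_derivative: "holo_on f S \<Longrightarrow> x \<in> S \<Longrightarrow> (f has_derivative fd f x) (at x)"
  unfolding holo_on_def by (metis fd_has_derivative differentiable_def)

lemma holo_on_smult: "holo_on f S \<Longrightarrow> x \<in> S \<Longrightarrow> fd f x (c *s v) = c * fd f x v"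
  unfolding holo_on_def by (metis fd_eqI)

lemma holo_onI:
  assumes "\<And>x. x \<in> S \<Longrightarrow> (f has_derivative D x) (at x)" "\<And>x c v. x \<in> S \<Longrightarrow> D x (c *s v) = c * D x v"
  shows "holo_on f S"
  unfolding holo_on_def using assms by blast

lemma real_linear_complex_homogeneous:
  fixes D :: "complex^'m::finite \<Rightarrow> complex"
  assumes "linear D" "\<And>v. D (\<i> *s v) = \<i> * D v"
  shows "D (c *s v) = c * D v"
proof -
  have "c *s v = Re c *\<^sub>R v + Im c *\<^sub>R (\<i> *s v)"
    by (simp add: vec_eq_iff complex_eq_iff)
  then have "D (c *s v) = Re c *\<^sub>R D v + Im c *\<^sub>R (\<i> * D v)"
    using assms by (simp add: linear_add linear_scale)
  also have "\<dots> = c * D v" by (simp add: complex_eq_iff)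
  finally show ?thesis .
qed

lemma holo_onI_i:
  assumes "\<And>x. x \<in> S \<Longrightarrow> (f has_derivative D x) (at x)"
    "\<And>x v. x \<in> S \<Longrightarrow> D x (\<i> *s v) = \<i> * D x v"
  shows "holo_on f S"
  using assms(1) real_linear_complex_homogeneous[OF has_derivative_linear[OF assms(1)] assms(2)]
  by (rule holo_onI)

lemma holo_on_subset: "holo_on f S \<Longrightarrow> T \<subseteq> S \<Longrightarrow> holo_on f T"
  unfolding holo_on_def by blast

lemma holo_on_local:
  assumes "\<And>x. x \<in> S \<Longrightarrow> \<exists>U. x \<in> U \<and> holo_on f U"
  shows "holo_on f S"
  using assms unfolding holo_on_def by blast

lemma holo_on_cong:
  assumes "open S" "\<And>x. x \<in> S \<Longrightarrow> f x = g x" "holo_on f S"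
  shows "holo_on g S"
  unfolding holo_on_def
proof
  fix x assume x: "x \<in> S"
  then obtain D where D: "(f has_derivative D) (at x)" "\<forall>c v. D (c *s v) = c * D v"
    using assms(3) unfolding holo_on_def by blast
  from has_derivative_transform_within_open[OF D(1) assms(1) x assms(2)] D(2)
  show "\<exists>D. (g has_derivative D) (at x) \<and> (\<forall>c v. D (c *s v) = c * D v)" by blast
qed

lemma holo_on_continuous_on: "holo_on f S \<Longrightarrow> continuous_on S f"
  by (meson continuous_at_imp_continuous_on holo_on_has_derivative has_derivative_continuous)

lemma holo_on_const: "holo_on (\<lambda>x. c) S"
  by (rule holo_onI[of _ _ "\<lambda>x v. 0"]) auto

lemma holo_on_add: "holo_on f S \<Longrightarrow> holo_on g S \<Longrightarrow> holo_on (\<lambda>x. f x + g x) S"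
  by (rule holo_onI[of _ _ "\<lambda>x v. fd f x v + fd g x v"])
     (auto intro!: derivative_intros holo_on_has_derivative simp: holo_on_smult algebra_simps)

lemma holo_on_mult: "holo_on f S \<Longrightarrow> holo_on g S \<Longrightarrow> holo_on (\<lambda>x. f x * g x) S"
  by (rule holo_onI[of _ _ "\<lambda>x v. f x * fd g x v + fd f x v * g x"])
     (auto intro!: has_derivative_mult holo_on_has_derivative simp: holo_on_smult distrib_left)

lemma holo_on_cmult: "holo_on f S \<Longrightarrow> holo_on (\<lambda>x. c * f x) S"
  by (intro holo_on_mult holo_on_const)

lemma holo_on_diff: "holo_on f S \<Longrightarrow> holo_on g S \<Longrightarrow> holo_on (\<lambda>x. f x - g x) S"
  using holo_on_add[of f S "\<lambda>x. (-1) * g x"] holo_on_cmult[of g S "-1"] by simp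

lemma holo_on_power: "holo_on f S \<Longrightarrow> holo_on (\<lambda>x. f x ^ k) S"
  by (induction k) (auto intro: holo_on_const holo_on_mult)

lemma holo_on_inverse:
  assumes "\<And>x. x \<in> S \<Longrightarrow> f x \<noteq> 0" "holo_on f S" shows "holo_on (\<lambda>x. inverse (f x)) S"
proof (rule holo_onI[of _ _ "\<lambda>x v. - (inverse (f x) * fd f x v * inverse (f x))"])
  show "((\<lambda>x. inverse (f x)) has_derivative (\<lambda>v. - (inverse (f x) * fd f x v * inverse (f x)))) (at x)"
    if "x \<in> S" for x
    using Deriv.has_derivative_inverse[OF assms(1)[OF that] holo_on_has_derivative[OF assms(2) that]] .
qed (use assms(2) in \<open>auto simp: holo_on_smult\<close>)

lemma holo_on_line:
  assumes "holo_on f S" "x + \<zeta> *s v \<in> S"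
  shows "((\<lambda>\<zeta>. f (x + \<zeta> *s v)) has_field_derivative fd f (x + \<zeta> *s v) v) (at \<zeta>)"
proof -
  have "((\<lambda>\<zeta>. x + \<zeta> *s v) has_derivative (\<lambda>h. h *s v)) (at \<zeta>)"
    by (rule has_derivative_vecI) (auto intro!: derivative_eq_intros)
  note has_derivative_compose[OF this holo_on_has_derivative[OF assms]]
  moreover have "(\<lambda>h. fd f (x + \<zeta> *s v) (h *s v)) = (*) (fd f (x + \<zeta> *s v) v)"
    by (auto simp: holo_on_smult[OF assms])
  ultimately have "((\<lambda>\<zeta>. f (x + \<zeta> *s v)) has_derivative (*) (fd f (x + \<zeta> *s v) v)) (at \<zeta>)"
    by simp
  then show ?thesis unfolding has_field_derivative_def .
qed

text \<open>One-variable Cauchy inequality for the restriction to the complex line through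
  \<open>x\<close> along \<open>v\<close>.\<close>

lemma holo_on_cauchy_estimate:
  assumes f: "holo_on f S" and S: "cball x r \<subseteq> S" and r: "r > 0"
    and B: "\<And>y. y \<in> cball x r \<Longrightarrow> norm (f y) \<le> B"
  shows "norm (fd f x v) \<le> B / r * norm v"
proof (cases "v = 0")
  case True
  have "x \<in> S" using S r by auto
  then have "fd f x v = 0"
    using True linear_0[OF has_derivative_linear[OF holo_on_has_derivative[OF f]]] by simp
  then show ?thesis using True by simp
next
  case False
  \<comment> \<open>The largest radius for which the disc of points \<open>x + \<zeta> *s v\<close>
    stays in \<open>cball x r\<close>.\<close>
  define \<rho> where "\<rho> = r / norm v"
  have \<rho>: "\<rho> > 0" using False r unfolding \<rho>_def by simp
  have mem: "x + \<zeta> *s v \<in> cball x r" if "\<zeta> \<in> cball 0 \<rho>" for \<zeta>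
    using that False unfolding \<rho>_def by (simp add: dist_norm field_simps)
  define g where "g \<zeta> = f (x + \<zeta> *s v)" for \<zeta>
  have der: "(g has_field_derivative fd f (x + \<zeta> *s v) v) (at \<zeta>)" if "\<zeta> \<in> cball 0 \<rho>" for \<zeta>
    unfolding g_def using mem[OF that] S by (intro holo_on_line[OF f]) auto
  have "norm ((deriv ^^ 1) g 0) \<le> fact 1 * B / \<rho> ^ 1"
  proof (rule Cauchy_inequality[OF _ _ \<rho>])
    show "g holomorphic_on ball 0 \<rho>"
      unfolding holomorphic_on_def using der
      by (meson ball_subset_cball field_differentiable_at_within field_differentiable_def subset_iff)
    show "continuous_on (cball 0 \<rho>) g"
      using der by (meson DERIV_isCont continuous_at_imp_continuous_on)
    show "norm (g \<zeta>) \<le> B" if "norm (0 - \<zeta>) = \<rho>" for \<zeta>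
      unfolding g_def using that by (intro B mem) auto
  qed
  moreover have "deriv g 0 = fd f x v" using DERIV_imp_deriv[OF der[of 0]] \<rho> by simp
  ultimately show ?thesis unfolding \<rho>_def by simp
qed

text \<open>By Cauchy's estimate the derivatives converge uniformly as well.\<close>

lemma holo_on_uniform_limit:
  fixes f :: "nat \<Rightarrow> complex^'m::finite \<Rightarrow> complex"
  assumes f: "\<And>n. holo_on (f n) (ball x R)" and R: "R > 0"
    and lim: "uniform_limit (ball x R) f g sequentially"
  shows "holo_on g (ball x (R/2))"
proof -
  define U where "U = ball x (R/2)"
  have sub: "cball y (R/4) \<subseteq> ball x R" if "y \<in> U" for y
  proof
    fix z assume "z \<in> cball y (R/4)"
    then have "dist x z \<le> dist x y + R/4" using dist_triangle[of x z y] by simp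
    then show "z \<in> ball x R" using that R unfolding U_def by simp
  qed
  have US: "U \<subseteq> ball x R" unfolding U_def using R by (intro subset_ball) auto
  have est: "\<exists>N. \<forall>m\<ge>N. \<forall>n\<ge>N. \<forall>y\<in>U. \<forall>h. norm (fd (f m) y h - fd (f n) y h) \<le> e * norm h"
    if e: "e > 0" for e
  proof -
    \<comment> \<open>Two members within \<open>e * R / 8\<close> of \<open>g\<close> differ by at
      most \<open>e * R / 4\<close>, and the Cauchy estimate on balls of radius \<open>R / 4\<close>
      turns this into \<open>e\<close>.\<close>
    have "e * R / 8 > 0" using e R by simp
    then have "\<forall>\<^sub>F n in sequentially. \<forall>y\<in>ball x R. dist (f n y) (g y) < e * R / 8"
      using lim unfolding uniform_limit_iff by blast
    then obtain N where N: "\<And>n y. n \<ge> N \<Longrightarrow> y \<in> ball x R \<Longrightarrow> dist (f n y) (g y) < e * R / 8"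
      unfolding eventually_sequentially by blast
    have "norm (fd (f m) y h - fd (f n) y h) \<le> e * norm h" if mn: "m \<ge> N" "n \<ge> N" and y: "y \<in> U" for m n y h
    proof -
      have yS: "y \<in> ball x R" using y US by blast
      have d: "((\<lambda>y. f m y - f n y) has_derivative (\<lambda>h. fd (f m) y h - fd (f n) y h)) (at y)"
        using f yS by (intro derivative_intros holo_on_has_derivative)
      have "norm (fd (\<lambda>y. f m y - f n y) y h) \<le> (e * R / 4) / (R/4) * norm h"
      proof (rule holo_on_cauchy_estimate[OF holo_on_diff[OF f f] sub[OF y]])
        show "norm (f m z - f n z) \<le> e * R / 4" if "z \<in> cball y (R/4)" for z
        proof -
          have "z \<in> ball x R" using that sub[OF y] by blast
          from N[OF mn(1) this] N[OF mn(2) this] show ?thesis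
            using dist_triangle2[of "f m z" "f n z" "g z"] by (simp add: dist_norm)
        qed
      qed (use R in simp)
      then show ?thesis unfolding fd_eqI[OF d] using R by simp
    qed
    then show ?thesis by blast
  qed
  define g' where "g' y h = lim (\<lambda>n. fd (f n) y h)" for y h
  have conv: "(\<lambda>n. fd (f n) y h) \<longlonglongrightarrow> g' y h" if "y \<in> U" for y h
  proof -
    have "Cauchy (\<lambda>n. fd (f n) y h)"
    proof (rule CauchyI)
      fix e :: real assume e: "e > 0"
      define e' where "e' = e / (norm h + 1)"
      have "e' > 0" using e unfolding e'_def by (simp add: add_nonneg_pos)
      then obtain N where N: "\<forall>m\<ge>N. \<forall>n\<ge>N. \<forall>y\<in>U. \<forall>h. norm (fd (f m) y h - fd (f n) y h) \<le> e' * norm h"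
        using est by blast
      have "1 + norm h > 0" by (smt (verit) norm_ge_zero)
      then have "e' * norm h < e" unfolding e'_def using e
        by (simp add: field_simps)
      then show "\<exists>M. \<forall>m\<ge>M. \<forall>n\<ge>M. norm (fd (f m) y h - fd (f n) y h) < e"
        using N that by (meson le_less_trans)
    qed
    then show ?thesis unfolding g'_def by (simp add: Cauchy_convergent_iff convergent_LIMSEQ_iff)
  qed
  have unif: "\<forall>\<^sub>F n in sequentially. \<forall>y\<in>U. \<forall>h. norm (fd (f n) y h - g' y h) \<le> e * norm h" if e: "e > 0" for e
  proof -
    obtain N where N: "\<forall>m\<ge>N. \<forall>n\<ge>N. \<forall>y\<in>U. \<forall>h. norm (fd (f m) y h - fd (f n) y h) \<le> e * norm h"
      using est[OF e] by blast
    have "norm (fd (f n) y h - g' y h) \<le> e * norm h" if "n \<ge> N" "y \<in> U" for n y h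
    proof (rule LIMSEQ_le_const2)
      show "(\<lambda>m. norm (fd (f n) y h - fd (f m) y h)) \<longlonglongrightarrow> norm (fd (f n) y h - g' y h)"
        by (intro tendsto_intros conv that)
    qed (use N that in blast)
    then show ?thesis unfolding eventually_sequentially by blast
  qed
  have point: "(\<lambda>n. f n y) \<longlonglongrightarrow> g y" if "y \<in> U" for y
    using tendsto_uniform_limitI[OF lim] that US by blast
  have x: "x \<in> U" unfolding U_def using R by simp
  have "\<exists>g0. \<forall>y\<in>U. (\<lambda>n. f n y) \<longlonglongrightarrow> g0 y \<and> (g0 has_derivative g' y) (at y within U)"
  proof (rule has_derivative_sequence)
    show "x \<in> U" "(\<lambda>n. f n x) \<longlonglongrightarrow> g x" using x point by auto
    show "\<forall>\<^sub>F n in sequentially. \<forall>y\<in>U. \<forall>h. norm (fd (f n) y h - g' y h) \<le> e * norm h" if "e > 0" for e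
      using unif[OF that] .
    show "convex U" unfolding U_def by simp
    show "(f n has_derivative fd (f n) y) (at y within U)" if "y \<in> U" for n y
      using holo_on_has_derivative[OF f] that US by (blast intro: has_derivative_at_withinI)
  qed
  \<comment> \<open>The theorem on sequences of derivatives produces a limit function of its own;
    pointwise convergence identifies it with \<open>g\<close>.\<close>
  then obtain g0 where g0: "\<And>y. y \<in> U \<Longrightarrow> (\<lambda>n. f n y) \<longlonglongrightarrow> g0 y"
      "\<And>y. y \<in> U \<Longrightarrow> (g0 has_derivative g' y) (at y within U)" by blast
  have g0g: "g0 y = g y" if "y \<in> U" for y using LIMSEQ_unique[OF g0(1) point] that by blast
  show ?thesis unfolding U_def[symmetric]
  proof (rule holo_onI[where D=g'])
    fix y assume y: "y \<in> U"
    have "(g0 has_derivative g' y) (at y)"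
      using g0(2)[OF y] at_within_open[OF y] unfolding U_def by simp
    then show "(g has_derivative g' y) (at y)"
      by (rule has_derivative_transform_within_open[where s=U]) (use y g0g U_def in auto)
    show "g' y (c *s v) = c * g' y v" for c v
    proof (rule LIMSEQ_unique[OF conv[OF y]])
      have "(\<lambda>n. c * fd (f n) y v) \<longlonglongrightarrow> c * g' y v" by (intro tendsto_intros conv y)
      then show "(\<lambda>n. fd (f n) y (c *s v)) \<longlonglongrightarrow> c * g' y v"
        using holo_on_smult[OF f, of y] y US by (simp add: subset_iff)
    qed
  qed
qed

text \<open>Taylor's formula on the complex line through \<open>y\<close>. The second derivative on
  the unit disc is bounded by Cauchy's inequality on discs of radius 1, which reach out to radius 2;
  hence the ball of radius \<open>2 * norm v\<close> and the constant
  \<open>fact 2 * B\<close>.\<close>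

lemma holo_on_second_order_bound:
  assumes f: "holo_on f S" and S: "cball y (2 * norm v) \<subseteq> S"
    and B: "\<And>z. z \<in> cball y (2 * norm v) \<Longrightarrow> norm (f z) \<le> B"
    and \<zeta>: "norm \<zeta> < 1"
  shows "norm (f (y + \<zeta> *s v) - f y - \<zeta> * fd f y v) \<le> 2 * B * (norm \<zeta>)\<^sup>2"
proof -
  define g where "g \<zeta> = f (y + \<zeta> *s v)" for \<zeta>
  have mem: "y + \<xi> *s v \<in> cball y (2 * norm v)" if "norm \<xi> \<le> 2" for \<xi>
    using that by (simp add: dist_norm mult_right_mono)
  have der: "(g has_field_derivative fd f (y + \<xi> *s v) v) (at \<xi>)" if "norm \<xi> \<le> 2" for \<xi>
    unfolding g_def using mem[OF that] S by (intro holo_on_line[OF f]) auto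
  have hol: "g holomorphic_on ball 0 2"
    unfolding holomorphic_on_def using der
    by (metis field_differentiable_at_within field_differentiable_def less_imp_le mem_ball_0)
  have cont: "continuous_on (cball 0 2) g"
    using der by (metis DERIV_isCont continuous_at_imp_continuous_on mem_cball_0)
  have bd: "norm ((deriv ^^ 2) g \<xi>) \<le> 2 * B" if "\<xi> \<in> ball 0 1" for \<xi>
  proof -
    have sub: "cball \<xi> 1 \<subseteq> ball 0 2"
    proof
      fix z assume "z \<in> cball \<xi> 1"
      then show "z \<in> ball 0 2" using that norm_triangle_ineq2[of z \<xi>] by (simp add: dist_norm norm_minus_commute)
    qed
    have "norm ((deriv ^^ 2) g \<xi>) \<le> fact 2 * B / 1 ^ 2"
    proof (rule Cauchy_inequality)
      show "g holomorphic_on ball \<xi> 1" using hol sub by (meson ball_subset_cball holomorphic_on_subset order_trans)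
      show "continuous_on (cball \<xi> 1) g"
        by (rule holomorphic_on_imp_continuous_on[OF holomorphic_on_subset[OF hol sub]])
      show "norm (g x) \<le> B" if "norm (\<xi> - x) = 1" for x
      proof -
        have "x \<in> cball \<xi> 1" using that by (simp add: dist_norm)
        then have "norm x \<le> 2" using sub by fastforce
        then show ?thesis unfolding g_def by (intro B mem)
      qed
    qed simp
    then show ?thesis by simp
  qed
  have "cmod ((deriv ^^ 0) g \<zeta> - (\<Sum>i\<le>1. (deriv ^^ i) g 0 * (\<zeta> - 0) ^ i / fact i))
      \<le> (2 * B) * cmod (\<zeta> - 0) ^ Suc 1 / fact 1"
  proof (rule complex_Taylor[where S="ball 0 1"])
    show "((deriv ^^ i) g has_field_derivative (deriv ^^ Suc i) g x) (at x within ball 0 1)"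
      if "x \<in> ball 0 1" "i \<le> 1" for i x
    proof -
      have "(deriv ^^ i) g holomorphic_on ball 0 2"
        by (rule holomorphic_higher_deriv[OF hol]) simp
      then have "((deriv ^^ i) g has_field_derivative deriv ((deriv ^^ i) g) x) (at x)"
        using that by (intro holomorphic_derivI[where S="ball 0 2"]) auto
      then show ?thesis by (simp add: has_field_derivative_at_within)
    qed
  qed (use bd \<zeta> in \<open>auto simp: numeral_2_eq_2\<close>)
  moreover have "deriv g 0 = fd f y v" using DERIV_imp_deriv[OF der[of 0]] by simp
  ultimately show ?thesis unfolding g_def by (simp add: power2_eq_square algebra_simps)
qed

text \<open>A directional derivative is, near each point, the uniform limit of holomorphic
  difference quotients; the quadratic remainder bound makes the convergence uniform.\<close>

lemma holo_on_fd:
  assumes f: "holo_on f S" and S: "open S"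
  shows "holo_on (\<lambda>x. fd f x v) S"
proof (rule holo_on_local)
  fix x assume x: "x \<in> S"
  obtain r0 where r0: "r0 > 0" "cball x r0 \<subseteq> S" using S x open_contains_cball by blast
  define R where "R = r0 / 2"
  have R: "R > 0" using r0 unfolding R_def by simp
  \<comment> \<open>For nonzero \<open>v\<close> this is the rescaled direction of length
    \<open>R / 2\<close>, so that \<open>cball y (2 * norm v')\<close> stays in
    \<open>cball x r0\<close> for all \<open>y\<close> in \<open>ball x R\<close>. Complex
    homogeneity restores \<open>v\<close> at the end.\<close>
  define v' where "v' = (if v = 0 then 0 else complex_of_real (R / (2 * norm v)) *s v)"
  have v': "2 * norm v' \<le> R"
  proof (cases "v = 0")
    case False
    have "norm (complex_of_real (R / (2 * norm v))) = R / (2 * norm v)"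
      using R by (simp only: norm_of_real) simp
    then show ?thesis unfolding v'_def norm_vector_smult using False by simp
  qed (use R v'_def in simp)
  obtain c where c: "v = c *s v'"
  proof (cases "v = 0")
    case False
    then have "v = complex_of_real (2 * norm v / R) *s v'"
      unfolding v'_def using R by (simp add: vec_eq_iff)
    then show ?thesis using that by blast
  qed (use that v'_def in simp)
  obtain B where B: "\<And>y. y \<in> cball x r0 \<Longrightarrow> norm (f y) \<le> B"
  proof -
    have "compact (f ` cball x r0)"
      by (intro compact_continuous_image compact_cball continuous_on_subset[OF holo_on_continuous_on[OF f] r0(2)])
    then have "bounded (f ` cball x r0)" by (rule compact_imp_bounded)
    then show ?thesis using that unfolding bounded_iff by blast
  qed
  have sub: "cball y (2 * norm v') \<subseteq> cball x r0" if "y \<in> ball x R" for y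
  proof
    fix z assume "z \<in> cball y (2 * norm v')"
    then show "z \<in> cball x r0" using that v' dist_triangle[of x z y] unfolding R_def by simp
  qed
  \<comment> \<open>The offset 2 keeps the step \<open>1 / (n + 2)\<close> strictly below 1, as the
    remainder bound demands.\<close>
  define q where "q n y = of_nat (n+2) * (f (y + inverse (of_nat (n+2)) *s v') - f y)" for n y
  have inS: "y + inverse (of_nat (n+2)) *s v' \<in> S" if "y \<in> ball x R" for y n
  proof -
    have "norm (inverse (of_nat (n+2) :: complex)) \<le> 1"
      unfolding norm_inverse norm_of_nat by (simp add: field_simps)
    then have "norm (inverse (of_nat (n+2) :: complex)) * norm v' \<le> 2 * norm v'"
      by (intro mult_right_mono) auto
    then have "y + inverse (of_nat (n+2)) *s v' \<in> cball y (2 * norm v')" by (simp add: dist_norm)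
    then show ?thesis using sub[OF that] r0 by blast
  qed
  have yS: "y \<in> S" if "y \<in> ball x R" for y
    using that r0 unfolding R_def by (auto simp: subset_iff)
  have hq: "holo_on (q n) (ball x R)" for n
  proof -
    have t: "holo_on (\<lambda>y. f (y + inverse (of_nat (n+2)) *s v')) (ball x R)"
    proof (rule holo_onI)
      fix y assume y: "y \<in> ball x R"
      have "((\<lambda>y. y + inverse (of_nat (n+2)) *s v') has_derivative (\<lambda>h. h)) (at y)"
        by (auto intro!: derivative_eq_intros)
      from has_derivative_compose[OF this holo_on_has_derivative[OF f inS[OF y]]]
      show "((\<lambda>y. f (y + inverse (of_nat (n+2)) *s v')) has_derivative fd f (y + inverse (of_nat (n+2)) *s v')) (at y)" .
    qed (rule holo_on_smult[OF f inS])
    show ?thesis unfolding q_def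
      by (intro holo_on_cmult holo_on_diff t holo_on_subset[OF f]) (use yS in auto)
  qed
  have "uniform_limit (ball x R) q (\<lambda>y. fd f y v') sequentially"
  proof (rule uniform_limitI)
    fix e :: real assume e: "e > 0"
    have "(\<lambda>n. 2 * B * inverse (real (n+2))) \<longlonglongrightarrow> 2 * B * 0"
      by (intro tendsto_intros LIMSEQ_ignore_initial_segment[OF lim_inverse_n])
    then have "\<forall>\<^sub>F n in sequentially. 2 * B * inverse (real (n+2)) < e"
      using e by (simp add: order_tendsto_iff)
    then show "\<forall>\<^sub>F n in sequentially. \<forall>y\<in>ball x R. dist (q n y) (fd f y v') < e"
    proof (rule eventually_mono, intro ballI)
      fix n y assume n: "2 * B * inverse (real (n+2)) < e" and y: "y \<in> ball x R"
      define \<zeta> :: complex where "\<zeta> = inverse (of_nat (n+2))"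
      have n\<zeta>: "norm \<zeta> = inverse (real (n+2))" unfolding \<zeta>_def by (simp only: norm_inverse norm_of_nat)
      have z0: "of_nat (n+2) * \<zeta> = 1" unfolding \<zeta>_def
        by (rule right_inverse) (simp only: of_nat_eq_0_iff)
      have "norm (f (y + \<zeta> *s v') - f y - \<zeta> * fd f y v') \<le> 2 * B * (norm \<zeta>)\<^sup>2"
        by (rule holo_on_second_order_bound[OF f order_trans[OF sub[OF y] r0(2)]])
           (use B sub[OF y] in \<open>auto simp: n\<zeta> inverse_less_1_iff\<close>)
      then have "real (n+2) * norm (f (y + \<zeta> *s v') - f y - \<zeta> * fd f y v') \<le> real (n+2) * (2 * B * (norm \<zeta>)\<^sup>2)"
        by (rule mult_left_mono) simp
      also have "\<dots> = 2 * B * inverse (real (n+2))"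
      proof -
        have "real (n+2) * (2 * B * (norm \<zeta>)\<^sup>2) = 2 * B * norm \<zeta> * (real (n+2) * norm \<zeta>)"
          by (simp only: power2_eq_square mult_ac)
        moreover have "real (n+2) * norm \<zeta> = 1" unfolding n\<zeta> by (rule right_inverse) simp
        ultimately show ?thesis unfolding n\<zeta> by (simp only: mult_1_right)
      qed
      also have "real (n+2) * norm (f (y + \<zeta> *s v') - f y - \<zeta> * fd f y v')
         = norm (of_nat (n+2) * (f (y + \<zeta> *s v') - f y - \<zeta> * fd f y v'))"
        by (simp only: norm_mult norm_of_nat)
      also have "of_nat (n+2) * (f (y + \<zeta> *s v') - f y - \<zeta> * fd f y v') = q n y - fd f y v'"
      proof -
        have "of_nat (n+2) * (f (y + \<zeta> *s v') - f y - \<zeta> * fd f y v')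
          = of_nat (n+2) * (f (y + \<zeta> *s v') - f y) - (of_nat (n+2) * \<zeta>) * fd f y v'"
          by (simp only: right_diff_distrib mult.assoc)
        then show ?thesis by (simp only: z0 q_def \<zeta>_def[symmetric] mult_1_left)
      qed
      finally show "dist (q n y) (fd f y v') < e" using n by (simp add: dist_norm)
    qed
  qed
  from holo_on_uniform_limit[OF hq R this]
  have "holo_on (\<lambda>y. c * fd f y v') (ball x (R/2))" by (rule holo_on_cmult)
  then have "holo_on (\<lambda>y. fd f y v) (ball x (R/2))"
    by (rule holo_on_cong[OF open_ball, rotated])
       (use holo_on_smult[OF f] yS R in \<open>simp add: c\<close>)
  then show "\<exists>U. x \<in> U \<and> holo_on (\<lambda>y. fd f y v) U" using R by (intro exI[of _ "ball x (R/2)"]) auto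
qed

text \<open>Each directional derivative is again holomorphic, so the orders follow by induction.
  Holomorphic sections and the Hamiltonian field get their differentiability from here.\<close>

lemma holo_on_Ck_on:
  assumes "holo_on f S" "open S" shows "Ck_on n f S"
  using assms(1)
proof (induction n arbitrary: f)
  case 0 then show ?case by (simp add: holo_on_continuous_on)
next
  case (Suc n)
  show ?case
    by (rule Ck_on_SucI[OF assms(2), of _ "fd f"])
       (use Suc holo_on_fd[OF _ assms(2)] holo_on_has_derivative in auto)
qed

definition vholo_on :: "(complex^'m::finite \<Rightarrow> complex^'n::finite) \<Rightarrow> (complex^'m) set \<Rightarrow> bool" where
  "vholo_on T S \<longleftrightarrow> (\<forall>j. holo_on (\<lambda>x. T x $ j) S)"

lemma vholo_on_has_derivative:
  assumes "vholo_on T S" "x \<in> S" shows "(T has_derivative fd T x) (at x)"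
proof -
  have "(T has_derivative (\<lambda>h. \<chi> j. fd (\<lambda>x. T x $ j) x h)) (at x)"
    by (rule has_derivative_vecI) (use assms holo_on_has_derivative vholo_on_def in fastforce)
  then show ?thesis using fd_has_derivative differentiable_def by blast
qed

lemma vholo_on_fd_nth:
  assumes "vholo_on T S" "x \<in> S" shows "fd T x h $ j = fd (\<lambda>x. T x $ j) x h"
  by (simp add: fd_eqI[OF has_derivative_vecD[OF vholo_on_has_derivative[OF assms]]])

lemma vholo_on_smult:
  assumes "vholo_on T S" "x \<in> S" shows "fd T x (c *s v) = c *s fd T x v"
  using assms unfolding vholo_on_def by (simp add: vec_eq_iff vholo_on_fd_nth[OF assms] holo_on_smult[of _ S])

lemma vholo_on_fd:
  assumes "vholo_on T S" "open S" shows "vholo_on (\<lambda>x. fd T x v) S"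
  unfolding vholo_on_def
proof
  fix j
  have "holo_on (\<lambda>x. fd (\<lambda>x. T x $ j) x v) S"
    using assms vholo_on_def by (blast intro: holo_on_fd)
  then show "holo_on (\<lambda>x. fd T x v $ j) S"
    by (rule holo_on_cong[OF assms(2), rotated]) (simp add: vholo_on_fd_nth[OF assms(1)])
qed

lemma vholo_on_subset: "vholo_on T S \<Longrightarrow> U \<subseteq> S \<Longrightarrow> vholo_on T U"
  unfolding vholo_on_def using holo_on_subset by blast

text \<open>Both terms of the product rule are complex linear in the direction of
  differentiation.\<close>

lemma holo_on_linear_family:
  fixes G :: "complex^'m::finite \<Rightarrow> complex^'n::finite \<Rightarrow> complex"
  assumes "open S" "\<And>y. y \<in> S \<Longrightarrow> linear (G y)" "\<And>v. holo_on (\<lambda>y. G y v) S"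
    "\<And>y c v. y \<in> S \<Longrightarrow> G y (c *s v) = c * G y v" "vholo_on X S"
  shows "holo_on (\<lambda>y. G y (X y)) S"
proof (rule holo_onI)
  fix x assume x: "x \<in> S"
  show "((\<lambda>y. G y (X y)) has_derivative (\<lambda>h. fd (\<lambda>y. G y (X x)) x h + G x (fd X x h))) (at x)"
    by (rule has_derivative_linear_family[OF assms(1) x assms(2)])
       (use assms(3,5) x holo_on_has_derivative vholo_on_has_derivative differentiable_def in blast)+
  show "fd (\<lambda>y. G y (X x)) x (c *s v) + G x (fd X x (c *s v)) =
      c * (fd (\<lambda>y. G y (X x)) x v + G x (fd X x v))" for c v
    by (simp add: holo_on_smult[OF assms(3) x] vholo_on_smult[OF assms(5) x] assms(4)[OF x] distrib_left)
qed

section \<open>The Levi form\<close>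

text \<open>This is \<open>- \<i> \<partial> (cnj \<partial>) u\<close> as a real two-form, hence \<open>\<omega>\<close> if \<open>u\<close> is the logarithm of the weight.\<close>

definition levi :: "(complex^'m::finite \<Rightarrow> real) \<Rightarrow> complex^'m \<Rightarrow> complex^'m \<Rightarrow> complex^'m \<Rightarrow> real" where
  "levi u x X Y = (hess u x X (\<i> *s Y) - hess u x (\<i> *s X) Y) / 2"

lemma levi_cong:
  assumes "open S" "x \<in> S" "\<And>y. y \<in> S \<Longrightarrow> f y = g y"
  shows "levi f x = levi g x"
  by (simp add: levi_def fun_eq_iff hess_cong[OF assms])

text \<open>Differentiating the sum of squares of real and imaginary part avoids choosing a branch
  of \<open>log g\<close>, whose derivative would be \<open>dg / g\<close>.\<close>

lemma fd_ln_norm_square: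
  assumes g: "holo_on g S" and y: "y \<in> S" and nz: "g y \<noteq> 0"
  shows "fd (\<lambda>y. ln ((cmod (g y))\<^sup>2)) y w = 2 * Re (fd g y w / g y)"
proof -
  have eq: "ln ((cmod (g y))\<^sup>2) = ln ((Re (g y))\<^sup>2 + (Im (g y))\<^sup>2)" for y by (simp add: cmod_power2)
  have pos: "(Re (g y))\<^sup>2 + (Im (g y))\<^sup>2 > 0"
    using nz by (metis complex_neq_0)
  have dg: "(g has_derivative fd g y) (at y)" by (rule holo_on_has_derivative[OF g y])
  have "((\<lambda>y. ln ((Re (g y))\<^sup>2 + (Im (g y))\<^sup>2)) has_derivative
      (\<lambda>w. (2 * Re (g y) * Re (fd g y w) + 2 * Im (g y) * Im (fd g y w)) / ((Re (g y))\<^sup>2 + (Im (g y))\<^sup>2))) (at y)"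
    using pos by (auto intro!: derivative_eq_intros dg simp: field_simps)
  then have "fd (\<lambda>y. ln ((cmod (g y))\<^sup>2)) y w
      = (2 * Re (g y) * Re (fd g y w) + 2 * Im (g y) * Im (fd g y w)) / ((Re (g y))\<^sup>2 + (Im (g y))\<^sup>2)"
    unfolding eq by (simp add: fd_eqI)
  also have "\<dots> = 2 * Re (fd g y w / g y)"
    by (simp add: Re_divide add_divide_distrib mult_ac)
  finally show ?thesis .
qed

text \<open>The first derivative of \<open>log |g|^2\<close> along \<open>w\<close> is the real part
  of \<open>G w\<close>, which is holomorphic and complex linear in \<open>w\<close>. A factor
  \<open>\<i>\<close> in either slot of the Hessian has the same effect, so the difference in
  \<open>levi\<close> cancels. This makes the curvature form independent of the frame.\<close>

lemma levi_pluriharmonic: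
  assumes g: "holo_on g S" and S: "open S" and x: "x \<in> S" and nz: "\<And>y. y \<in> S \<Longrightarrow> g y \<noteq> 0"
  shows "levi (\<lambda>y. ln ((cmod (g y))\<^sup>2)) x X Y = 0"
proof -
  define u where "u y = ln ((cmod (g y))\<^sup>2)" for y
  define G where "G w y = 2 * fd g y w * inverse (g y)" for w y
  have hG: "holo_on (G w) S" for w
    unfolding G_def using g nz by (intro holo_on_mult holo_on_const holo_on_fd holo_on_inverse S) auto
  have du: "fd u y w = Re (G w y)" if y: "y \<in> S" for y w
    unfolding u_def G_def fd_ln_norm_square[OF g y nz[OF y]] by (simp add: divide_inverse mult.assoc)
  have h: "hess u x v w = Re (fd (G w) x v)" for v w
  proof -
    have "hess u x v w = fd (\<lambda>y. Re (G w y)) x v"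
      unfolding hess_def by (rule fun_cong[OF fd_cong[OF S x]]) (rule du)
    also have "\<dots> = Re (fd (G w) x v)"
      by (rule fun_cong[OF fd_eqI])
         (rule bounded_linear.has_derivative[OF bounded_linear_Re holo_on_has_derivative[OF hG x]])
    finally show ?thesis .
  qed
  have "G (\<i> *s Y) y = \<i> * G Y y" if "y \<in> S" for y
    unfolding G_def by (simp add: holo_on_smult[OF g that])
  then have "fd (G (\<i> *s Y)) x = fd (\<lambda>y. \<i> * G Y y) x" by (intro fd_cong[OF S x]) auto
  also have "\<dots> = (\<lambda>h. \<i> * fd (G Y) x h)"
    by (intro fd_eqI derivative_intros holo_on_has_derivative[OF hG x])
  finally show ?thesis unfolding u_def[symmetric] levi_def h by (simp add: holo_on_smult[OF hG x])
qed

lemma levi_add: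
  assumes "open S" "x \<in> S" "smooth_on f S" "smooth_on g S"
  shows "levi (\<lambda>y. f y + g y) x X Y = levi f x X Y + levi g x X Y"
proof -
  have 1: "fd (\<lambda>y. f y + g y) y w = fd f y w + fd g y w" if "y \<in> S" for y w
    using that assms(3,4)
    by (intro fun_cong[OF fd_eqI] derivative_intros fd_has_derivative smooth_on_differentiable)
  have "hess (\<lambda>y. f y + g y) x v w = hess f x v w + hess g x v w" for v w
  proof -
    have "hess (\<lambda>y. f y + g y) x v w = fd (\<lambda>y. fd f y w + fd g y w) x v"
      unfolding hess_def by (rule fun_cong[OF fd_cong[OF assms(1,2)]]) (rule 1)
    also have "\<dots> = hess f x v w + hess g x v w" unfolding hess_def
      using assms(2-4)
      by (intro fun_cong[OF fd_eqI] derivative_intros fd_has_derivative smooth_on_differentiable smooth_on_fd)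
    finally show ?thesis .
  qed
  then show ?thesis unfolding levi_def by (simp add: field_simps)
qed

text \<open>The second derivative of \<open>T\<close> is complex bilinear and hence drops out.\<close>

lemma levi_compose:
  fixes T :: "complex^'m::finite \<Rightarrow> complex^'n::finite"
  assumes S: "open S" and x: "x \<in> S" and V: "open V" and T: "vholo_on T S" "T ` S \<subseteq> V" and f: "smooth_on f V"
  shows "levi (\<lambda>y. f (T y)) x X Y = levi f (T x) (fd T x X) (fd T x Y)"
proof -
  have TV: "T y \<in> V" if "y \<in> S" for y using T that by blast
  have dT: "(T has_derivative fd T y) (at y)" if "y \<in> S" for y by (rule vholo_on_has_derivative[OF T(1) that])
  have df: "(f has_derivative fd f y) (at y)" if "y \<in> V" for y
    using f that by (intro fd_has_derivative smooth_on_differentiable)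
  have dfw: "((\<lambda>y. fd f y w) has_derivative (\<lambda>v. hess f y v w)) (at y)" if "y \<in> V" for y w
    unfolding hess_def using f that by (intro fd_has_derivative smooth_on_differentiable smooth_on_fd)
  have 1: "fd (\<lambda>y. f (T y)) y w = fd f (T y) (fd T y w)" if "y \<in> S" for y w
    using has_derivative_compose[OF dT[OF that] df[OF TV[OF that]]] by (simp add: fd_eqI)
  have h: "hess (\<lambda>y. f (T y)) x v w = hess f (T x) (fd T x v) (fd T x w) + fd f (T x) (hess T x v w)" for v w
  proof -
    have G: "((\<lambda>y. fd f (T y) u) has_derivative (\<lambda>h. hess f (T x) (fd T x h) u)) (at x)" for u
      using has_derivative_compose[OF dT[OF x] dfw[OF TV[OF x]]] .
    have T': "((\<lambda>y. fd T y w) has_derivative (\<lambda>h. hess T x h w)) (at x)"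
      unfolding hess_def using vholo_on_has_derivative[OF vholo_on_fd[OF T(1) S] x] .
    have "((\<lambda>y. fd f (T y) (fd T y w)) has_derivative
       (\<lambda>h. fd (\<lambda>y. fd f (T y) (fd T x w)) x h + fd f (T x) (hess T x h w))) (at x)"
      by (rule has_derivative_linear_family[OF S x _ _ T'])
         (use G TV df has_derivative_linear differentiable_def in blast)+
    then have "fd (\<lambda>y. fd f (T y) (fd T y w)) x v = hess f (T x) (fd T x v) (fd T x w) + fd f (T x) (hess T x v w)"
      unfolding fd_eqI[OF G] by (simp add: fd_eqI)
    moreover have "hess (\<lambda>y. f (T y)) x v w = fd (\<lambda>y. fd f (T y) (fd T y w)) x v"
      unfolding hess_def by (rule fun_cong[OF fd_cong[OF S x]]) (rule 1)
    ultimately show ?thesis by simp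
  qed
  have a: "hess T x (\<i> *s v) w = \<i> *s hess T x v w" for v w
    unfolding hess_def by (rule vholo_on_smult[OF vholo_on_fd[OF T(1) S] x])
  have b: "hess T x v (\<i> *s w) = \<i> *s hess T x v w" for v w
  proof -
    have "hess T x v (\<i> *s w) = fd (\<lambda>y. \<i> *s fd T y w) x v"
      unfolding hess_def by (rule fun_cong[OF fd_cong[OF S x]]) (rule vholo_on_smult[OF T(1)])
    also have "\<dots> = \<i> *s hess T x v w" unfolding hess_def
      using vholo_on_has_derivative[OF vholo_on_fd[OF T(1) S] x, of w]
      by (intro fun_cong[OF fd_eqI] bounded_linear.has_derivative[OF linear_conv_bounded_linear[THEN iffD1, OF linear_smult]])
    finally show ?thesis .
  qed
  show ?thesis unfolding levi_def h a b by (simp add: vholo_on_smult[OF T(1) x])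
qed

section \<open>Determinants\<close>

lemma det_hermitian_real:
  fixes a :: "complex^'m::finite^'m"
  assumes "\<And>j k. a $ j $ k = cnj (a $ k $ j)"
  shows "Im (det a) = 0"
proof -
  have "cnj (det a) = det (\<chi> i j. cnj (a $ i $ j))"
    unfolding det_def by simp
  also have "(\<chi> i j. cnj (a $ i $ j)) = transpose a"
    by (simp add: transpose_def vec_eq_iff assms[symmetric])
  finally have "cnj (det a) = det a" by (simp add: det_transpose)
  then show ?thesis by (simp add: complex_eq_iff)
qed

text \<open>Move along the segment from the identity, on which the determinant has no zero.\<close>

lemma det_hermitian_pos:
  fixes a :: "complex^'m::finite^'m"
  assumes herm: "\<And>j k. a $ j $ k = cnj (a $ k $ j)"
    and pos: "\<And>v. v \<noteq> 0 \<Longrightarrow> Re (\<Sum>j\<in>UNIV. \<Sum>k\<in>UNIV. a $ j $ k * (v $ j * cnj (v $ k))) > 0"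
  shows "Re (det a) > 0"
proof -
  define b where "b t = (\<chi> j k. complex_of_real (1 - t) * (if j = k then 1 else 0) + complex_of_real t * a $ j $ k)" for t :: real
  have nz: "Re (det (b t)) \<noteq> 0" if t: "0 \<le> t" "t \<le> 1" for t
  proof -
    have "Im (det (b t)) = 0"
      by (rule det_hermitian_real) (simp add: b_def herm[symmetric])
    moreover have "det (b t) \<noteq> 0"
    proof -
      have "w = 0" if w: "b t *v w = 0" for w
      proof (rule ccontr)
        assume "w \<noteq> 0"
        \<comment> \<open>The form conjugates its second vector, while \<open>b t *v w\<close> does
          not conjugate \<open>w\<close>; hence the test vector is the conjugate of the kernel
          vector.\<close>
        define v where "v = (\<chi> j. cnj (w $ j))"
        have v: "v \<noteq> 0" using \<open>w \<noteq> 0\<close> unfolding v_def by (auto simp: vec_eq_iff)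
        have "(\<Sum>j\<in>UNIV. \<Sum>k\<in>UNIV. b t $ j $ k * (v $ j * cnj (v $ k))) = (\<Sum>j\<in>UNIV. v $ j * (b t *v w) $ j)"
          by (simp add: matrix_vector_mult_def v_def sum_distrib_left mult_ac)
        then have 0: "(\<Sum>j\<in>UNIV. \<Sum>k\<in>UNIV. b t $ j $ k * (v $ j * cnj (v $ k))) = 0" using w by simp
        have "(\<Sum>j\<in>UNIV. \<Sum>k\<in>UNIV. b t $ j $ k * (v $ j * cnj (v $ k)))
          = complex_of_real (1 - t) * (\<Sum>j\<in>UNIV. v $ j * cnj (v $ j))
            + complex_of_real t * (\<Sum>j\<in>UNIV. \<Sum>k\<in>UNIV. a $ j $ k * (v $ j * cnj (v $ k)))"
        proof -
          have "(\<Sum>k\<in>UNIV. b t $ j $ k * (v $ j * cnj (v $ k))) = complex_of_real (1 - t) * (v $ j * cnj (v $ j))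
            + complex_of_real t * (\<Sum>k\<in>UNIV. a $ j $ k * (v $ j * cnj (v $ k)))" for j
          proof -
            have "(\<Sum>k\<in>UNIV. b t $ j $ k * (v $ j * cnj (v $ k))) =
              (\<Sum>k\<in>UNIV. (if k = j then complex_of_real (1 - t) * (v $ j * cnj (v $ j)) else 0)
                 + complex_of_real t * (a $ j $ k * (v $ j * cnj (v $ k))))"
              by (rule sum.cong) (auto simp: b_def algebra_simps)
            then show ?thesis by (simp add: sum.distrib sum_distrib_left)
          qed
          then show ?thesis by (simp add: sum.distrib sum_distrib_left)
        qed
        also have "Re \<dots> = (1 - t) * (\<Sum>j\<in>UNIV. (cmod (v $ j))\<^sup>2)
            + t * Re (\<Sum>j\<in>UNIV. \<Sum>k\<in>UNIV. a $ j $ k * (v $ j * cnj (v $ k)))"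
          by (simp add: complex_mult_cnj cmod_power2 del: of_real_diff)
        also have "\<dots> > 0"
        proof -
          have "(\<Sum>j\<in>UNIV. (cmod (v $ j))\<^sup>2) > 0"
          proof -
            obtain j where "v $ j \<noteq> 0" using v by (auto simp: vec_eq_iff)
            then show ?thesis by (intro sum_pos2[of _ j]) auto
          qed
          then show ?thesis using pos[OF v] t
            by (cases "t = 0") (auto intro!: add_nonneg_pos mult_nonneg_nonneg)
        qed
        finally show False using 0 by simp
      qed
      then have "\<exists>B. B ** b t = mat 1" using matrix_left_invertible_ker by blast
      then show ?thesis by (metis det_I det_mul mult_zero_right zero_neq_one)
    qed
    ultimately show ?thesis by (simp add: complex_eq_iff)
  qed
  have cont: "continuous_on {0..1} (\<lambda>t. Re (det (b t)))"
    unfolding det_def b_def by (auto intro!: continuous_intros)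
  have b0: "b 0 = mat 1" and b1: "b 1 = a"
    unfolding b_def mat_def by (simp_all add: vec_eq_iff)
  show ?thesis
  proof (rule ccontr)
    assume "\<not> ?thesis"
    then have "\<exists>t\<ge>0. t \<le> 1 \<and> Re (det (b t)) = 0"
      using cont b0 b1 by (intro IVT2') auto
    then show False using nz by blast
  qed
qed

text \<open>The differential of \<open>det\<close> at \<open>A\<close> in direction
  \<open>B\<close>, as the product rule gives it on the Leibniz sum: in each product one factor of
  \<open>A\<close> is replaced by the corresponding entry of \<open>B\<close>.\<close>

definition ddet :: "complex^'m::finite^'m \<Rightarrow> complex^'m^'m \<Rightarrow> complex" where
  "ddet A B = (\<Sum>p | p permutes UNIV. of_int (sign p) *
     (\<Sum>k\<in>UNIV. B $ k $ p k * (\<Prod>i\<in>UNIV - {k}. A $ i $ p i)))"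

lemma has_derivative_det:
  fixes a :: "'e::real_normed_vector \<Rightarrow> complex^'m::finite^'m"
  assumes "\<And>i j. ((\<lambda>y. a y $ i $ j) has_derivative (\<lambda>h. a' h $ i $ j)) (at x)"
  shows "((\<lambda>y. det (a y)) has_derivative (\<lambda>h. ddet (a x) (a' h))) (at x)"
  unfolding det_def ddet_def
  by (intro has_derivative_sum has_derivative_mult_right has_derivative_prod assms)

text \<open>A permutation other than the identity moves at least two indices, so after deletion of
  one factor an off-diagonal zero of the unit matrix remains.\<close>

lemma ddet_id:
  fixes N :: "complex^'m::finite^'m"
  shows "ddet (mat 1) N = trace N"
proof -
  have "(\<Sum>k\<in>UNIV. N $ k $ p k * (\<Prod>i\<in>UNIV - {k}. (mat 1 :: complex^'m^'m) $ i $ p i)) = 0"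
    if p: "p permutes UNIV" "p \<noteq> id" for p :: "'m \<Rightarrow> 'm"
  proof (rule sum.neutral, intro ballI)
    fix k
    have "\<exists>i. i \<noteq> k \<and> p i \<noteq> i"
    proof (rule ccontr)
      assume n: "\<not> ?thesis"
      have "p k = k" 
      proof (rule ccontr)
        assume "p k \<noteq> k"
        then have "p (p k) = p k" using n by blast
        then show False using \<open>p k \<noteq> k\<close> permutes_inj[OF p(1)] by (simp add: inj_eq)
      qed
      then show False using n p(2) by (metis eq_id_iff)
    qed
    then obtain i where "i \<noteq> k" "p i \<noteq> i" by blast
    then have "(\<Prod>i\<in>UNIV - {k}. (mat 1 :: complex^'m^'m) $ i $ p i) = 0"
      by (intro prod_zero) (auto simp: mat_def intro!: bexI[of _ i])
    then show "N $ k $ p k * (\<Prod>i\<in>UNIV - {k}. (mat 1 :: complex^'m^'m) $ i $ p i) = 0" by simp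
  qed
  then have "ddet (mat 1) N = (\<Sum>p | p permutes (UNIV::'m set). if p = id then trace N else 0)"
    unfolding ddet_def
    by (intro sum.cong) (auto simp: sign_id trace_def mat_def intro!: sum.cong)
  also have "\<dots> = trace N"
    by (subst sum.delta) (auto simp: finite_permutations permutes_id)
  finally show ?thesis .
qed

lemma ddet_add: "ddet A (B + C) = ddet A B + ddet A C"
  unfolding ddet_def by (simp add: sum.distrib algebra_simps)

lemma ddet_line:
  "((\<lambda>t::real. det (\<chi> i j. A $ i $ j + complex_of_real t * B $ i $ j)) has_derivative (\<lambda>t. complex_of_real t * ddet A B)) (at 0)"
proof -
  have "((\<lambda>t::real. det (\<chi> i j. A $ i $ j + complex_of_real t * B $ i $ j)) has_derivative
     (\<lambda>t. ddet (\<chi> i j. A $ i $ j + complex_of_real 0 * B $ i $ j) (\<chi> i j. complex_of_real t * B $ i $ j))) (at 0)"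
    by (rule has_derivative_det) (auto intro!: derivative_eq_intros)
  moreover have "(\<chi> i j. A $ i $ j + complex_of_real 0 * B $ i $ j) = A" by (simp add: vec_eq_iff)
  moreover have "ddet A (\<chi> i j. complex_of_real t * B $ i $ j) = complex_of_real t * ddet A B" for t
    unfolding ddet_def by (simp add: sum_distrib_left mult_ac)
  ultimately show ?thesis by simp
qed

text \<open>Jacobi's formula in a shape free of adjugates: \<open>(1 + t N) A\<close> has
  determinant \<open>det (1 + t N) * det A\<close>, and both expressions are differentiated at
  \<open>t = 0\<close>.\<close>

lemma ddet_mult_left: "ddet A (N ** A) = trace N * det A"
proof -
  define M where "M t = (\<chi> i j. (mat 1 :: complex^'a^'a) $ i $ j + complex_of_real t * N $ i $ j)" for t
  have M: "(\<chi> i j. A $ i $ j + complex_of_real t * (N ** A) $ i $ j) = M t ** A" for t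
  proof -
    have "M t ** A = mat 1 ** A + (\<chi> i j. complex_of_real t * (N ** A) $ i $ j)"
      unfolding M_def matrix_matrix_mult_def
      by (simp add: vec_eq_iff sum.distrib sum_distrib_left algebra_simps)
    then show ?thesis by (simp add: vec_eq_iff)
  qed
  have "((\<lambda>t::real. det (M t) * det A) has_derivative (\<lambda>t. complex_of_real t * trace N * det A)) (at 0)"
    using has_derivative_mult_left[OF ddet_line[of "mat 1" N]] unfolding ddet_id M_def .
  moreover have "((\<lambda>t::real. det (M t) * det A) has_derivative (\<lambda>t. complex_of_real t * ddet A (N ** A))) (at 0)"
    using ddet_line[of A "N ** A"] unfolding M det_mul .
  ultimately have "(\<lambda>t. complex_of_real t * trace N * det A) = (\<lambda>t. complex_of_real t * ddet A (N ** A))"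
    by (rule has_derivative_unique)
  from fun_cong[OF this, of 1] show ?thesis by simp
qed

lemma ddet_mult_right: "ddet A (A ** N) = trace N * det A"
proof -
  define M where "M t = (\<chi> i j. (mat 1 :: complex^'a^'a) $ i $ j + complex_of_real t * N $ i $ j)" for t
  have M: "(\<chi> i j. A $ i $ j + complex_of_real t * (A ** N) $ i $ j) = A ** M t" for t
  proof -
    have "A ** M t = A ** mat 1 + (\<chi> i j. complex_of_real t * (A ** N) $ i $ j)"
      unfolding M_def matrix_matrix_mult_def
      by (simp add: vec_eq_iff sum.distrib sum_distrib_left algebra_simps)
    then show ?thesis by (simp add: vec_eq_iff)
  qed
  have "((\<lambda>t::real. det A * det (M t)) has_derivative (\<lambda>t. det A * (complex_of_real t * trace N))) (at 0)"
    using has_derivative_mult_right[OF ddet_line[of "mat 1" N]] unfolding ddet_id M_def .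
  moreover have "((\<lambda>t::real. det A * det (M t)) has_derivative (\<lambda>t. complex_of_real t * ddet A (A ** N))) (at 0)"
    using ddet_line[of A "A ** N"] unfolding M det_mul .
  ultimately have "(\<lambda>t. det A * (complex_of_real t * trace N)) = (\<lambda>t. complex_of_real t * ddet A (A ** N))"
    by (rule has_derivative_unique)
  from fun_cong[OF this, of 1] show ?thesis by (simp add: mult.commute)
qed

lemma sum_Basis_vec:
  fixes f :: "complex^'m::finite \<Rightarrow> 'b::comm_monoid_add"
  shows "(\<Sum>b\<in>Basis. f b) = (\<Sum>j\<in>UNIV. f (axis j 1) + f (axis j \<i>))"
proof -
  have B: "(Basis :: (complex^'m) set) = (\<lambda>(j, u). axis j u) ` (UNIV \<times> {1, \<i>})"
    unfolding Basis_vec_def Basis_complex_def by auto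
  have "inj_on (\<lambda>(j, u). axis j u :: complex^'m) (UNIV \<times> {1, \<i>})"
    by (auto simp: inj_on_def axis_eq_axis)
  then have "(\<Sum>b\<in>Basis. f b) = (\<Sum>(j, u)\<in>UNIV \<times> {1, \<i>}. f (axis j u))"
    unfolding B by (subst sum.reindex) (auto simp: case_prod_unfold)
  also have "\<dots> = (\<Sum>j\<in>UNIV. \<Sum>u\<in>{1, \<i>}. f (axis j u))"
    by (simp only: sum.cartesian_product)
  finally show ?thesis by (simp add: complex_eq_iff)
qed

text \<open>Since \<open>D\<close> commutes with \<open>\<i>\<close>, the basis vectors
  \<open>axis j 1\<close> and \<open>axis j \<i>\<close> contribute equally to the real trace. It
  serves to compute the Euclidean divergence of a holomorphic field.\<close>

lemma real_trace_complex_linear: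
  fixes D :: "complex^'m::finite \<Rightarrow> complex^'m"
  assumes "\<And>v. D (\<i> *s v) = \<i> *s D v"
  shows "(\<Sum>b\<in>Basis. D b \<bullet> b) = 2 * Re (\<Sum>j\<in>UNIV. D (axis j 1) $ j)"
proof -
  have "axis j \<i> = \<i> *s (axis j 1 :: complex^'m)" for j by (simp add: vec_eq_iff axis_def)
  then have "D (axis j \<i>) = \<i> *s D (axis j 1)" for j using assms by metis
  then show ?thesis unfolding sum_Basis_vec by (simp add: inner_axis sum_distrib_left inner_complex_def)
qed

section \<open>The divergence theorem for compactly supported fields\<close>

text \<open>Translation invariance of \<open>lborel\<close> makes every difference quotient
  integrate to 0; dominated convergence passes to the derivative.\<close>

lemma integral_fd_compact_support:
  fixes f :: "'e::euclidean_space \<Rightarrow> complex"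
  assumes f: "Ck_on 1 f UNIV" and K: "compact K" and supp: "\<And>x. x \<notin> K \<Longrightarrow> f x = 0"
  shows "(\<integral>x. fd f x b \<partial>lborel) = 0" "integrable lborel (\<lambda>x. fd f x b)"
proof -
  have df: "(f has_derivative fd f x) (at x)" for x using f Ck_on_has_derivative[of 0 f UNIV] by simp
  have cfd: "continuous_on UNIV (\<lambda>x. fd f x v)" for v using f by simp
  have cf: "continuous_on UNIV f" by (rule Ck_on_imp_continuous_on[OF f])
  have fd0: "fd f x v = 0" if "x \<notin> K" for x v
  proof -
    have "fd f x = fd (\<lambda>x. 0) x"
      by (rule fd_cong[of "- K"]) (use supp that compact_imp_closed[OF K] in auto)
    then show ?thesis by simp
  qed
  have int: "integrable lborel g" if "continuous_on UNIV g" "\<And>x. x \<notin> K' \<Longrightarrow> g x = 0" "compact K'" for g :: "'e \<Rightarrow> complex" and K'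
  proof -
    have "integrable lborel (\<lambda>x. indicator K' x *\<^sub>R g x)"
      by (rule borel_integrable_compact[OF that(3) continuous_on_subset[OF that(1)]]) simp
    moreover have "(\<lambda>x. indicator K' x *\<^sub>R g x) = g" using that(2) by (auto simp: indicator_def)
    ultimately show ?thesis by simp
  qed
  show "integrable lborel (\<lambda>x. fd f x b)" by (rule int[OF cfd fd0 K])
  have "\<exists>C. \<forall>x. norm (fd f x v) \<le> C" for v
  proof -
    have "compact ((\<lambda>x. fd f x v) ` K)" by (intro compact_continuous_image continuous_on_subset[OF cfd] K) simp
    then have "bounded ((\<lambda>x. fd f x v) ` K)" by (rule compact_imp_bounded)
    then obtain C where C: "\<And>x. x \<in> K \<Longrightarrow> norm (fd f x v) \<le> C"
      unfolding bounded_iff by blast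
    have "norm (fd f x v) \<le> max 0 C" for x using C[of x] fd0[of x v] by (cases "x \<in> K") auto
    then show ?thesis by blast
  qed
  then obtain C where C: "\<And>x v. norm (fd f x v) \<le> C v" by metis
  define D where "D = (\<Sum>i\<in>Basis. C i)"
  have bound: "norm (fd f x v) \<le> D * norm v" for x v
  proof -
    have "fd f x v = (\<Sum>i\<in>Basis. (v \<bullet> i) *\<^sub>R fd f x i)"
      by (rule linear_Basis_expand[OF has_derivative_linear[OF df]])
    also have "norm \<dots> \<le> (\<Sum>i\<in>Basis. norm v * C i)"
    proof (rule sum_norm_le)
      fix i :: 'e assume "i \<in> Basis"
      then have "\<bar>v \<bullet> i\<bar> \<le> norm v" by (rule Basis_le_norm)
      then show "norm ((v \<bullet> i) *\<^sub>R fd f x i) \<le> norm v * C i" using C[of x i] by (simp add: mult_mono)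
    qed
    finally show ?thesis unfolding D_def by (simp add: sum_distrib_left mult.commute)
  qed
  define h where "h n = inverse (real (Suc n))" for n
  have h: "0 < h n" "h n \<le> 1" for n unfolding h_def by (auto simp: field_simps)
  have hlim: "h \<longlonglongrightarrow> 0" unfolding h_def by (rule LIMSEQ_inverse_real_of_nat)
  define s where "s n x = (f (x + h n *\<^sub>R b) - f x) /\<^sub>R h n" for n x
  obtain R where R: "\<And>x. x \<in> K \<Longrightarrow> norm x \<le> R" using compact_imp_bounded[OF K] unfolding bounded_iff by blast
  \<comment> \<open>One dominating function serves all \<open>n\<close>: the mean value inequality
    bounds the quotients, and steps \<open>h n\<close> of size at most 1 keep their supports in the
    ball of radius \<open>R + norm b\<close>.\<close>
  have s_bound: "norm (s n x) \<le> D * norm b * indicator (cball 0 (R + norm b)) x" for n x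
  proof (cases "x \<in> cball 0 (R + norm b)")
    case True
    have "norm (f (x + h n *\<^sub>R b) - f x) \<le> D * norm ((x + h n *\<^sub>R b) - x)"
      by (rule differentiable_bound[of UNIV f "fd f"]) (use df bound in \<open>auto intro!: onorm_le\<close>)
    then have "norm (f (x + h n *\<^sub>R b) - f x) \<le> (D * norm b) * h n" using h[of n] by (simp add: mult_ac)
    moreover have "norm (s n x) = norm (f (x + h n *\<^sub>R b) - f x) / h n"
      unfolding s_def norm_scaleR using h[of n] by (simp add: divide_inverse mult.commute)
    ultimately show ?thesis using True h[of n] by (simp add: pos_divide_le_eq)
  next
    case False
    then have x: "norm x > R + norm b" by simp
    have "norm (x + h n *\<^sub>R b) \<ge> norm x - norm (h n *\<^sub>R b)" by (rule norm_diff_ineq)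
    moreover have "norm (h n *\<^sub>R b) \<le> norm b" using h[of n] by (simp add: mult_left_le_one_le)
    ultimately have "norm (x + h n *\<^sub>R b) > R" using x by linarith
    then have "x + h n *\<^sub>R b \<notin> K" using R by force
    moreover have "x \<notin> K" using x R norm_ge_zero[of b] by (smt (verit))
    ultimately show ?thesis using False supp unfolding s_def by simp
  qed
  have cs: "continuous_on UNIV (\<lambda>x. f (x + h n *\<^sub>R b))" for n
    by (rule continuous_on_compose2[OF cf]) (auto intro!: continuous_intros)
  have lim: "(\<lambda>n. \<integral>x. s n x \<partial>lborel) \<longlonglongrightarrow> (\<integral>x. fd f x b \<partial>lborel)"
  proof (rule integral_dominated_convergence[where w="\<lambda>x. D * norm b * indicator (cball 0 (R + norm b)) x"])
    show "(\<lambda>x. fd f x b) \<in> borel_measurable lborel"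
      using borel_measurable_continuous_onI[OF cfd] by simp
    show "s n \<in> borel_measurable lborel" for n
      unfolding s_def using borel_measurable_continuous_onI[OF cs] borel_measurable_continuous_onI[OF cf] by simp
    have "emeasure lborel (cball (0::'e) (R + norm b)) < \<infinity>"
      using emeasure_compact_finite[OF compact_cball] by (simp add: less_top)
    then show "integrable lborel (\<lambda>x. D * norm b * indicator (cball (0::'e) (R + norm b)) x)"
      by (intro integrable_mult_right integrable_real_indicator) auto
    show "AE x in lborel. (\<lambda>n. s n x) \<longlonglongrightarrow> fd f x b"
    proof (rule AE_I2)
      fix x
      have "((\<lambda>t. x + t *\<^sub>R b) has_derivative (\<lambda>t. t *\<^sub>R b)) (at 0)"
        by (auto intro!: derivative_eq_intros)
      from has_derivative_compose[OF this, of f "fd f x"] df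
      have "((\<lambda>t. f (x + t *\<^sub>R b)) has_derivative (\<lambda>t. fd f x (t *\<^sub>R b))) (at 0)" by simp
      then have q: "((\<lambda>t. norm (f (x + t *\<^sub>R b) - f x - t *\<^sub>R fd f x b) / norm t) \<longlongrightarrow> 0) (at 0)"
        using linear_scale[OF has_derivative_linear[OF df]] by (simp add: has_derivative_at)
      have "norm ((f (x + t *\<^sub>R b) - f x) /\<^sub>R t - fd f x b) = norm (f (x + t *\<^sub>R b) - f x - t *\<^sub>R fd f x b) / norm t"
        if "t \<noteq> 0" for t
      proof -
        have "(f (x + t *\<^sub>R b) - f x) /\<^sub>R t - fd f x b = (f (x + t *\<^sub>R b) - f x - t *\<^sub>R fd f x b) /\<^sub>R t"
          using that by (simp add: scaleR_diff_right)
        then show ?thesis by (simp add: divide_inverse mult.commute)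
      qed
      then have "((\<lambda>t. norm ((f (x + t *\<^sub>R b) - f x) /\<^sub>R t - fd f x b)) \<longlongrightarrow> 0) (at 0)"
        by (intro Lim_transform_eventually[OF q]) (auto simp: eventually_at intro: exI[of _ 1])
      then have "((\<lambda>t. (f (x + t *\<^sub>R b) - f x) /\<^sub>R t) \<longlongrightarrow> fd f x b) (at 0)"
        by (simp add: tendsto_norm_zero_iff LIM_zero_iff)
      moreover have "filterlim h (at 0) sequentially"
        using hlim h by (auto simp: filterlim_at less_imp_neq[symmetric])
      ultimately show "(\<lambda>n. s n x) \<longlonglongrightarrow> fd f x b"
        unfolding s_def by (rule filterlim_compose)
    qed
    show "AE x in lborel. norm (s n x) \<le> D * norm b * indicator (cball 0 (R + norm b)) x" for n
      using s_bound by simp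
  qed
  have intf: "integrable lborel f" by (rule int[OF cf supp K])
  have "(\<integral>x. s n x \<partial>lborel) = 0" for n
  proof -
    have e: "(\<lambda>x. f (x + h n *\<^sub>R b)) = (\<lambda>x. f (h n *\<^sub>R b + x))" by (simp add: add.commute)
    have m: "(\<lambda>x. h n *\<^sub>R b + x) \<in> measurable lborel borel" by simp
    have fm: "f \<in> borel_measurable borel" using borel_measurable_continuous_onI[OF cf] .
    have "(\<integral>x. f x \<partial>lborel) = (\<integral>x. f x \<partial>distr lborel borel ((+) (h n *\<^sub>R b)))" by (simp add: lborel_distr_plus)
    also have "\<dots> = (\<integral>x. f (h n *\<^sub>R b + x) \<partial>lborel)" by (rule integral_distr[OF m fm])
    finally have 1: "(\<integral>x. f (x + h n *\<^sub>R b) \<partial>lborel) = (\<integral>x. f x \<partial>lborel)" using e by simp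
    have "integrable (distr lborel borel ((+) (h n *\<^sub>R b))) f" using intf by (simp add: lborel_distr_plus)
    then have 2: "integrable lborel (\<lambda>x. f (x + h n *\<^sub>R b))"
      unfolding e by (simp add: integrable_distr_eq[OF m fm])
    show ?thesis unfolding s_def using 1 Bochner_Integration.integral_diff[OF 2 intf] by simp
  qed
  then show "(\<integral>x. fd f x b \<partial>lborel) = 0" using lim LIMSEQ_unique[OF lim, of 0] by simp
qed

text \<open>The products of \<open>F\<close> with the components of \<open>X\<close>, extended by
  zero, are continuously differentiable on the whole space, and their partial derivatives in the
  matching coordinate directions sum to the integrand.\<close>

lemma integral_divergence:
  fixes F :: "'e::euclidean_space \<Rightarrow> complex" and X :: "'e \<Rightarrow> 'e"
  assumes S: "open S" and K: "compact K" "K \<subseteq> S" and supp: "\<And>x. x \<in> S - K \<Longrightarrow> F x = 0"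
    and F: "Ck_on 1 F S" and X: "\<And>b. b \<in> Basis \<Longrightarrow> Ck_on 1 (\<lambda>x. X x \<bullet> b) S"
  shows "(\<integral>x. indicator S x *\<^sub>R (fd F x (X x) + (\<Sum>b\<in>Basis. fd (\<lambda>x. X x \<bullet> b) x b) *\<^sub>R F x) \<partial>lborel) = 0"
proof -
  define G where "G b x = (if x \<in> S then (X x \<bullet> b) *\<^sub>R F x else 0)" for b x
  have GS: "Ck_on 1 (\<lambda>x. (X x \<bullet> b) *\<^sub>R F x) S" if "b \<in> Basis" for b
    by (rule Ck_on_scaleR[OF S X[OF that] F])
  have G: "Ck_on 1 (G b) UNIV" if b: "b \<in> Basis" for b
  \<comment> \<open>The open sets \<open>S\<close> and \<open>- K\<close> cover the space, and the
    extension vanishes on the second.\<close>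
  proof (rule Ck_on_local)
    fix x :: 'e
    show "\<exists>U. open U \<and> x \<in> U \<and> Ck_on 1 (G b) U"
    proof (cases "x \<in> S")
      case True
      have "Ck_on 1 (G b) S" by (rule Ck_on_cong[OF S _ GS[OF b]]) (simp add: G_def)
      then show ?thesis using True S by blast
    next
      case False
      have "Ck_on 1 (G b) (- K)"
        by (rule Ck_on_cong[OF _ _ Ck_on_const[of 1 0]])
           (use compact_imp_closed[OF K(1)] supp in \<open>auto simp: G_def\<close>)
      then show ?thesis using False K compact_imp_closed[OF K(1)] by (intro exI[of _ "- K"]) auto
    qed
  qed
  have G0: "G b x = 0" if "x \<notin> K" for b x using that supp unfolding G_def by auto
  have eq: "indicator S x *\<^sub>R (fd F x (X x) + (\<Sum>b\<in>Basis. fd (\<lambda>x. X x \<bullet> b) x b) *\<^sub>R F x) = (\<Sum>b\<in>Basis. fd (G b) x b)" for x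
  proof (cases "x \<in> S")
    case True
    have dF: "(F has_derivative fd F x) (at x)" using F True Ck_on_has_derivative[of 0] by simp
    have dX: "((\<lambda>x. X x \<bullet> b) has_derivative fd (\<lambda>x. X x \<bullet> b) x) (at x)" if "b \<in> Basis" for b
      using X[OF that] True Ck_on_has_derivative[of 0] by simp
    have "fd (G b) x b = (X x \<bullet> b) *\<^sub>R fd F x b + fd (\<lambda>x. X x \<bullet> b) x b *\<^sub>R F x" if b: "b \<in> Basis" for b
    proof -
      have "fd (G b) x = fd (\<lambda>x. (X x \<bullet> b) *\<^sub>R F x) x"
        by (rule fd_cong[OF S True]) (simp add: G_def)
      also have "\<dots> = (\<lambda>h. (X x \<bullet> b) *\<^sub>R fd F x h + fd (\<lambda>x. X x \<bullet> b) x h *\<^sub>R F x)"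
        by (intro fd_eqI has_derivative_scaleR dF dX b)
      finally show ?thesis by simp
    qed
    then have "(\<Sum>b\<in>Basis. fd (G b) x b) = (\<Sum>b\<in>Basis. (X x \<bullet> b) *\<^sub>R fd F x b) + (\<Sum>b\<in>Basis. fd (\<lambda>x. X x \<bullet> b) x b) *\<^sub>R F x"
      by (simp add: sum.distrib scaleR_sum_left)
    also have "(\<Sum>b\<in>Basis. (X x \<bullet> b) *\<^sub>R fd F x b) = fd F x (X x)"
      by (rule linear_Basis_expand[OF has_derivative_linear[OF dF], symmetric])
    finally show ?thesis using True by simp
  next
    case False
    have "fd (G b) x = fd (\<lambda>x. 0) x" for b
      by (rule fd_cong[of "- K"]) (use compact_imp_closed[OF K(1)] G0 False K in auto)
    then show ?thesis using False by simp
  qed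
  show ?thesis unfolding eq
    using integral_fd_compact_support[OF G K(1) G0] by (subst Bochner_Integration.integral_sum) auto
qed

declare Ck_on.simps [simp del]

section \<open>Charts and tangent vectors\<close>

locale complex_manifold =
  fixes A :: "('a::t2_space, 'm::finite) chart set"
  assumes atlas: "complex_atlas A"
begin

lemma
  assumes "c \<in> A"
  shows open_dom: "open (fst c)" and open_img: "open (snd c ` fst c)"
    and chart_homeo: "homeomorphism (fst c) (snd c ` fst c) (snd c) (chart_inv c)"
  using atlas assms unfolding complex_atlas_def by auto

lemma chart_inv_snd: "c \<in> A \<Longrightarrow> p \<in> fst c \<Longrightarrow> chart_inv c (snd c p) = p"
  by (rule homeomorphism_apply1[OF chart_homeo])

lemma snd_chart_inv: "c \<in> A \<Longrightarrow> x \<in> snd c ` fst c \<Longrightarrow> snd c (chart_inv c x) = x"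
  by (rule homeomorphism_apply2[OF chart_homeo])

lemma chart_inv_mem: "c \<in> A \<Longrightarrow> x \<in> snd c ` fst c \<Longrightarrow> chart_inv c x \<in> fst c"
  by (auto simp: chart_inv_snd)

lemma mem_chart_img: "c \<in> A \<Longrightarrow> x \<in> chart_img c U \<longleftrightarrow> x \<in> snd c ` fst c \<and> chart_inv c x \<in> U"
  unfolding chart_img_def by (auto simp: chart_inv_snd intro!: image_eqI[of x "snd c" "chart_inv c x"])

lemma chart_img_UNIV: "chart_img c UNIV = snd c ` fst c"
  unfolding chart_img_def by simp

lemma chart_img_I: "p \<in> fst c \<Longrightarrow> p \<in> U \<Longrightarrow> snd c p \<in> chart_img c U"
  unfolding chart_img_def by auto

lemma continuous_on_chart_inv: "c \<in> A \<Longrightarrow> continuous_on (snd c ` fst c) (chart_inv c)"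
  using chart_homeo homeomorphism_cont2 by blast

lemma continuous_on_chart: "c \<in> A \<Longrightarrow> continuous_on (fst c) (snd c)"
  using chart_homeo homeomorphism_cont1 by blast

lemma open_chart_img:
  assumes "c \<in> A" "open U" shows "open (chart_img c U)"
proof -
  have "chart_img c U = chart_inv c -` U \<inter> snd c ` fst c"
    using mem_chart_img[OF assms(1)] by auto
  then show ?thesis
    using continuous_on_open_vimage[OF open_img[OF assms(1)], of "chart_inv c"] continuous_on_chart_inv assms by simp
qed

lemma open_chart_preimage:
  assumes "c \<in> A" "open V" shows "open {p \<in> fst c. snd c p \<in> V}"
proof -
  have "{p \<in> fst c. snd c p \<in> V} = snd c -` V \<inter> fst c" by auto
  then show ?thesis
    using continuous_on_open_vimage[OF open_dom[OF assms(1)], of "snd c"] continuous_on_chart assms by simp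
qed

lemma ex_chart: "\<exists>c\<in>A. p \<in> fst c"
  using atlas unfolding complex_atlas_def by blast

lemma chart_at: "chart_at A p \<in> A" "p \<in> fst (chart_at A p)"
  using someI_ex[of "\<lambda>c. c \<in> A \<and> p \<in> fst c"] ex_chart unfolding chart_at_def by blast+

lemma vholo_on_transition:
  assumes "c \<in> A" "d \<in> A" shows "vholo_on (snd d \<circ> chart_inv c) (chart_img c (fst d))"
  using atlas assms unfolding complex_atlas_def vholo_on_def holo_fun_def by (simp add: comp_def)

lemma transition_image:
  assumes "c \<in> A" "d \<in> A" shows "(snd d \<circ> chart_inv c) ` chart_img c (fst d \<inter> U) \<subseteq> chart_img d U"
  using assms by (auto simp: mem_chart_img intro: chart_img_I)

lemma transition_fd_has_derivative:
  assumes "c \<in> A" "d \<in> A" "p \<in> fst c" "p \<in> fst d"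
  shows "((snd d \<circ> chart_inv c) has_derivative fd (snd d \<circ> chart_inv c) (snd c p)) (at (snd c p))"
  by (rule vholo_on_has_derivative[OF vholo_on_transition[OF assms(1,2)]]) (use assms in \<open>auto intro: chart_img_I\<close>)

lemma chart_change_has_derivative:
  fixes f :: "'a \<Rightarrow> 'b::real_normed_vector"
  assumes cd: "c \<in> A" "d \<in> A" and p: "p \<in> fst c" "p \<in> fst d"
    and f: "((f \<circ> chart_inv d) has_derivative D) (at (snd d p))"
  shows "((f \<circ> chart_inv c) has_derivative (\<lambda>v. D (fd (snd d \<circ> chart_inv c) (snd c p) v))) (at (snd c p))"
proof -
  have "((f \<circ> chart_inv d) has_derivative D) (at ((snd d \<circ> chart_inv c) (snd c p)))"
    using f p cd by (simp add: chart_inv_snd)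
  from has_derivative_compose[OF transition_fd_has_derivative[OF cd p] this]
  show ?thesis
  proof (rule has_derivative_transform_within_open[where s="chart_img c (fst d)"])
    show "(f \<circ> chart_inv d) ((snd d \<circ> chart_inv c) x) = (f \<circ> chart_inv c) x" if "x \<in> chart_img c (fst d)" for x
      using that cd by (simp add: mem_chart_img chart_inv_snd)
  qed (auto simp: cd p intro!: open_chart_img open_dom chart_img_I)
qed

lemma transition_fd_compose:
  assumes "c \<in> A" "d \<in> A" "d' \<in> A" "p \<in> fst c" "p \<in> fst d" "p \<in> fst d'"
  shows "fd (snd d' \<circ> chart_inv d) (snd d p) (fd (snd d \<circ> chart_inv c) (snd c p) v)
       = fd (snd d' \<circ> chart_inv c) (snd c p) v"
  using fd_eqI[OF chart_change_has_derivative[OF assms(1,2,4,5) transition_fd_has_derivative[OF assms(2,3,5,6)]]]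
  by simp

lemma transition_fd_id:
  assumes "c \<in> A" "p \<in> fst c" shows "fd (snd c \<circ> chart_inv c) (snd c p) v = v"
proof -
  have "fd (snd c \<circ> chart_inv c) (snd c p) = fd (\<lambda>x. x) (snd c p)"
    by (rule fd_cong[OF open_img]) (auto simp: assms snd_chart_inv chart_inv_snd)
  then show ?thesis by simp
qed

text \<open>A tangent vector is a family over all charts, so a coordinate vector given in one chart
  has to be transported to all the others at once.\<close>

definition tvec :: "('a, 'm) chart \<Rightarrow> 'a \<Rightarrow> complex^'m \<Rightarrow> ('a, 'm) tvec" where
  "tvec c p v = (\<lambda>d. if d \<in> A \<and> p \<in> fst d then fd (snd d \<circ> chart_inv c) (snd c p) v else 0)"

lemma tvec_in_tangent_space: "c \<in> A \<Longrightarrow> p \<in> fst c \<Longrightarrow> tvec c p v \<in> tangent_space A p"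
  unfolding tangent_space_def tvec_def by (auto simp: transition_fd_compose)

lemma tvec_self: "c \<in> A \<Longrightarrow> p \<in> fst c \<Longrightarrow> tvec c p v c = v"
  unfolding tvec_def by (simp add: transition_fd_id)

lemma tangent_space_eq_tvec:
  assumes "X \<in> tangent_space A p" "c \<in> A" "p \<in> fst c" shows "X = tvec c p (X c)"
proof
  fix d
  show "X d = tvec c p (X c) d"
  proof (cases "d \<in> A \<and> p \<in> fst d")
    case True
    then have "X d = fd (snd d \<circ> chart_inv c) (snd c p) (X c)"
      using assms unfolding tangent_space_def by blast
    then show ?thesis using True unfolding tvec_def by simp
  next
    case False
    moreover from this have "X d = 0" using assms(1) unfolding tangent_space_def by blast
    ultimately show ?thesis unfolding tvec_def by auto
  qed
qed

lemma tangent_space_eqI: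
  assumes "X \<in> tangent_space A p" "Y \<in> tangent_space A p" "c \<in> A" "p \<in> fst c" "X c = Y c" shows "X = Y"
  using tangent_space_eq_tvec[OF assms(1,3,4)] tangent_space_eq_tvec[OF assms(2,3,4)] assms(5) by metis

lemma tangent_space_transition:
  assumes "X \<in> tangent_space A p" "c \<in> A" "p \<in> fst c" "d \<in> A" "p \<in> fst d"
  shows "X d = fd (snd d \<circ> chart_inv c) (snd c p) (X c)"
  using assms unfolding tangent_space_def by blast

lemma cplx_J_tangent_space: "X \<in> tangent_space A p \<Longrightarrow> cplx_J X \<in> tangent_space A p"
proof -
  assume X: "X \<in> tangent_space A p"
  have "\<i> *s X d = fd (snd d \<circ> chart_inv c) (snd c p) (\<i> *s X c)"
    if "c \<in> A" "d \<in> A" "p \<in> fst c" "p \<in> fst d" for c d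
    using tangent_space_transition[OF X that(1,3,2,4)]
      vholo_on_smult[OF vholo_on_transition[OF that(1,2)] chart_img_I[OF that(3,4)]] by simp
  moreover have "\<i> *s X c = 0" if "\<not> (c \<in> A \<and> p \<in> fst c)" for c
  proof -
    have "X c = 0" using X that unfolding tangent_space_def by blast
    then show ?thesis by simp
  qed
  ultimately show ?thesis unfolding tangent_space_def cplx_J_def mem_Collect_eq by blast
qed

text \<open>\<open>differential\<close> evaluates in a chart picked by choice; the compatibility
  condition of tangent vectors cancels the chain rule factor of the coordinate change.\<close>

lemma differential_chart:
  assumes X: "X \<in> tangent_space A p" and c: "c \<in> A" "p \<in> fst c"
    and f: "((f \<circ> chart_inv c) has_derivative D) (at (snd c p))"
  shows "differential A f p X = D (X c)"
proof -
  note d = chart_at[of p]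
  have "fd (f \<circ> chart_inv (chart_at A p)) (snd (chart_at A p) p)
      = (\<lambda>v. D (fd (snd c \<circ> chart_inv (chart_at A p)) (snd (chart_at A p) p) v))"
    by (rule fd_eqI[OF chart_change_has_derivative[OF d(1) c(1) d(2) c(2) f]])
  then show ?thesis unfolding differential_def Let_def
    using tangent_space_transition[OF X d c] by simp
qed

text \<open>In the chain rule both the linear map and its argument vary with \<open>x\<close>;
  expanding the argument in the real basis makes the continuity of the derivative visible.\<close>

lemma Ck_on_vholo_compose:
  fixes g :: "complex^'m \<Rightarrow> 'b::real_normed_vector" and T :: "complex^'m \<Rightarrow> complex^'m"
  assumes S: "open S" and T: "vholo_on T S" "T ` S \<subseteq> V" and g: "Ck_on 1 g V"
  shows "Ck_on 1 (\<lambda>x. g (T x)) S"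
  unfolding One_nat_def
proof (rule Ck_on_SucI[OF S])
  have TV: "T x \<in> V" if "x \<in> S" for x using T that by blast
  have dg: "(g has_derivative fd g y) (at y)" if "y \<in> V" for y using g that Ck_on_has_derivative[of 0] by simp
  show "((\<lambda>x. g (T x)) has_derivative (\<lambda>v. fd g (T x) (fd T x v))) (at x)" if "x \<in> S" for x
    using has_derivative_compose[OF vholo_on_has_derivative[OF T(1) that] dg[OF TV[OF that]]] .
  fix v
  have e: "fd g (T x) (fd T x v) = (\<Sum>b\<in>Basis. (fd T x v \<bullet> b) *\<^sub>R fd g (T x) b)" if "x \<in> S" for x
    by (rule linear_Basis_expand[OF has_derivative_linear[OF dg[OF TV[OF that]]]])
  have cT: "continuous_on S T"
    by (meson T(1) continuous_at_imp_continuous_on has_derivative_continuous vholo_on_has_derivative)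
  have cT': "continuous_on S (\<lambda>x. fd T x v)"
    using vholo_on_has_derivative[OF vholo_on_fd[OF T(1) S]]
    by (meson continuous_at_imp_continuous_on has_derivative_continuous)
  have cg: "continuous_on S (\<lambda>x. fd g (T x) b)" for b
    by (rule continuous_on_compose2[OF _ cT T(2)]) (use g in \<open>simp add: Ck_on.simps\<close>)
  have "continuous_on S (\<lambda>x. \<Sum>b\<in>Basis. (fd T x v \<bullet> b) *\<^sub>R fd g (T x) b)"
    by (intro continuous_intros cT' cg)
  then show "Ck_on 0 (\<lambda>x. fd g (T x) (fd T x v)) S"
    using e by (simp add: Ck_on.simps cong: continuous_on_cong)
qed

section \<open>Continuously differentiable functions on the manifold and bumps\<close>

definition C1_fun :: "'a set \<Rightarrow> ('a \<Rightarrow> 'b::real_normed_vector) \<Rightarrow> bool" where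
  "C1_fun U f \<longleftrightarrow> (\<forall>c\<in>A. Ck_on 1 (f \<circ> chart_inv c) (chart_img c U))"

text \<open>Transition maps are holomorphic, so regularity in one chart that covers \<open>U\<close>
  transfers to every chart.\<close>

lemma C1_funI_chart:
  assumes d: "d \<in> A" and U: "open U" and Ud: "U \<subseteq> fst d" and f: "Ck_on 1 (f \<circ> chart_inv d) (chart_img d U)"
  shows "C1_fun U f"
  unfolding C1_fun_def
proof
  fix c assume c: "c \<in> A"
  have S: "open (chart_img c U)" by (rule open_chart_img[OF c U])
  have sub: "chart_img c U \<subseteq> chart_img c (fst d)" using Ud unfolding chart_img_def by auto
  have im: "(snd d \<circ> chart_inv c) ` chart_img c U \<subseteq> chart_img d U"
    using transition_image[OF c d, of U] Ud by (simp add: Int_absorb1)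
  have "Ck_on 1 (\<lambda>x. (f \<circ> chart_inv d) ((snd d \<circ> chart_inv c) x)) (chart_img c U)"
    by (rule Ck_on_vholo_compose[OF S vholo_on_subset[OF vholo_on_transition[OF c d] sub] im f])
  then show "Ck_on 1 (f \<circ> chart_inv c) (chart_img c U)"
    by (rule Ck_on_cong[OF S, rotated]) (use c d Ud in \<open>auto simp: mem_chart_img chart_inv_snd subset_iff\<close>)
qed

lemma C1_fun_local:
  assumes "\<And>p. p \<in> U \<Longrightarrow> \<exists>V. open V \<and> p \<in> V \<and> C1_fun V f"
  shows "C1_fun U f"
  unfolding C1_fun_def
proof
  fix c assume c: "c \<in> A"
  show "Ck_on 1 (f \<circ> chart_inv c) (chart_img c U)"
  proof (rule Ck_on_local)
    fix x assume x: "x \<in> chart_img c U"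
    then have "chart_inv c x \<in> U" using mem_chart_img[OF c] by blast
    then obtain V where V: "open V" "chart_inv c x \<in> V" "C1_fun V f" using assms by blast
    have "x \<in> chart_img c V" using x V mem_chart_img[OF c] by blast
    then show "\<exists>U. open U \<and> x \<in> U \<and> Ck_on 1 (f \<circ> chart_inv c) U"
      using V c open_chart_img[OF c V(1)] unfolding C1_fun_def by blast
  qed
qed

lemma C1_fun_cong:
  assumes "open U" "\<And>p. p \<in> U \<Longrightarrow> f p = g p" "C1_fun U f" shows "C1_fun U g"
  unfolding C1_fun_def
proof
  fix c assume c: "c \<in> A"
  have "Ck_on 1 (f \<circ> chart_inv c) (chart_img c U)" using assms(3) c unfolding C1_fun_def by blast
  then show "Ck_on 1 (g \<circ> chart_inv c) (chart_img c U)"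
    by (rule Ck_on_cong[OF open_chart_img[OF c assms(1)], rotated]) (use assms(2) c mem_chart_img in auto)
qed

lemma C1_fun_const: "C1_fun U (\<lambda>p. k)"
  unfolding C1_fun_def by (simp add: comp_def Ck_on_const del: One_nat_def)

lemma C1_fun_scaleR:
  assumes "open U" "C1_fun U f" "C1_fun U g" shows "C1_fun U (\<lambda>p. f p *\<^sub>R g p)"
  unfolding C1_fun_def comp_def
  using assms[unfolded C1_fun_def comp_def] by (intro ballI Ck_on_scaleR open_chart_img) auto

lemma C1_fun_sum:
  assumes "open U" "\<And>i. i \<in> I \<Longrightarrow> C1_fun U (f i)" shows "C1_fun U (\<lambda>p. \<Sum>i\<in>I. f i p)"
  unfolding C1_fun_def comp_def
  using assms[unfolded C1_fun_def comp_def] by (intro ballI Ck_on_sum open_chart_img) auto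

lemma C1_fun_inverse:
  fixes f :: "'a \<Rightarrow> real"
  assumes "open U" "\<And>p. p \<in> U \<Longrightarrow> f p \<noteq> 0" "C1_fun U f" shows "C1_fun U (\<lambda>p. inverse (f p))"
  unfolding C1_fun_def comp_def
  using assms[unfolded C1_fun_def comp_def]
  by (intro ballI Ck_on_inverse open_chart_img) (simp_all add: mem_chart_img)

lemma C1_fun_has_derivative:
  assumes "C1_fun U f" "c \<in> A" "p \<in> fst c" "p \<in> U"
  shows "((f \<circ> chart_inv c) has_derivative fd (f \<circ> chart_inv c) (snd c p)) (at (snd c p))"
  by (rule Ck_on_has_derivative[of 0, OF _ chart_img_I[OF assms(3,4)]])
     (use assms(1,2) in \<open>simp add: C1_fun_def\<close>)

lemma C1_fun_continuous_on:
  assumes "C1_fun U f" "open U" shows "continuous_on U f"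
proof (rule continuous_at_imp_continuous_on, rule ballI)
  fix p assume p: "p \<in> U"
  obtain c where c: "c \<in> A" "p \<in> fst c" using ex_chart by blast
  have "continuous_on (chart_img c U) (f \<circ> chart_inv c)"
    using assms c unfolding C1_fun_def by (blast intro: Ck_on_imp_continuous_on)
  then have "continuous_on (fst c \<inter> U) (\<lambda>q. (f \<circ> chart_inv c) (snd c q))"
    by (rule continuous_on_compose2) (auto intro: continuous_on_subset[OF continuous_on_chart[OF c(1)]] chart_img_I)
  then have "continuous_on (fst c \<inter> U) f"
    by (rule continuous_on_eq) (use c in \<open>simp add: chart_inv_snd\<close>)
  then show "isCont f p"
    using continuous_on_eq_continuous_at[of "fst c \<inter> U" f] open_dom[OF c(1)] assms(2) c p by auto
qed

text \<open>One derivative of the bumps suffices for the integration by parts below.\<close>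

lemma bump_function:
  assumes c: "c \<in> A" and p: "p \<in> fst c" and U: "open U" "p \<in> U"
  obtains \<beta> :: "'a \<Rightarrow> real" and K where "C1_fun UNIV \<beta>" "\<And>q. 0 \<le> \<beta> q" "\<beta> p > 0"
    "compact K" "K \<subseteq> fst c" "K \<subseteq> U" "\<And>q. q \<notin> K \<Longrightarrow> \<beta> q = 0"
proof -
  have "snd c p \<in> chart_img c U" using p U by (intro chart_img_I)
  then obtain r where r0: "r > 0" "cball (snd c p) r \<subseteq> chart_img c U"
    using open_chart_img[OF c U(1)] open_contains_cball by blast
  then have r: "r > 0" "cball (snd c p) r \<subseteq> snd c ` fst c" by (auto simp: mem_chart_img[OF c] subset_iff)
  define K where "K = chart_inv c ` cball (snd c p) r"
  have K: "compact K" unfolding K_def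
    by (intro compact_continuous_image continuous_on_subset[OF continuous_on_chart_inv[OF c] r(2)] compact_cball)
  have Kc: "K \<subseteq> fst c" using r(2) c unfolding K_def by (auto simp: chart_inv_mem subset_iff)
  have KU: "K \<subseteq> U" using r0(2) unfolding K_def by (auto simp: mem_chart_img[OF c] subset_iff)
  \<comment> \<open>The squared positive part of \<open>r\<^sup>2 - |x - x0|\<^sup>2\<close> is
    differentiable across the sphere. Values of \<open>snd c\<close> outside \<open>fst c\<close>
    carry no meaning, hence the explicit zero there.\<close>
  define \<beta> where "\<beta> q = (if q \<in> fst c then (max 0 (r\<^sup>2 - (norm (snd c q - snd c p))\<^sup>2))\<^sup>2 else 0)" for q
  have out: "\<beta> q = 0" if "q \<notin> K" for q
  proof (cases "q \<in> fst c")
    case True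
    have "snd c q \<notin> cball (snd c p) r"
      using that True c unfolding K_def by (metis chart_inv_snd image_eqI)
    then have "norm (snd c q - snd c p) > r" by (simp add: dist_norm norm_minus_commute)
    then have "(norm (snd c q - snd c p))\<^sup>2 \<ge> r\<^sup>2" using r(1) by (intro power_mono) auto
    then show ?thesis unfolding \<beta>_def by simp
  qed (simp add: \<beta>_def)
  have "C1_fun UNIV \<beta>"
  proof (rule C1_fun_local)
    fix q :: 'a
    show "\<exists>V. open V \<and> q \<in> V \<and> C1_fun V \<beta>"
    proof (cases "q \<in> fst c")
      case True
      have S: "open (chart_img c (fst c))" by (rule open_chart_img[OF c open_dom[OF c]])
      have comp: "Ck_on 1 (\<lambda>x::complex^'m. x $ j) (chart_img c (fst c))" for j
        by (rule holo_on_Ck_on[OF _ S], rule holo_onI[of _ _ "\<lambda>x h. h $ j"])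
           (auto intro: bounded_linear.has_derivative[OF bounded_linear_vec_nth has_derivative_ident])
      have "Ck_on 1 (\<lambda>x. (max 0 (r\<^sup>2 - (\<Sum>j\<in>UNIV. (Re (x $ j - snd c p $ j))\<^sup>2 + (Im (x $ j - snd c p $ j))\<^sup>2)))\<^sup>2)
        (chart_img c (fst c))"
        by (intro Ck_on_pos_part_square Ck_on_diff Ck_on_sum Ck_on_add Ck_on_power Ck_on_Re Ck_on_Im Ck_on_const S comp)
      then have "Ck_on 1 (\<beta> \<circ> chart_inv c) (chart_img c (fst c))"
      proof (rule Ck_on_cong[OF S, rotated])
        fix x assume "x \<in> chart_img c (fst c)"
        then have x: "x \<in> snd c ` fst c" "chart_inv c x \<in> fst c" using mem_chart_img[OF c] by auto
        have n: "(norm v)\<^sup>2 = (\<Sum>j\<in>UNIV. (Re (v $ j))\<^sup>2 + (Im (v $ j))\<^sup>2)" for v :: "complex^'m"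
          unfolding norm_vec_def L2_set_def by (simp add: cmod_power2 sum_nonneg)
        show "(max 0 (r\<^sup>2 - (\<Sum>j\<in>UNIV. (Re (x $ j - snd c p $ j))\<^sup>2 + (Im (x $ j - snd c p $ j))\<^sup>2)))\<^sup>2 = (\<beta> \<circ> chart_inv c) x"
          using x unfolding \<beta>_def by (simp add: snd_chart_inv[OF c] n)
      qed
      then show ?thesis using C1_funI_chart[OF c open_dom[OF c]] True open_dom[OF c] by blast
    next
      case False
      \<comment> \<open>Compact sets are closed in a Hausdorff space, so points off the chart have
        the open neighbourhood \<open>- K\<close> on which the bump is identically 0.\<close>
      have "C1_fun (- K) \<beta>"
        by (rule C1_fun_cong[OF _ _ C1_fun_const[of _ 0]]) (use compact_imp_closed[OF K] out in auto)
      then show ?thesis using False Kc compact_imp_closed[OF K] by (intro exI[of _ "- K"]) auto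
    qed
  qed
  moreover have "0 \<le> \<beta> q" for q unfolding \<beta>_def by simp
  moreover have "\<beta> p > 0" unfolding \<beta>_def using p r by simp
  ultimately show ?thesis using that K Kc KU out by blast
qed

lemma holo_fun_has_derivative:
  assumes f: "holo_fun A U f" and c: "c \<in> A" "p \<in> fst c" "p \<in> U"
  shows "((f \<circ> chart_inv c) has_derivative fd (f \<circ> chart_inv c) (snd c p)) (at (snd c p))"
  using f c(1) unfolding holo_fun_def by (intro holo_on_has_derivative[OF _ chart_img_I[OF c(2,3)]]) blast

lemma holo_fun_C1_fun: "holo_fun A U f \<Longrightarrow> open U \<Longrightarrow> C1_fun U f"
  unfolding holo_fun_def C1_fun_def using holo_on_Ck_on open_chart_img by blast

lemma smooth_fun_C1_fun: "smooth_fun A U f \<Longrightarrow> C1_fun U f"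
  unfolding smooth_fun_def C1_fun_def smooth_on_def by blast

end

section \<open>Hermitian line bundles\<close>

lemma smooth_on_subset: "smooth_on f S \<Longrightarrow> T \<subseteq> S \<Longrightarrow> smooth_on f T"
  unfolding smooth_on_def using Ck_on_subset by blast

lemma smooth_on_diff: "open S \<Longrightarrow> smooth_on f S \<Longrightarrow> smooth_on g S \<Longrightarrow> smooth_on (\<lambda>x. f x - g x) S"
  unfolding smooth_on_def using Ck_on_diff by blast

lemma smooth_on_ln:
  fixes f :: "'e::real_normed_vector \<Rightarrow> real"
  shows "open S \<Longrightarrow> smooth_on f S \<Longrightarrow> (\<And>x. x \<in> S \<Longrightarrow> f x > 0) \<Longrightarrow> smooth_on (\<lambda>x. ln (f x)) S"
  unfolding smooth_on_def using Ck_on_ln by blast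

locale hermitian_bundle = complex_manifold A
  for A :: "('a::t2_space, 'm::finite) chart set" +
  fixes B :: "('a, 'i) herm_line_bundle"
  assumes herm_bundle: "herm_holo_line_bundle A B"
begin

lemma ex_triv: "\<exists>i. z \<in> triv_dom B i"
proof -
  have "(\<Union>i. triv_dom B i) = UNIV" using herm_bundle unfolding herm_holo_line_bundle_def by blast
  then show ?thesis by auto
qed

lemma triv_at: "z \<in> triv_dom B (triv_at B z)"
  unfolding triv_at_def by (rule someI_ex[OF ex_triv])

lemma open_triv: "open (triv_dom B i)"
  using herm_bundle unfolding herm_holo_line_bundle_def by blast

lemma trans_holo: "holo_fun A (triv_dom B i \<inter> triv_dom B j) (trans B i j)"
  using herm_bundle unfolding herm_holo_line_bundle_def by blast

lemma trans_nonzero: "z \<in> triv_dom B i \<Longrightarrow> z \<in> triv_dom B j \<Longrightarrow> trans B i j z \<noteq> 0"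
  using herm_bundle unfolding herm_holo_line_bundle_def by blast

lemma trans_self: "z \<in> triv_dom B i \<Longrightarrow> trans B i i z = 1"
  using herm_bundle unfolding herm_holo_line_bundle_def by blast

lemma trans_cocycle: "z \<in> triv_dom B i \<Longrightarrow> z \<in> triv_dom B j \<Longrightarrow> z \<in> triv_dom B l \<Longrightarrow>
    trans B i j z * trans B j l z = trans B i l z"
  using herm_bundle unfolding herm_holo_line_bundle_def by blast

lemma weight_smooth: "smooth_fun A (triv_dom B i) (weight B i)"
  using herm_bundle unfolding herm_holo_line_bundle_def by blast

lemma weight_pos: "z \<in> triv_dom B i \<Longrightarrow> weight B i z > 0"
  using herm_bundle unfolding herm_holo_line_bundle_def by blast

lemma weight_trans: "z \<in> triv_dom B i \<Longrightarrow> z \<in> triv_dom B j \<Longrightarrow>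
    weight B j z = (cmod (trans B i j z))\<^sup>2 * weight B i z"
  using herm_bundle unfolding herm_holo_line_bundle_def by blast

lemma fibre_trans: "u \<in> fibre B z \<Longrightarrow> z \<in> triv_dom B i \<Longrightarrow> z \<in> triv_dom B j \<Longrightarrow> u i = trans B i j z * u j"
  unfolding fibre_def by blast

lemma fibre_outside: "u \<in> fibre B z \<Longrightarrow> z \<notin> triv_dom B i \<Longrightarrow> u i = 0"
  unfolding fibre_def by blast

lemma frame_in_fibre: "z \<in> triv_dom B j \<Longrightarrow> frame B j z \<in> fibre B z"
  unfolding fibre_def frame_def using trans_cocycle by auto

lemma frame_self: "z \<in> triv_dom B j \<Longrightarrow> frame B j z j = 1"
  unfolding frame_def by (simp add: trans_self)

lemma fibre_scale_frame:
  assumes "u \<in> fibre B z" "z \<in> triv_dom B j" shows "u = (\<lambda>i. u j * frame B j z i)"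
proof
  fix i show "u i = u j * frame B j z i"
    using fibre_trans[OF assms(1) _ assms(2), of i] fibre_outside[OF assms(1), of i] unfolding frame_def by auto
qed

lemma fibre_add: "u \<in> fibre B z \<Longrightarrow> v \<in> fibre B z \<Longrightarrow> (\<lambda>i. a * u i + b * v i) \<in> fibre B z"
proof -
  assume uv: "u \<in> fibre B z" "v \<in> fibre B z"
  have "a * u i + b * v i = trans B i j z * (a * u j + b * v j)" if "z \<in> triv_dom B i" "z \<in> triv_dom B j" for i j
    unfolding fibre_trans[OF uv(1) that] fibre_trans[OF uv(2) that] by (simp add: algebra_simps)
  then show ?thesis using fibre_outside[OF uv(1)] fibre_outside[OF uv(2)]
    unfolding fibre_def mem_Collect_eq by simp
qed

lemma fibre_zero: "(\<lambda>i. 0) \<in> fibre B z"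
  unfolding fibre_def by simp

lemma fibre_eq_zero_iff:
  assumes "u \<in> fibre B z" "z \<in> triv_dom B i" shows "u = (\<lambda>i. 0) \<longleftrightarrow> u i = 0"
  using fibre_scale_frame[OF assms] by (metis mult_zero_left)

text \<open>\<open>herm\<close> is evaluated in a frame picked by choice. The factor
  \<open>|trans|^2\<close> between the weights cancels against the two transition factors of the
  coordinates.\<close>

lemma herm_eq:
  assumes "u \<in> fibre B z" "v \<in> fibre B z" "z \<in> triv_dom B i"
  shows "herm B z u v = of_real (weight B i z) * u i * cnj (v i)"
proof -
  let ?j = "triv_at B z"
  have j: "z \<in> triv_dom B ?j" by (rule triv_at)
  have "of_real (weight B i z) = (trans B ?j i z * cnj (trans B ?j i z)) * complex_of_real (weight B ?j z)"
    using weight_trans[OF j assms(3)] by (simp add: complex_norm_square del: of_real_power)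
  then show ?thesis unfolding herm_def Let_def
    using fibre_trans[OF assms(1) j assms(3)] fibre_trans[OF assms(2) j assms(3)] by simp
qed

lemma herm_self:
  assumes "u \<in> fibre B z" "z \<in> triv_dom B i"
  shows "herm B z u u = of_real (weight B i z * (cmod (u i))\<^sup>2)"
proof -
  have "u i * cnj (u i) = of_real ((cmod (u i))\<^sup>2)" by (rule complex_norm_square[symmetric])
  then show ?thesis using herm_eq[OF assms(1,1,2)] by (simp add: mult.assoc)
qed

section \<open>Local logarithms of the weight and their Levi forms\<close>

definition logw :: "'i \<Rightarrow> ('a, 'm) chart \<Rightarrow> complex^'m \<Rightarrow> real" where
  "logw i c x = ln (weight B i (chart_inv c x))"

lemma smooth_on_logw: "c \<in> A \<Longrightarrow> smooth_on (logw i c) (chart_img c (triv_dom B i))"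
  unfolding logw_def using weight_smooth[of i] unfolding smooth_fun_def
  by (intro smooth_on_ln open_chart_img open_triv) (auto simp: mem_chart_img weight_pos comp_def)

text \<open>Two log weights differ by the logarithm of \<open>|trans|^2\<close>, whose Levi form
  vanishes.\<close>

lemma levi_logw_triv:
  assumes c: "c \<in> A" and x: "x \<in> chart_img c (triv_dom B i)" "x \<in> chart_img c (triv_dom B j)"
  shows "levi (logw i c) x X Y = levi (logw j c) x X Y"
proof -
  define S where "S = chart_img c (triv_dom B i \<inter> triv_dom B j)"
  have S: "open S" unfolding S_def by (intro open_chart_img[OF c] open_Int open_triv)
  have xS: "x \<in> S" using x unfolding S_def by (simp add: mem_chart_img[OF c])
  have SD: "chart_inv c y \<in> triv_dom B i" "chart_inv c y \<in> triv_dom B j" if "y \<in> S" for y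
    using that unfolding S_def by (simp_all add: mem_chart_img[OF c])
  define g where "g = trans B i j \<circ> chart_inv c"
  have g: "holo_on g S" using trans_holo[of i j] c unfolding holo_fun_def g_def S_def by blast
  have gnz: "g y \<noteq> 0" if "y \<in> S" for y using trans_nonzero[OF SD[OF that]] unfolding g_def by simp
  have sub: "S \<subseteq> chart_img c (triv_dom B l)" if "l \<in> {i, j}" for l
    using that SD unfolding S_def by (auto simp: mem_chart_img[OF c])
  have si: "smooth_on (logw i c) S" "smooth_on (logw j c) S"
    using smooth_on_logw[OF c] smooth_on_subset sub by blast+
  define f where "f y = logw j c y - logw i c y" for y
  have sf: "smooth_on f S" unfolding f_def by (rule smooth_on_diff[OF S si(2,1)])
  have fg: "f y = ln ((cmod (g y))\<^sup>2)" if "y \<in> S" for y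
    unfolding f_def logw_def g_def comp_def
    using weight_trans[OF SD[OF that]] weight_pos[OF SD(1)[OF that]] trans_nonzero[OF SD[OF that]]
    by (simp add: ln_mult)
  have "levi (logw j c) x X Y = levi (\<lambda>y. f y + logw i c y) x X Y"
    unfolding f_def by simp
  also have "\<dots> = levi f x X Y + levi (logw i c) x X Y"
    by (rule levi_add[OF S xS sf si(1)])
  also have "levi f x X Y = levi (\<lambda>y. ln ((cmod (g y))\<^sup>2)) x X Y"
    using levi_cong[OF S xS fg] by simp
  also have "\<dots> = 0" by (rule levi_pluriharmonic[OF g S xS gnz])
  finally show ?thesis by simp
qed

text \<open>Coordinate changes are holomorphic, and the Levi form is natural under holomorphic
  maps.\<close>

lemma levi_logw_chart:
  assumes c: "c \<in> A" and d: "d \<in> A" and p: "p \<in> fst c" "p \<in> fst d" "p \<in> triv_dom B i"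
    and X: "X \<in> tangent_space A p" and Y: "Y \<in> tangent_space A p"
  shows "levi (logw i c) (snd c p) (X c) (Y c) = levi (logw i d) (snd d p) (X d) (Y d)"
proof -
  define S where "S = chart_img c (fst d \<inter> triv_dom B i)"
  define T where "T = snd d \<circ> chart_inv c"
  have S: "open S" unfolding S_def by (intro open_chart_img[OF c] open_Int open_triv open_dom[OF d])
  have xS: "snd c p \<in> S" unfolding S_def using p by (intro chart_img_I) auto
  have "S \<subseteq> chart_img c (fst d)" unfolding S_def chart_img_def by auto
  then have T: "vholo_on T S" unfolding T_def by (rule vholo_on_subset[OF vholo_on_transition[OF c d]])
  have TS: "T ` S \<subseteq> chart_img d (triv_dom B i)" unfolding S_def T_def by (rule transition_image[OF c d])
  have "levi (logw i c) (snd c p) (X c) (Y c) = levi (\<lambda>y. logw i d (T y)) (snd c p) (X c) (Y c)"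
  proof -
    have "logw i c y = logw i d (T y)" if "y \<in> S" for y
      using that d unfolding S_def T_def logw_def by (simp add: mem_chart_img[OF c] chart_inv_snd)
    then show ?thesis using levi_cong[OF S xS] by metis
  qed
  also have "\<dots> = levi (logw i d) (T (snd c p)) (fd T (snd c p) (X c)) (fd T (snd c p) (Y c))"
    by (rule levi_compose[OF S xS open_chart_img[OF d open_triv] T TS smooth_on_logw[OF d]])
  also have "T (snd c p) = snd d p" unfolding T_def using c p by (simp add: chart_inv_snd)
  also have "fd T (snd c p) (X c) = X d"
    unfolding T_def using tangent_space_transition[OF X c p(1) d p(2)] by simp
  also have "fd T (snd c p) (Y c) = Y d"
    unfolding T_def using tangent_space_transition[OF Y c p(1) d p(2)] by simp
  finally show ?thesis .
qed

end

lemma tensor_power_hermitian_bundle: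
  assumes "hermitian_bundle A L" shows "hermitian_bundle A (tensor_power L k)"
proof -
  interpret hermitian_bundle A L by (rule assms)
  have h: "holo_fun A U (\<lambda>z. f z ^ k)" if "holo_fun A U f" for U f
    using that unfolding holo_fun_def by (auto simp: comp_def intro: holo_on_power)
  have s: "smooth_fun A U (\<lambda>z. f z ^ k)" if "smooth_fun A U f" "open U" for U and f :: "'a \<Rightarrow> real"
    using that unfolding smooth_fun_def smooth_on_def
    by (auto simp: comp_def intro: Ck_on_power open_chart_img)
  have "herm_holo_line_bundle A (tensor_power L k)"
    unfolding herm_holo_line_bundle_def tensor_power_def herm_line_bundle.simps
  proof (intro conjI allI ballI)
    show "(\<Union>i. triv_dom L i) = UNIV" using ex_triv by auto
    show "trans L i j z ^ k * trans L j l z ^ k = trans L i l z ^ k"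
      if "z \<in> triv_dom L i \<inter> triv_dom L j \<inter> triv_dom L l" for i j l z
      using trans_cocycle[of z i j l] that by (simp add: power_mult_distrib[symmetric])
    show "weight L j z ^ k = (cmod (trans L i j z ^ k))\<^sup>2 * weight L i z ^ k"
      if "z \<in> triv_dom L i \<inter> triv_dom L j" for i j z
      using weight_trans[of z i j] that
      by (simp add: norm_power power_mult_distrib power_mult[symmetric] mult.commute)
  qed (use open_triv trans_nonzero trans_self weight_pos in \<open>auto intro!: h s trans_holo weight_smooth\<close>)
  then show ?thesis by unfold_locales
qed

section \<open>The Kaehler form in charts\<close>

text \<open>The Hermitian form whose real part is half the metric of \<open>\<omega>\<close>.\<close>

definition herm_form :: "(complex^'m::finite \<Rightarrow> complex^'m \<Rightarrow> real) \<Rightarrow> complex^'m \<Rightarrow> complex^'m \<Rightarrow> complex" where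
  "herm_form \<omega> X Y = Complex (\<omega> X (\<i> *s Y) / 2) (- \<omega> X Y / 2)"

lemma complex_linear_expand:
  fixes f :: "complex^'m::finite \<Rightarrow> complex"
  assumes "linear f" "\<And>v. f (\<i> *s v) = \<i> * f v"
  shows "f v = (\<Sum>j\<in>UNIV. v $ j * f (axis j 1))"
proof -
  have "f v = f (\<Sum>j\<in>UNIV. v $ j *s axis j 1)" by (simp add: basis_expansion)
  also have "\<dots> = (\<Sum>j\<in>UNIV. v $ j * f (axis j 1))"
    using assms by (simp add: linear_sum real_linear_complex_homogeneous)
  finally show ?thesis .
qed

text \<open>Only the algebra of a \<open>J\<close>-invariant two-form is collected here.
  Nondegeneracy enters separately, through positivity of the metric.\<close>

locale symplectic_form =
  fixes \<omega> :: "complex^'m::finite \<Rightarrow> complex^'m \<Rightarrow> real"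
  assumes lin2: "\<And>X. linear (\<omega> X)"
    and antisym: "\<And>X Y. \<omega> X Y = - \<omega> Y X"
    and J_inv: "\<And>X Y. \<omega> (\<i> *s X) (\<i> *s Y) = \<omega> X Y"
begin

lemma lin1: "linear (\<lambda>X. \<omega> X Y)"
proof -
  have "(\<lambda>X. \<omega> X Y) = (\<lambda>X. - \<omega> Y X)" using antisym by blast
  then show ?thesis using linear_compose_neg[OF lin2[of Y]] by simp
qed

lemma J_left: "\<omega> (\<i> *s X) Y = - \<omega> X (\<i> *s Y)"
  using J_inv[of "\<i> *s X" Y] linear_neg[OF lin1, of _ "\<i> *s Y"] by simp

text \<open>\<open>J\<close>-invariance makes \<open>herm_form\<close> complex linear in the first
  slot and conjugate linear in the second, so it is determined by its values on the vectors
  \<open>axis j 1\<close>. The second slot is treated by passing to conjugates.\<close>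

lemma herm_form_expand: "herm_form \<omega> X Y = (\<Sum>j\<in>UNIV. \<Sum>k\<in>UNIV. herm_form \<omega> (axis j 1) (axis k 1) * (X $ j * cnj (Y $ k)))"
proof -
  have 1: "herm_form \<omega> X Y = (\<Sum>j\<in>UNIV. X $ j * herm_form \<omega> (axis j 1) Y)" for X Y
  proof (rule complex_linear_expand)
    show "linear (\<lambda>X. herm_form \<omega> X Y)"
      unfolding herm_form_def
      by (rule linearI) (auto simp: linear_add[OF lin1] linear_scale[OF lin1] complex_eq_iff field_simps)
    show "herm_form \<omega> (\<i> *s v) Y = \<i> * herm_form \<omega> v Y" for v
      unfolding herm_form_def using J_inv[of v Y] J_left[of v Y] by (simp add: complex_eq_iff)
  qed
  have 2: "cnj (herm_form \<omega> X Y) = (\<Sum>k\<in>UNIV. Y $ k * cnj (herm_form \<omega> X (axis k 1)))" for X Y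
  proof (rule complex_linear_expand[of "\<lambda>Y. cnj (herm_form \<omega> X Y)"])
    show "linear (\<lambda>Y. cnj (herm_form \<omega> X Y))"
      unfolding herm_form_def
      by (rule linearI) (auto simp: linear_add[OF lin2] linear_scale[OF lin2] vector_add_ldistrib complex_eq_iff field_simps
          linear_add[OF linear_smult] linear_scale[OF linear_smult])
    show "cnj (herm_form \<omega> X (\<i> *s v)) = \<i> * cnj (herm_form \<omega> X v)" for v
      unfolding herm_form_def by (simp add: complex_eq_iff linear_neg[OF lin2])
  qed
  have 3: "herm_form \<omega> X Y = (\<Sum>k\<in>UNIV. cnj (Y $ k) * herm_form \<omega> X (axis k 1))" for X Y
    using arg_cong[OF 2[of X Y], of cnj] by simp
  have "herm_form \<omega> X Y = (\<Sum>j\<in>UNIV. X $ j * (\<Sum>k\<in>UNIV. cnj (Y $ k) * herm_form \<omega> (axis j 1) (axis k 1)))"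
    using 1[of X Y] 3[of "axis j 1" Y for j] by simp
  then show ?thesis by (simp add: sum_distrib_left mult_ac)
qed

lemma herm_form_cnj: "herm_form \<omega> X Y = cnj (herm_form \<omega> Y X)"
proof -
  have "\<omega> Y (\<i> *s X) = \<omega> X (\<i> *s Y)" using antisym[of Y "\<i> *s X"] J_left[of X Y] by linarith
  moreover have "\<omega> Y X = - \<omega> X Y" by (rule antisym)
  ultimately show ?thesis unfolding herm_form_def by (simp add: complex_eq_iff)
qed

text \<open>Antisymmetrising a Hermitian form keeps its imaginary part, which is the two-form up to
  a factor. The right-hand side has the shape in which \<open>kahler_form\<close> is
  defined.\<close>

lemma omega_eq_herm_form: "\<omega> X Y = Re (\<i> * (herm_form \<omega> X Y - herm_form \<omega> Y X))"
proof -
  have "\<omega> Y X = - \<omega> X Y" by (rule antisym)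
  then show ?thesis unfolding herm_form_def by simp
qed

end

lemma symplectic_form_levi:
  assumes "open S" "smooth_on u S" "x \<in> S" shows "symplectic_form (levi u x)"
proof (rule symplectic_form.intro)
  note l1 = smooth_on_linear_hess1[OF assms(2,3)] and l2 = smooth_on_linear_hess2[OF assms]
  note sym = smooth_on_hess_commute[OF assms]
  show "linear (levi u x X)" for X
    unfolding levi_def
    by (rule linearI) (auto simp: linear_add[OF l2] linear_scale[OF l2] linear_add[OF linear_smult] linear_scale[OF linear_smult] field_simps)
  show "levi u x X Y = - levi u x Y X" for X Y
    unfolding levi_def sym[of X "\<i> *s Y"] sym[of "\<i> *s X" Y] by (simp add: field_simps)
  show "levi u x (\<i> *s X) (\<i> *s Y) = levi u x X Y" for X Y
    unfolding levi_def by (simp add: linear_neg[OF l1] linear_neg[OF l2])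
qed

locale polarized_manifold =
  fixes A :: "('a::t2_space, 'm::finite) chart set" and L :: "('a, 'i) herm_line_bundle"
  assumes polarized: "polarized_kahler_manifold A L"
begin

sublocale hermitian_bundle A L
proof unfold_locales
  show "complex_atlas A" "herm_holo_line_bundle A L"
    using polarized unfolding polarized_kahler_manifold_def by auto
qed

text \<open>The mixed Wirtinger derivative of a real function unfolds into four real second
  derivatives, and these are the ones occurring in the two components of \<open>herm_form\<close>.
  The frame chosen in \<open>kahler_coeffs\<close> may be exchanged because the Levi form does not
  see it.\<close>

lemma kahler_coeffs_eq:
  assumes c: "c \<in> A" and p: "p \<in> fst c" "p \<in> triv_dom L i"
  shows "kahler_coeffs L c p $ j $ k = herm_form (levi (logw i c) (snd c p)) (axis j 1) (axis k 1)"
proof -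
  define i0 where "i0 = triv_at L p"
  have i0: "p \<in> triv_dom L i0" unfolding i0_def by (rule triv_at)
  define S where "S = chart_img c (triv_dom L i0)"
  have S: "open S" unfolding S_def by (rule open_chart_img[OF c open_triv])
  define x where "x = snd c p"
  have x: "x \<in> S" unfolding S_def x_def by (rule chart_img_I[OF p(1) i0])
  define u where "u = logw i0 c"
  have u: "smooth_on u S" unfolding u_def S_def by (rule smooth_on_logw[OF c])
  interpret symplectic_form "levi u x" by (rule symplectic_form_levi[OF S u x])
  define U where "U y = complex_of_real (u y)" for y
  have fdU: "fd U y v = of_real (fd u y v)" if "y \<in> S" for y v
    unfolding U_def
    by (rule fun_cong[OF fd_eqI]) (intro derivative_intros fd_has_derivative smooth_on_differentiable[OF u that])
  define W where "W y = (of_real (fd u y (axis k 1)) + \<i> * of_real (fd u y (axis k \<i>))) / 2" for y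
  have W: "wirtinger_bar k U y = W y" if "y \<in> S" for y
    unfolding wirtinger_bar_def W_def fdU[OF that] ..
  have dfu: "((\<lambda>y. fd u y w) has_derivative (\<lambda>v. hess u x v w)) (at x)" for w
    unfolding hess_def by (intro fd_has_derivative smooth_on_differentiable[OF smooth_on_fd[OF u] x])
  have "(W has_derivative (\<lambda>v. (of_real (hess u x v (axis k 1)) + \<i> * of_real (hess u x v (axis k \<i>))) / 2)) (at x)"
    unfolding W_def by (auto intro!: derivative_eq_intros dfu)
  then have fdW: "fd W x v = (of_real (hess u x v (axis k 1)) + \<i> * of_real (hess u x v (axis k \<i>))) / 2" for v
    by (simp add: fd_eqI)
  have ax: "axis l \<i> = \<i> *s (axis l 1 :: complex^'m)" for l by (simp add: vec_eq_iff axis_def)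
  have "kahler_coeffs L c p $ j $ k = - wirtinger j (wirtinger_bar k U) x"
    unfolding kahler_coeffs_def Let_def U_def u_def logw_def i0_def x_def by simp
  also have "wirtinger j (wirtinger_bar k U) x = wirtinger j W x"
    unfolding wirtinger_def using fd_cong[OF S x W] by simp
  also have "- wirtinger j W x = herm_form (levi u x) (axis j 1) (axis k 1)"
    unfolding wirtinger_def fdW herm_form_def levi_def ax using linear_neg[OF smooth_on_linear_hess2[OF S u x]]
    by (simp add: complex_eq_iff field_simps)
  also have "levi u x = levi (logw i c) x"
    unfolding u_def using levi_logw_triv[OF c, of x i0 i] x p i0 unfolding S_def x_def
    by (intro ext) (auto intro: chart_img_I)
  finally show ?thesis unfolding x_def .
qed

lemma symplectic_form_logw:
  assumes "c \<in> A" "x \<in> chart_img c (triv_dom L i)" shows "symplectic_form (levi (logw i c) x)"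
  by (rule symplectic_form_levi[OF open_chart_img[OF assms(1) open_triv] smooth_on_logw[OF assms(1)] assms(2)])

text \<open>The coefficient sum is an antisymmetrised Hermitian form and so collapses to the Levi
  form in the chosen chart; invariance under coordinate changes frees the choice of the
  chart.\<close>

lemma kahler_form_eq:
  assumes c: "c \<in> A" and p: "p \<in> fst c" "p \<in> triv_dom L i"
    and X: "X \<in> tangent_space A p" and Y: "Y \<in> tangent_space A p"
  shows "kahler_form A L p X Y = levi (logw i c) (snd c p) (X c) (Y c)"
proof -
  define d where "d = chart_at A p"
  have d: "d \<in> A" "p \<in> fst d" unfolding d_def by (rule chart_at)+
  interpret symplectic_form "levi (logw i d) (snd d p)"
    by (rule symplectic_form_logw[OF d(1) chart_img_I[OF d(2) p(2)]])
  have "kahler_form A L p X Y = Re (\<i> * (\<Sum>j\<in>UNIV. \<Sum>k\<in>UNIV. kahler_coeffs L d p $ j $ k * (X d $ j * cnj (Y d $ k) - Y d $ j * cnj (X d $ k))))"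
    unfolding kahler_form_def Let_def d_def ..
  also have "\<dots> = Re (\<i> * (herm_form (levi (logw i d) (snd d p)) (X d) (Y d) - herm_form (levi (logw i d) (snd d p)) (Y d) (X d)))"
    unfolding kahler_coeffs_eq[OF d p(2)] herm_form_expand[of "X d" "Y d"] herm_form_expand[of "Y d" "X d"]
    by (simp add: sum_subtractf right_diff_distrib)
  also have "\<dots> = levi (logw i d) (snd d p) (X d) (Y d)"
    by (rule omega_eq_herm_form[symmetric])
  also have "\<dots> = levi (logw i c) (snd c p) (X c) (Y c)"
    by (rule levi_logw_chart[OF d(1) c d(2) p X Y])
  finally show ?thesis .
qed

text \<open>Positivity of the metric is assumed for tangent vectors; \<open>tvec\<close> turns the
  coordinate vector \<open>v\<close> into one. This is the nondegeneracy of the form.\<close>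

lemma levi_logw_pos:
  assumes c: "c \<in> A" and x: "x \<in> chart_img c (triv_dom L i)" and v: "v \<noteq> 0"
  shows "levi (logw i c) x v (\<i> *s v) > 0"
proof -
  define p where "p = chart_inv c x"
  have xi: "x \<in> snd c ` fst c" and p: "p \<in> triv_dom L i" "p \<in> fst c" "snd c p = x"
    using x mem_chart_img[OF c] chart_inv_mem[OF c] snd_chart_inv[OF c] unfolding p_def by auto
  define X where "X = tvec c p v"
  have X: "X \<in> tangent_space A p" "X c = v" unfolding X_def using tvec_in_tangent_space tvec_self c p by auto
  have "kahler_metric A L p X X > 0"
    using polarized X v unfolding polarized_kahler_manifold_def by (metis)
  then show ?thesis
    using kahler_form_eq[OF c p(2,1) X(1) cplx_J_tangent_space[OF X(1)]] X p
    unfolding kahler_metric_def cplx_J_def by simp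
qed

lemma det_kahler_coeffs:
  assumes c: "c \<in> A" and p: "p \<in> fst c"
  shows "Im (det (kahler_coeffs L c p)) = 0" "Re (det (kahler_coeffs L c p)) > 0"
proof -
  obtain i where i: "p \<in> triv_dom L i" using ex_triv by blast
  have x: "snd c p \<in> chart_img c (triv_dom L i)" by (rule chart_img_I[OF p i])
  interpret symplectic_form "levi (logw i c) (snd c p)" by (rule symplectic_form_logw[OF c x])
  have h: "kahler_coeffs L c p $ j $ k = cnj (kahler_coeffs L c p $ k $ j)" for j k
    unfolding kahler_coeffs_eq[OF c p i] by (rule herm_form_cnj)
  show "Im (det (kahler_coeffs L c p)) = 0" by (rule det_hermitian_real[OF h])
  show "Re (det (kahler_coeffs L c p)) > 0"
  proof (rule det_hermitian_pos[OF h])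
    fix v :: "complex^'m" assume v: "v \<noteq> 0"
    show "Re (\<Sum>j\<in>UNIV. \<Sum>k\<in>UNIV. kahler_coeffs L c p $ j $ k * (v $ j * cnj (v $ k))) > 0"
      unfolding kahler_coeffs_eq[OF c p i] herm_form_expand[symmetric]
      using levi_logw_pos[OF c x v] by (simp add: herm_form_def)
  qed
qed

end

section \<open>The Hamiltonian vector field\<close>

locale hamiltonian_system = polarized_manifold A L
  for A :: "('a::t2_space, 'm::finite) chart set" and L :: "('a, 'i) herm_line_bundle" +
  fixes H :: "'a \<Rightarrow> real"
  assumes H_smooth: "smooth_fun A UNIV H"
begin

abbreviation ham :: "'a \<Rightarrow> ('a, 'm) tvec" where
  "ham \<equiv> hamiltonian_field A L H"

lemma smooth_on_H: "c \<in> A \<Longrightarrow> smooth_on (H \<circ> chart_inv c) (snd c ` fst c)"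
  using H_smooth unfolding smooth_fun_def chart_img_UNIV by blast

lemma H_has_derivative:
  assumes "c \<in> A" "p \<in> fst c"
  shows "((H \<circ> chart_inv c) has_derivative fd (H \<circ> chart_inv c) (snd c p)) (at (snd c p))"
  using assms by (intro fd_has_derivative smooth_on_differentiable[OF smooth_on_H]) auto

text \<open>Testing against \<open>J\<close> of the difference gives the square length of the
  difference, which is positive unless the difference is 0.\<close>

lemma hamiltonian_field_unique:
  assumes "X \<in> tangent_space A p" "X' \<in> tangent_space A p"
    "\<And>Y. Y \<in> tangent_space A p \<Longrightarrow> kahler_form A L p X Y = kahler_form A L p X' Y"
  shows "X = X'"
proof -
  obtain c i where c: "c \<in> A" "p \<in> fst c" and i: "p \<in> triv_dom L i" using ex_chart ex_triv by blast
  have x: "snd c p \<in> chart_img c (triv_dom L i)" by (rule chart_img_I[OF c(2) i])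
  interpret symplectic_form "levi (logw i c) (snd c p)" by (rule symplectic_form_logw[OF c(1) x])
  define v where "v = X c - X' c"
  define Y where "Y = tvec c p (\<i> *s v)"
  have Y: "Y \<in> tangent_space A p" "Y c = \<i> *s v"
    unfolding Y_def using tvec_in_tangent_space tvec_self c by auto
  have "levi (logw i c) (snd c p) v (\<i> *s v) = 0"
    using assms(3)[OF Y(1)] kahler_form_eq[OF c i assms(1) Y(1)] kahler_form_eq[OF c i assms(2) Y(1)] Y(2)
    unfolding v_def linear_diff[OF lin1] by simp
  then have "v = 0" using levi_logw_pos[OF c(1) x] by fastforce
  then show ?thesis using tangent_space_eqI[OF assms(1,2) c] unfolding v_def by simp
qed

text \<open>Contraction with the form is injective by positivity and hence surjective by dimension;
  the real inner product represents functionals by vectors.\<close>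

lemma hamiltonian_field_ex:
  "\<exists>X. X \<in> tangent_space A p \<and> (\<forall>Y\<in>tangent_space A p. differential A H p Y = kahler_form A L p X Y)"
proof -
  obtain c i where c: "c \<in> A" "p \<in> fst c" and i: "p \<in> triv_dom L i" using ex_chart ex_triv by blast
  have x: "snd c p \<in> chart_img c (triv_dom L i)" by (rule chart_img_I[OF c(2) i])
  interpret symplectic_form "levi (logw i c) (snd c p)" by (rule symplectic_form_logw[OF c(1) x])
  define l where "l = fd (H \<circ> chart_inv c) (snd c p)"
  have l: "linear l" unfolding l_def using H_has_derivative[OF c] has_derivative_linear by blast
  define M where "M v = (\<Sum>b\<in>Basis. levi (logw i c) (snd c p) v b *\<^sub>R b)" for v
  have "linear M" unfolding M_def
    by (rule linearI) (auto simp: linear_add[OF lin1] linear_scale[OF lin1] scaleR_left_distrib sum.distrib scaleR_sum_right)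
  have Mb: "M v \<bullet> w = levi (logw i c) (snd c p) v w" for v w
    unfolding M_def by (rule linear_eq_inner_Basis[OF lin2])
  have "inj M"
    unfolding linear_injective_0[OF \<open>linear M\<close>]
  proof (intro allI impI)
    fix v assume "M v = 0"
    then have "levi (logw i c) (snd c p) v (\<i> *s v) = 0" using Mb[of v "\<i> *s v"] by simp
    then show "v = 0" using levi_logw_pos[OF c(1) x] by fastforce
  qed
  then have "surj M" using linear_injective_imp_surjective[OF \<open>linear M\<close>] by blast
  then obtain v where v: "M v = (\<Sum>b\<in>Basis. l b *\<^sub>R b)" by (metis surjD)
  have lv: "levi (logw i c) (snd c p) v w = l w" for w
    using Mb[of v w] linear_eq_inner_Basis[OF l, of w] v by simp
  have t: "tvec c p v \<in> tangent_space A p" "tvec c p v c = v" using tvec_in_tangent_space tvec_self c by auto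
  have "differential A H p Y = kahler_form A L p (tvec c p v) Y" if Y: "Y \<in> tangent_space A p" for Y
    using differential_chart[OF Y c H_has_derivative[OF c]] kahler_form_eq[OF c i t(1) Y] t(2) lv
    unfolding l_def by simp
  then show ?thesis using t(1) by blast
qed

lemma
  shows ham_tangent: "ham p \<in> tangent_space A p"
    and differential_H: "Y \<in> tangent_space A p \<Longrightarrow> differential A H p Y = kahler_form A L p (ham p) Y"
proof -
  have "\<exists>!X. X \<in> tangent_space A p \<and> (\<forall>Y\<in>tangent_space A p. differential A H p Y = kahler_form A L p X Y)"
    using hamiltonian_field_ex[of p] by (auto intro!: hamiltonian_field_unique)
  from theI'[OF this]
  show "ham p \<in> tangent_space A p" "Y \<in> tangent_space A p \<Longrightarrow> differential A H p Y = kahler_form A L p (ham p) Y"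
    unfolding hamiltonian_field_def by blast+
qed

lemma hamiltonian_fieldI:
  assumes "X \<in> tangent_space A p" "\<And>Y. Y \<in> tangent_space A p \<Longrightarrow> differential A H p Y = kahler_form A L p X Y"
  shows "ham p = X"
  using hamiltonian_field_unique[OF ham_tangent assms(1)] assms(2) differential_H by metis

lemma kahler_metric_J:
  assumes "X \<in> tangent_space A p" "Y \<in> tangent_space A p"
  shows "kahler_metric A L p (cplx_J X) Y = kahler_form A L p X Y"
proof -
  obtain c i where c: "c \<in> A" "p \<in> fst c" and i: "p \<in> triv_dom L i" using ex_chart ex_triv by blast
  interpret symplectic_form "levi (logw i c) (snd c p)"
    by (rule symplectic_form_logw[OF c(1) chart_img_I[OF c(2) i]])
  show ?thesis unfolding kahler_metric_def
    using kahler_form_eq[OF c i cplx_J_tangent_space[OF assms(1)] cplx_J_tangent_space[OF assms(2)]]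
      kahler_form_eq[OF c i assms] by (simp add: cplx_J_def J_inv)
qed

lemma gradient_field_eq: "gradient_field A L H p = cplx_J (ham p)"
  unfolding gradient_field_def
proof (rule the_equality)
  show "cplx_J (ham p) \<in> tangent_space A p \<and> (\<forall>Y\<in>tangent_space A p. differential A H p Y = kahler_metric A L p (cplx_J (ham p)) Y)"
    using cplx_J_tangent_space[OF ham_tangent] kahler_metric_J[OF ham_tangent] differential_H by auto
  fix X assume X: "X \<in> tangent_space A p \<and> (\<forall>Y\<in>tangent_space A p. differential A H p Y = kahler_metric A L p X Y)"
  \<comment> \<open>Applying \<open>J\<close> three times inverts it and visibly preserves tangent
    spaces.\<close>
  define X' where "X' = cplx_J (cplx_J (cplx_J X))"
  have JJ: "cplx_J X' = X" unfolding X'_def cplx_J_def by (auto simp: vec_eq_iff fun_eq_iff)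
  have X': "X' \<in> tangent_space A p" unfolding X'_def using X cplx_J_tangent_space by blast
  have "ham p = X'"
    using X kahler_metric_J[OF X'] JJ by (intro hamiltonian_fieldI[OF X']) auto
  then show "X = cplx_J (ham p)" using JJ by simp
qed

definition xi :: "('a, 'm) chart \<Rightarrow> complex^'m \<Rightarrow> complex^'m" where
  "xi c x = ham (chart_inv c x) c"

text \<open>Working form of Hamilton's equation. Continuity of the field comes from solving it,
  holomorphy of the moment function and invariance of the two-form from differentiating it.\<close>

lemma xi_eq:
  assumes c: "c \<in> A" and x: "x \<in> chart_img c (triv_dom L i)"
  shows "fd (H \<circ> chart_inv c) x v = levi (logw i c) x (xi c x) v"
proof -
  define p where "p = chart_inv c x"
  have p: "p \<in> fst c" "p \<in> triv_dom L i" "snd c p = x"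
    using x mem_chart_img[OF c] chart_inv_mem[OF c] snd_chart_inv[OF c] unfolding p_def by auto
  have Y: "tvec c p v \<in> tangent_space A p" "tvec c p v c = v" using tvec_in_tangent_space tvec_self c p by auto
  show ?thesis
    using differential_H[OF Y(1)] differential_chart[OF Y(1) c p(1) H_has_derivative[OF c p(1)]]
      kahler_form_eq[OF c p(1,2) ham_tangent Y(1)] Y(2) p(3) unfolding xi_def p_def by simp
qed

lemma ham_critical:
  assumes "\<And>Y. Y \<in> tangent_space A p \<Longrightarrow> differential A H p Y = 0"
  shows "ham p = (\<lambda>c. 0)"
proof (rule hamiltonian_fieldI)
  obtain c i where c: "c \<in> A" "p \<in> fst c" and i: "p \<in> triv_dom L i" using ex_chart ex_triv by blast
  interpret symplectic_form "levi (logw i c) (snd c p)"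
    by (rule symplectic_form_logw[OF c(1) chart_img_I[OF c(2) i]])
  have "fd (snd d \<circ> chart_inv e) (snd e p) 0 = 0" if "d \<in> A" "e \<in> A" "p \<in> fst d" "p \<in> fst e" for d e
    using linear_0[OF has_derivative_linear[OF transition_fd_has_derivative[OF that(2,1,4,3)]]] .
  then show z: "(\<lambda>c. 0) \<in> tangent_space A p" unfolding tangent_space_def by auto
  show "differential A H p Y = kahler_form A L p (\<lambda>c. 0) Y" if "Y \<in> tangent_space A p" for Y
    using assms[OF that] kahler_form_eq[OF c i z that] linear_0[OF lin1] by simp
qed

end

section \<open>Sections along the gradient flow\<close>

text \<open>Where \<open>a \<ge> - M\<close>, the function \<open>f t * exp (M * t)\<close> is
  nondecreasing. Beyond some \<open>T\<close> the choice \<open>M = - \<delta>\<close> forces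
  exponential growth unless \<open>f T = 0\<close>, against the finite limit; on
  \<open>[0, T]\<close> a bound of \<open>\<bar>a\<bar>\<close> as \<open>M\<close> carries this
  zero back to time 0.\<close>

lemma exponential_growth_zero:
  fixes f a :: "real \<Rightarrow> real"
  assumes f: "\<And>t. (f has_real_derivative a t * f t) (at t)" and pos: "\<And>t. f t \<ge> 0"
    and a: "continuous_on UNIV a" "\<forall>\<^sub>F t in at_top. a t \<ge> \<delta>" and \<delta>: "\<delta> > 0"
    and lim: "(f \<longlongrightarrow> l) at_top"
  shows "f 0 = 0"
proof -
  have "\<forall>\<^sub>F t in at_top. f t < l + 1" using lim by (rule order_tendstoD) simp
  then obtain T0 where T0: "\<And>t. t \<ge> T0 \<Longrightarrow> a t \<ge> \<delta> \<and> f t < l + 1"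
    using a(2) eventually_conj unfolding eventually_at_top_linorder by (metis (mono_tags, lifting) linorder_linear order_trans)
  define T where "T = max T0 0"
  have T: "T \<ge> 0" "\<And>t. t \<ge> T \<Longrightarrow> a t \<ge> \<delta>" "\<And>t. t \<ge> T \<Longrightarrow> f t < l + 1" using T0 unfolding T_def by auto
  have mono: "f x * exp (M * x) \<le> f y * exp (M * y)" if "x \<le> y" "\<And>t. x \<le> t \<Longrightarrow> t \<le> y \<Longrightarrow> a t \<ge> - M" for x y M
  proof (rule DERIV_nonneg_imp_nondecreasing[OF that(1)])
    fix t assume t: "x \<le> t" "t \<le> y"
    have "((\<lambda>t. f t * exp (M * t)) has_real_derivative (a t + M) * (f t * exp (M * t))) (at t)"
      by (auto intro!: derivative_eq_intros f simp: algebra_simps)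
    moreover have "(a t + M) * (f t * exp (M * t)) \<ge> 0" using that(2)[OF t] pos[of t] by simp
    ultimately show "\<exists>y. ((\<lambda>t. f t * exp (M * t)) has_real_derivative y) (at t) \<and> 0 \<le> y" by blast
  qed
  have fT: "f T = 0"
  proof (rule ccontr)
    assume "f T \<noteq> 0"
    then have fT: "f T > 0" using pos[of T] by simp
    have g: "f T * exp (\<delta> * (t - T)) \<le> f t" if "t \<ge> T" for t
    proof -
      have "f T * exp (- \<delta> * T) \<le> f t * exp (- \<delta> * t)" using T that by (intro mono) auto
      then have "f T * exp (- \<delta> * T) * exp (\<delta> * t) \<le> f t * exp (- \<delta> * t) * exp (\<delta> * t)" by (rule mult_right_mono) simp
      then show ?thesis by (simp add: mult.assoc exp_add[symmetric] right_diff_distrib)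
    qed
    \<comment> \<open>At this time the linear lower bound \<open>1 + \<delta> * (t - T)\<close> of
      the exponential already lifts \<open>f\<close> to \<open>l + 1\<close>.\<close>
    define t where "t = T + (l + 1) / (f T * \<delta>)"
    have l: "l + 1 > 0" using T(3)[of T] pos[of T] by simp
    have t: "t \<ge> T" unfolding t_def using l fT \<delta> by simp
    have "l + 1 \<le> f T * (1 + \<delta> * (t - T))" unfolding t_def using fT \<delta> by (simp add: field_simps)
    also have "\<dots> \<le> f T * exp (\<delta> * (t - T))" using fT by (intro mult_left_mono exp_ge_add_one_self) simp
    also have "\<dots> \<le> f t" by (rule g[OF t])
    finally show False using T(3)[OF t] by simp
  qed
  have "compact (a ` {0..T})" by (intro compact_continuous_image continuous_on_subset[OF a(1)]) auto
  then have "bounded (a ` {0..T})" by (rule compact_imp_bounded)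
  then obtain M where "\<forall>y\<in>a ` {0..T}. norm y \<le> M" unfolding bounded_iff by blast
  then have M: "\<bar>a t\<bar> \<le> M" if "0 \<le> t" "t \<le> T" for t using that by auto
  have "f 0 * exp (M * 0) \<le> f T * exp (M * T)"
  proof (rule mono[OF T(1)])
    show "a t \<ge> - M" if "0 \<le> t" "t \<le> T" for t using M[OF that] by linarith
  qed
  then show ?thesis using fT pos[of 0] by simp
qed

section \<open>Continuous sections and the connection form\<close>

context hermitian_bundle
begin

definition cont_section :: "('a, 'i) sect \<Rightarrow> bool" where
  "cont_section s \<longleftrightarrow> (\<forall>z. s z \<in> fibre B z) \<and> (\<forall>i. continuous_on (triv_dom B i) (\<lambda>z. s z i))"

lemma holo_fun_continuous_on: "holo_fun A U f \<Longrightarrow> open U \<Longrightarrow> continuous_on U f"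
  by (rule C1_fun_continuous_on[OF holo_fun_C1_fun])

lemma holo_sections_cont_section: "s \<in> holo_sections A B \<Longrightarrow> cont_section s"
  unfolding holo_sections_def cont_section_def using holo_fun_continuous_on open_triv by blast

lemma continuous_on_weight: "continuous_on (triv_dom B i) (weight B i)"
  by (rule C1_fun_continuous_on[OF smooth_fun_C1_fun[OF weight_smooth] open_triv])

lemma continuous_on_herm:
  assumes "cont_section s" "cont_section t"
  shows "continuous_on UNIV (\<lambda>z. herm B z (s z) (t z))"
proof (rule continuous_at_imp_continuous_on, rule ballI)
  fix z
  obtain i where i: "z \<in> triv_dom B i" using ex_triv by blast
  have "continuous_on (triv_dom B i) (\<lambda>z. of_real (weight B i z) * s z i * cnj (t z i))"
    using assms unfolding cont_section_def by (intro continuous_intros continuous_on_weight) auto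
  then have "continuous_on (triv_dom B i) (\<lambda>z. herm B z (s z) (t z))"
    by (rule continuous_on_eq) (use assms in \<open>auto simp: cont_section_def herm_eq\<close>)
  then show "isCont (\<lambda>z. herm B z (s z) (t z)) z"
    using continuous_on_eq_continuous_at[OF open_triv] i by blast
qed

lemma section_has_derivative:
  assumes "s \<in> holo_sections A B" "c \<in> A" "p \<in> fst c" "p \<in> triv_dom B i"
  shows "(((\<lambda>z. s z i) \<circ> chart_inv c) has_derivative fd ((\<lambda>z. s z i) \<circ> chart_inv c) (snd c p)) (at (snd c p))"
  using assms by (intro holo_fun_has_derivative[of "triv_dom B i"]) (auto simp: holo_sections_def)

lemma section_fd_smult:
  assumes "s \<in> holo_sections A B" "c \<in> A" "p \<in> fst c" "p \<in> triv_dom B i"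
  shows "fd ((\<lambda>z. s z i) \<circ> chart_inv c) (snd c p) (\<zeta> *s v) = \<zeta> * fd ((\<lambda>z. s z i) \<circ> chart_inv c) (snd c p) v"
  using assms by (intro holo_on_smult[OF _ chart_img_I[of p c "triv_dom B i"]]) (auto simp: holo_sections_def holo_fun_def)

lemma holo_sections_fibre: "s \<in> holo_sections A B \<Longrightarrow> s z \<in> fibre B z"
  unfolding holo_sections_def by blast

text \<open>The connection form of the Chern connection in a frame and a chart: the (1,0)-part of
  the differential of the log weight.\<close>

definition dlogw :: "'i \<Rightarrow> ('a, 'm) chart \<Rightarrow> complex^'m \<Rightarrow> complex^'m \<Rightarrow> complex" where
  "dlogw i c x v = (of_real (fd (logw i c) x v) - \<i> * of_real (fd (logw i c) x (\<i> *s v))) / 2"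

lemma logw_has_derivative:
  assumes "c \<in> A" "x \<in> chart_img c (triv_dom B i)"
  shows "(logw i c has_derivative fd (logw i c) x) (at x)"
  by (rule fd_has_derivative[OF smooth_on_differentiable[OF smooth_on_logw[OF assms(1)] assms(2)]])

lemma dlogw_i:
  assumes "c \<in> A" "x \<in> chart_img c (triv_dom B i)"
  shows "dlogw i c x (\<i> *s v) = \<i> * dlogw i c x v"
  unfolding dlogw_def using linear_neg[OF has_derivative_linear[OF logw_has_derivative[OF assms]], of v]
  by (simp add: algebra_simps)

end

locale quantum_system = hamiltonian_system A L H
  for A :: "('a::t2_space, 'm::finite) chart set" and L :: "('a, 'i) herm_line_bundle" and H :: "'a \<Rightarrow> real" +
  fixes k :: nat
  assumes k: "k \<ge> 1"
begin

abbreviation Lk :: "('a, 'i) herm_line_bundle" where "Lk \<equiv> tensor_power L k"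

sublocale Lk: hermitian_bundle A "tensor_power L k"
  by (rule tensor_power_hermitian_bundle) unfold_locales

lemma triv_dom_Lk [simp]: "triv_dom Lk = triv_dom L"
  unfolding tensor_power_def by simp

lemma weight_Lk: "weight Lk i z = weight L i z ^ k"
  unfolding tensor_power_def by simp

lemma chern_connection_eq:
  assumes s: "s \<in> holo_sections A Lk" and c: "c \<in> A" and p: "p \<in> fst c" "p \<in> triv_dom L i"
    and X: "X \<in> tangent_space A p"
  shows "chern_connection A Lk X s p i =
    fd ((\<lambda>z. s z i) \<circ> chart_inv c) (snd c p) (X c) + of_nat k * dlogw i c (snd c p) (X c) * s p i"
proof -
  have x: "snd c p \<in> chart_img c (triv_dom L i)" by (rule chart_img_I[OF p])
  have "((\<lambda>y. complex_of_real (real k * logw i c y)) has_derivative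
      (\<lambda>v. complex_of_real (real k * fd (logw i c) (snd c p) v))) (at (snd c p))"
    by (intro derivative_intros logw_has_derivative[OF c x])
  moreover have "complex_of_real (real k * logw i c y) = ((\<lambda>w. complex_of_real (ln (weight Lk i w))) \<circ> chart_inv c) y"
    if "y \<in> chart_img c (triv_dom L i)" for y
    using that weight_pos[of "chart_inv c y" i] by (simp add: mem_chart_img[OF c] weight_Lk logw_def ln_realpow)
  ultimately have d: "(((\<lambda>w. complex_of_real (ln (weight Lk i w))) \<circ> chart_inv c) has_derivative
      (\<lambda>v. complex_of_real (real k * fd (logw i c) (snd c p) v))) (at (snd c p))"
    using has_derivative_transform_within_open[OF _ open_chart_img[OF c open_triv] x] by blast
  have "del A (\<lambda>w. complex_of_real (ln (weight Lk i w))) p X = of_nat k * dlogw i c (snd c p) (X c)"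
    unfolding del_def differential_chart[OF X c p(1) d] differential_chart[OF cplx_J_tangent_space[OF X] c p(1) d]
    by (simp add: dlogw_def cplx_J_def algebra_simps)
  then show ?thesis
    unfolding chern_connection_def
    using p(2) differential_chart[OF X c p(1) Lk.section_has_derivative[OF s c p(1)]] by simp
qed

definition Hhat :: "('a, 'i) sect \<Rightarrow> ('a, 'i) sect" where
  "Hhat = quantum_hamiltonian A L k H"

text \<open>Connection form and Hamiltonian are grouped as \<open>dlogw - \<i> H\<close>, because
  this combination along the Hamiltonian field is the one that turns out to be holomorphic.\<close>

lemma Hhat_eq:
  assumes s: "s \<in> holo_sections A Lk" and c: "c \<in> A" and p: "p \<in> fst c" "p \<in> triv_dom L i"
  shows "Hhat s p i = \<i> / of_nat k * fd ((\<lambda>z. s z i) \<circ> chart_inv c) (snd c p) (ham p c)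
     + \<i> * (dlogw i c (snd c p) (ham p c) - \<i> * of_real (H p)) * s p i"
  unfolding Hhat_def quantum_hamiltonian_def chern_connection_eq[OF s c p ham_tangent]
  using k by (simp add: field_simps)

lemma eigensection_fd:
  assumes e: "eigensection A L k H s \<mu>" and c: "c \<in> A" and p: "p \<in> fst c" "p \<in> triv_dom L i"
  shows "fd ((\<lambda>z. s z i) \<circ> chart_inv c) (snd c p) (ham p c) =
    - of_nat k * (dlogw i c (snd c p) (ham p c) + \<i> * (\<mu> - of_real (H p))) * s p i"
proof -
  have s: "s \<in> holo_sections A Lk" and q: "Hhat s = (\<lambda>z i. \<mu> * s z i)"
    using e unfolding eigensection_def Hhat_def by auto
  have "Hhat s p i = \<mu> * s p i" unfolding q ..
  then have "\<i> / of_nat k * fd ((\<lambda>z. s z i) \<circ> chart_inv c) (snd c p) (ham p c)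
     = \<mu> * s p i - \<i> * (dlogw i c (snd c p) (ham p c) - \<i> * of_real (H p)) * s p i"
    unfolding Hhat_eq[OF s c p] by (simp add: algebra_simps)
  then have "(- \<i> * of_nat k) * (\<i> / of_nat k * fd ((\<lambda>z. s z i) \<circ> chart_inv c) (snd c p) (ham p c))
     = (- \<i> * of_nat k) * (\<mu> * s p i - \<i> * (dlogw i c (snd c p) (ham p c) - \<i> * of_real (H p)) * s p i)"
    by simp
  then show ?thesis using k by (simp add: algebra_simps)
qed

lemma norm_derivative_gradient:
  assumes e: "eigensection A L k H s (of_real \<mu>)" and \<gamma>: "integral_curve A (gradient_field A L H) \<gamma>"
  shows "((\<lambda>t. Re (herm Lk (\<gamma> t) (s (\<gamma> t)) (s (\<gamma> t)))) has_real_derivative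
      (2 * real k * (\<mu> - H (\<gamma> t))) * Re (herm Lk (\<gamma> t) (s (\<gamma> t)) (s (\<gamma> t)))) (at t)"
proof -
  have s: "s \<in> holo_sections A Lk" using e unfolding eigensection_def by blast
  obtain c i where c: "c \<in> A" "\<gamma> t \<in> fst c" and i: "\<gamma> t \<in> triv_dom L i" using ex_chart ex_triv by blast
  define U where "U = \<gamma> -` (fst c \<inter> triv_dom L i)"
  have contg: "continuous_on UNIV \<gamma>" using \<gamma> unfolding integral_curve_def by blast
  have U: "open U" unfolding U_def
    using contg open_dom[OF c(1)] open_triv by (intro open_vimage open_Int) auto
  have tU: "t \<in> U" using c i unfolding U_def by simp
  define x where "x = snd c (\<gamma> t)"
  have x: "x \<in> chart_img c (triv_dom L i)" unfolding x_def by (rule chart_img_I[OF c(2) i])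
  define S where "S = (\<lambda>z. s z i) \<circ> chart_inv c"
  define v where "v = ham (\<gamma> t) c"
  have dy: "((\<lambda>r. snd c (\<gamma> r)) has_derivative (\<lambda>h. h *\<^sub>R (\<i> *s v))) (at t)"
    using \<gamma> c unfolding integral_curve_def gradient_field_eq cplx_J_def v_def has_vector_derivative_def by blast
  have dS: "(S has_derivative fd S x) (at x)"
    unfolding S_def x_def using Lk.section_has_derivative[OF s c] i by simp
  have dl: "(logw i c has_derivative fd (logw i c) x) (at x)" by (rule logw_has_derivative[OF c(1) x])
  define F where "F y = exp (real k * logw i c y) * ((Re (S y))\<^sup>2 + (Im (S y))\<^sup>2)" for y
  define D where "D h = exp (real k * logw i c x) * (real k * fd (logw i c) x h) * ((Re (S x))\<^sup>2 + (Im (S x))\<^sup>2)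
      + exp (real k * logw i c x) * (2 * Re (S x) * Re (fd S x h) + 2 * Im (S x) * Im (fd S x h))" for h
  have dF: "(F has_derivative D) (at x)"
    unfolding F_def D_def by (auto intro!: derivative_eq_intros dS dl simp: algebra_simps)
  have Fh: "F (snd c (\<gamma> r)) = Re (herm Lk (\<gamma> r) (s (\<gamma> r)) (s (\<gamma> r)))" if "r \<in> U" for r
  proof -
    have r: "\<gamma> r \<in> fst c" "\<gamma> r \<in> triv_dom L i" using that unfolding U_def by auto
    have "exp (real k * ln (weight L i (\<gamma> r))) = weight L i (\<gamma> r) ^ k"
      using weight_pos[OF r(2)] by (simp add: exp_of_nat_mult)
    then show ?thesis
      using Lk.herm_self[OF Lk.holo_sections_fibre[OF s], of "\<gamma> r" i] r
      by (simp add: F_def S_def logw_def chart_inv_snd[OF c(1)] weight_Lk cmod_power2)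
  qed
  have dF': "(F has_derivative D) (at (snd c (\<gamma> t)))" using dF unfolding x_def .
  have "((\<lambda>r. F (snd c (\<gamma> r))) has_derivative (\<lambda>h. D (h *\<^sub>R (\<i> *s v)))) (at t)"
    using has_derivative_compose[OF dy dF'] .
  then have "((\<lambda>r. Re (herm Lk (\<gamma> r) (s (\<gamma> r)) (s (\<gamma> r)))) has_derivative (\<lambda>h. D (h *\<^sub>R (\<i> *s v)))) (at t)"
    by (rule has_derivative_transform_within_open[OF _ U tU Fh])
  moreover have "D (h *\<^sub>R (\<i> *s v)) = D (\<i> *s v) * h" for h
    using linear_scale[OF has_derivative_linear[OF dF]] by simp
  ultimately have "((\<lambda>r. Re (herm Lk (\<gamma> r) (s (\<gamma> r)) (s (\<gamma> r)))) has_real_derivative D (\<i> *s v)) (at t)"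
    unfolding has_field_derivative_def by simp
  \<comment> \<open>The derivative of the weight along \<open>\<i> *s v\<close> cancels against
    twice the real part of the connection term in \<open>fd S x (\<i> *s v)\<close>; the imaginary
    part of that term does not affect the square of the modulus.\<close>
  moreover have "D (\<i> *s v) = (2 * real k * (\<mu> - H (\<gamma> t))) * F x"
  proof -
    have Sx: "S x = s (\<gamma> t) i" unfolding S_def x_def using c by (simp add: chart_inv_snd)
    have "fd S x (\<i> *s v) = \<i> * fd S x v"
      unfolding S_def x_def using Lk.section_fd_smult[OF s c] i by simp
    also have "fd S x v = - of_nat k * (dlogw i c x v + \<i> * (of_real \<mu> - of_real (H (\<gamma> t)))) * S x"
      unfolding Sx using eigensection_fd[OF e c i] unfolding S_def x_def v_def .
    finally have d: "fd S x (\<i> *s v) = \<i> * (- of_nat k * (dlogw i c x v + \<i> * (of_real \<mu> - of_real (H (\<gamma> t)))) * S x)" .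
    show ?thesis unfolding D_def F_def d dlogw_def
      by (simp add: field_simps power2_eq_square)
  qed
  ultimately show ?thesis using Fh[OF tU] unfolding x_def by simp
qed

text \<open>With \<open>\<epsilon> = -1\<close> the gradient line is run backwards.\<close>

lemma eigensection_zero_on_gradient_line:
  assumes e: "eigensection A L k H s (of_real \<mu>)" and \<gamma>: "integral_curve A (gradient_field A L H) \<gamma>"
    and lim: "((\<lambda>t. \<gamma> (\<epsilon> * t)) \<longlongrightarrow> zc) at_top" and sign: "\<epsilon> * (\<mu> - H zc) > 0"
  shows "s (\<gamma> 0) = (\<lambda>i. 0)"
proof -
  have s: "s \<in> holo_sections A Lk" using e unfolding eigensection_def by blast
  define n where "n z = Re (herm Lk z (s z) (s z))" for z
  have n0: "n z \<ge> 0" and nz: "n z = 0 \<Longrightarrow> s z = (\<lambda>i. 0)" for z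
  proof -
    obtain i where i: "z \<in> triv_dom Lk i" using Lk.ex_triv by blast
    have "n z = weight Lk i z * (cmod (s z i))\<^sup>2"
      unfolding n_def Lk.herm_self[OF Lk.holo_sections_fibre[OF s] i] by simp
    then show "n z \<ge> 0" "n z = 0 \<Longrightarrow> s z = (\<lambda>i. 0)"
      using Lk.weight_pos[OF i] Lk.fibre_eq_zero_iff[OF Lk.holo_sections_fibre[OF s] i] by auto
  qed
  have cn: "isCont n z" for z
    using Lk.continuous_on_herm[OF Lk.holo_sections_cont_section[OF s] Lk.holo_sections_cont_section[OF s]]
    unfolding n_def by (intro continuous_Re) (simp add: continuous_on_eq_continuous_at)
  have cH: "continuous_on UNIV H" by (rule C1_fun_continuous_on[OF smooth_fun_C1_fun[OF H_smooth]]) simp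
  then have cH': "isCont H zc" by (simp add: continuous_on_eq_continuous_at)
  have cg: "continuous_on UNIV \<gamma>" using \<gamma> unfolding integral_curve_def by blast
  define a where "a t = 2 * real k * (\<epsilon> * (\<mu> - H (\<gamma> (\<epsilon> * t))))" for t
  have "n (\<gamma> (\<epsilon> * 0)) = 0"
  \<comment> \<open>The rate \<open>\<delta>\<close> is half of the limit of \<open>a\<close>, so
    that \<open>a\<close> eventually exceeds it.\<close>
  proof (rule exponential_growth_zero[where f="\<lambda>t. n (\<gamma> (\<epsilon> * t))" and a=a and \<delta>="real k * (\<epsilon> * (\<mu> - H zc))"])
    show "((\<lambda>t. n (\<gamma> (\<epsilon> * t))) has_real_derivative a t * n (\<gamma> (\<epsilon> * t))) (at t)" for t
    proof -
      have "((\<lambda>t. n (\<gamma> t)) has_real_derivative 2 * real k * (\<mu> - H (\<gamma> (\<epsilon> * t))) * n (\<gamma> (\<epsilon> * t))) (at (\<epsilon> * t))"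
        unfolding n_def by (rule norm_derivative_gradient[OF e \<gamma>])
      moreover have "((\<lambda>t. \<epsilon> * t) has_real_derivative \<epsilon>) (at t)" by (auto intro!: derivative_eq_intros)
      ultimately show ?thesis using DERIV_chain2 unfolding a_def by (fastforce simp: mult_ac)
    qed
    show "continuous_on UNIV a" unfolding a_def
      by (intro continuous_intros continuous_on_compose2[OF cH] continuous_on_compose2[OF cg]) auto
    have "(a \<longlongrightarrow> 2 * real k * (\<epsilon> * (\<mu> - H zc))) at_top"
      unfolding a_def by (intro tendsto_intros isCont_tendsto_compose[OF cH' lim])
    moreover have "real k * (\<epsilon> * (\<mu> - H zc)) < 2 * real k * (\<epsilon> * (\<mu> - H zc))" using sign k by simp
    ultimately have "\<forall>\<^sub>F t in at_top. real k * (\<epsilon> * (\<mu> - H zc)) < a t" by (rule order_tendstoD)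
    then show "\<forall>\<^sub>F t in at_top. real k * (\<epsilon> * (\<mu> - H zc)) \<le> a t" by (rule eventually_mono) simp
    show "((\<lambda>t. n (\<gamma> (\<epsilon> * t))) \<longlongrightarrow> n zc) at_top" by (rule isCont_tendsto_compose[OF cn lim])
  qed (use n0 sign k in auto)
  then show ?thesis using nz by simp
qed

lemma
  assumes e: "eigensection A L k H s (of_real \<mu>)"
  shows vanishes_on_W_minus: "\<mu> > H zc \<Longrightarrow> vanishes_on s (W_minus A L H zc)"
    and vanishes_on_W_plus: "\<mu> < H zc \<Longrightarrow> vanishes_on s (W_plus A L H zc)"
  using eigensection_zero_on_gradient_line[OF e, of _ 1 zc] eigensection_zero_on_gradient_line[OF e, of _ "-1" zc]
  unfolding vanishes_on_def W_minus_def W_plus_def limit_set_minus_def limit_set_plus_def by auto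

end

section \<open>The Hamiltonian field is holomorphic\<close>

lemma onorm_scaleR_le: "norm v \<le> e \<Longrightarrow> onorm (\<lambda>h::real. h *\<^sub>R v) \<le> e"
  by (rule onorm_le) (simp add: mult.commute[of e] mult_left_mono)

text \<open>Perturbation of a linear system: at \<open>x0\<close> its matrix is bounded below by
  some \<open>B > 0\<close>, the matrices converge in operator norm, and so near \<open>x0\<close>
  they stay bounded below by \<open>B / 2\<close>. The error of the solution is then controlled by a
  residual.\<close>

lemma solution_continuous:
  fixes om :: "'e::t2_space \<Rightarrow> 'f::euclidean_space \<Rightarrow> 'f \<Rightarrow> real"
  assumes S: "open S" "x0 \<in> S"
    and lin: "\<And>x w. x \<in> S \<Longrightarrow> linear (\<lambda>v. om x v w)" and lin2: "\<And>v. linear (om x0 v)"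
    and om: "\<And>v w. isCont (\<lambda>x. om x v w) x0" and l: "\<And>w. isCont (\<lambda>x. l x w) x0"
    and eq: "\<And>x w. x \<in> S \<Longrightarrow> om x (\<xi> x) w = l x w"
    and nondeg: "\<And>v. (\<And>w. om x0 v w = 0) \<Longrightarrow> v = 0"
  shows "isCont \<xi> x0"
proof -
  define M where "M x v = (\<Sum>b\<in>Basis. om x v b *\<^sub>R b)" for x v
  have linM: "linear (M x)" if "x \<in> S" for x
    unfolding M_def
    by (rule linearI) (auto simp: linear_add[OF lin[OF that]] linear_scale[OF lin[OF that]] scaleR_left_distrib sum.distrib scaleR_sum_right)
  have Mb: "M x0 v \<bullet> w = om x0 v w" for v w
    unfolding M_def by (rule linear_eq_inner_Basis[OF lin2])
  have "inj (M x0)"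
    unfolding linear_injective_0[OF linM[OF S(2)]] using nondeg Mb by (metis inner_zero_left)
  then obtain B where B: "B > 0" "\<And>v. B * norm v \<le> norm (M x0 v)"
    using linear_inj_bounded_below_pos[OF linM[OF S(2)]] by blast
  define \<epsilon> where "\<epsilon> x = (\<Sum>b\<in>Basis. norm (M x b - M x0 b))" for x
  have cM: "((\<lambda>x. M x v) \<longlongrightarrow> M x0 v) (at x0)" for v
    unfolding M_def using om by (intro tendsto_intros) (simp add: isCont_def)
  have "(\<epsilon> \<longlongrightarrow> (\<Sum>b\<in>Basis. norm (M x0 b - M x0 b))) (at x0)"
    unfolding \<epsilon>_def by (intro tendsto_intros cM)
  then have \<epsilon>0: "(\<epsilon> \<longlongrightarrow> 0) (at x0)" by simp
  have diff: "norm (M x v - M x0 v) \<le> \<epsilon> x * norm v" if x: "x \<in> S" for x v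
  proof -
    have "M x v - M x0 v = (\<Sum>b\<in>Basis. (v \<bullet> b) *\<^sub>R (M x b - M x0 b))"
      unfolding linear_Basis_expand[OF linM[OF x], of v] linear_Basis_expand[OF linM[OF S(2)], of v]
      by (simp add: sum_subtractf scaleR_diff_right)
    also have "norm \<dots> \<le> (\<Sum>b\<in>Basis. norm (M x b - M x0 b) * norm v)"
    proof (rule sum_norm_le)
      fix b :: 'f assume "b \<in> Basis"
      then have "\<bar>v \<bullet> b\<bar> \<le> norm v" by (rule Basis_le_norm)
      then show "norm ((v \<bullet> b) *\<^sub>R (M x b - M x0 b)) \<le> norm (M x b - M x0 b) * norm v"
        by (simp add: mult.commute mult_right_mono)
    qed
    finally show ?thesis unfolding \<epsilon>_def by (simp add: sum_distrib_right)
  qed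
  \<comment> \<open>The residual left when the solution at \<open>x0\<close> is inserted into the
    system at \<open>x\<close>.\<close>
  define r where "r x = (\<Sum>b\<in>Basis. l x b *\<^sub>R b) - M x (\<xi> x0)" for x
  have Mxi: "M x (\<xi> x) = (\<Sum>b\<in>Basis. l x b *\<^sub>R b)" if "x \<in> S" for x
    unfolding M_def using eq[OF that] by simp
  have "(r \<longlongrightarrow> (\<Sum>b\<in>Basis. l x0 b *\<^sub>R b) - M x0 (\<xi> x0)) (at x0)"
    unfolding r_def using l by (intro tendsto_intros cM) (simp add: isCont_def)
  then have r0: "(r \<longlongrightarrow> 0) (at x0)" using Mxi[OF S(2)] by simp
  have "\<forall>\<^sub>F x in at x0. \<epsilon> x < B / 2" using \<epsilon>0 B(1) by (intro order_tendstoD(2)[OF \<epsilon>0]) simp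
  moreover have "\<forall>\<^sub>F x in at x0. x \<in> S" using S by (simp add: eventually_at_in_open')
  ultimately have "\<forall>\<^sub>F x in at x0. norm (\<xi> x - \<xi> x0) \<le> 2 / B * norm (r x)"
  proof eventually_elim
    case (elim x)
    define \<delta> where "\<delta> = \<xi> x - \<xi> x0"
    have Md: "M x \<delta> = r x" unfolding \<delta>_def r_def using Mxi[OF elim(2)] by (simp add: linear_diff[OF linM[OF elim(2)]])
    have "B * norm \<delta> \<le> norm (M x0 \<delta>)" by (rule B(2))
    also have "\<dots> \<le> norm (M x \<delta>) + norm (M x \<delta> - M x0 \<delta>)" by (metis norm_minus_commute norm_triangle_sub add.commute)
    also have "\<dots> \<le> norm (r x) + \<epsilon> x * norm \<delta>" using diff[OF elim(2), of \<delta>] unfolding Md by simp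
    also have "\<dots> \<le> norm (r x) + B / 2 * norm \<delta>" using elim(1) by (intro add_left_mono mult_right_mono) auto
    finally have "B / 2 * norm \<delta> \<le> norm (r x)" by simp
    then show ?case unfolding \<delta>_def[symmetric] using B(1) by (simp add: field_simps)
  qed
  moreover have "((\<lambda>x. 2 / B * norm (r x)) \<longlongrightarrow> 0) (at x0)"
    using tendsto_mult[OF tendsto_const tendsto_norm[OF r0], of "2 / B"] by simp
  ultimately have "((\<lambda>x. \<xi> x - \<xi> x0) \<longlongrightarrow> 0) (at x0)"
    by (rule Lim_null_comparison)
  then show ?thesis unfolding isCont_def by (simp add: LIM_zero_iff)
qed

context hamiltonian_system
begin

text \<open>In a fixed frame Hamilton's equation is a nondegenerate linear system for the field,
  with coefficients built from derivatives of smooth functions.\<close>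

lemma continuous_on_xi:
  assumes c: "c \<in> A" shows "continuous_on (snd c ` fst c) (xi c)"
proof (rule continuous_at_imp_continuous_on, rule ballI)
  fix x0 assume x0: "x0 \<in> snd c ` fst c"
  obtain i where i: "chart_inv c x0 \<in> triv_dom L i" using ex_triv by blast
  define S where "S = chart_img c (triv_dom L i)"
  have S: "open S" "x0 \<in> S" unfolding S_def using open_chart_img[OF c open_triv] x0 i by (simp_all add: mem_chart_img[OF c])
  have u: "smooth_on (logw i c) S" unfolding S_def by (rule smooth_on_logw[OF c])
  have sH: "smooth_on (H \<circ> chart_inv c) S"
    by (rule smooth_on_subset[OF smooth_on_H[OF c]]) (auto simp: S_def mem_chart_img[OF c])
  have sf: "symplectic_form (levi (logw i c) x)" if "x \<in> S" for x
    using symplectic_form_logw[OF c] that unfolding S_def by blast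
  have cont: "isCont g x0" if "smooth_on g S" for g :: "complex^'m \<Rightarrow> real"
    using smooth_on_differentiable[OF that S(2)] differentiable_imp_continuous_within by blast
  show "isCont (xi c) x0"
  proof (rule solution_continuous[OF S, where om="levi (logw i c)" and l="fd (H \<circ> chart_inv c)"])
    show "linear (\<lambda>v. levi (logw i c) x v w)" if "x \<in> S" for x w by (rule symplectic_form.lin1[OF sf[OF that]])
    show "linear (levi (logw i c) x0 v)" for v by (rule symplectic_form.lin2[OF sf[OF S(2)]])
    show "isCont (\<lambda>x. levi (logw i c) x v w) x0" for v w
      unfolding levi_def by (intro continuous_intros cont smooth_on_hess u) simp
    show "isCont (\<lambda>x. fd (H \<circ> chart_inv c) x w) x0" for w by (intro cont smooth_on_fd sH)
    show "levi (logw i c) x (xi c x) w = fd (H \<circ> chart_inv c) x w" if "x \<in> S" for x w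
      using xi_eq[OF c] that unfolding S_def by simp
    show "v = 0" if "\<And>w. levi (logw i c) x0 v w = 0" for v
      using levi_logw_pos[OF c, of x0 i v] S(2) that unfolding S_def by fastforce
  qed
qed

text \<open>Continuity argument: before a first exit from \<open>O'\<close> the speed is at most
  \<open>M\<close>, so the curve lies in the image of a closed ball of radius
  \<open>M * \<tau>\<close>. This image is closed, and contained in the open \<open>O'\<close>, so
  the exit point would still belong to \<open>O'\<close>.\<close>

lemma flow_stays:
  assumes c: "c \<in> A" and sub: "cball x0 (2*R) \<subseteq> snd c ` fst c" and M: "\<And>y. y \<in> cball x0 (2*R) \<Longrightarrow> norm (xi c y) \<le> M"
    and x: "x \<in> ball x0 R" and \<gamma>: "integral_curve A ham \<gamma>" "\<gamma> 0 = chart_inv c x"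
    and \<tau>: "M * \<tau> < R" and M0: "M > 0" and t: "0 \<le> t" "t \<le> \<tau>"
  shows "\<gamma> t \<in> fst c" "snd c (\<gamma> t) \<in> cball x (M * t)"
proof -
  have cg: "continuous_on UNIV \<gamma>" using \<gamma> unfolding integral_curve_def by blast
  define O' where "O' = {p \<in> fst c. snd c p \<in> ball x0 (2*R)}"
  have O': "open O'" unfolding O'_def by (rule open_chart_preimage[OF c open_ball])
  define C where "C = chart_inv c ` cball x (M * \<tau>)"
  have sub1: "cball x (M * \<tau>) \<subseteq> ball x0 (2*R)"
  proof
    fix y assume "y \<in> cball x (M * \<tau>)"
    then show "y \<in> ball x0 (2*R)" using x \<tau> dist_triangle[of x0 y x] by simp
  qed
  have sub2: "cball x (M * \<tau>) \<subseteq> snd c ` fst c" using sub1 sub by (meson ball_subset_cball order_trans)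
  have "compact C" unfolding C_def
    by (intro compact_continuous_image continuous_on_subset[OF continuous_on_chart_inv[OF c] sub2] compact_cball)
  then have C: "closed C" by (rule compact_imp_closed)
  have CO: "C \<subseteq> O'" unfolding C_def O'_def using sub1 sub2 c by (auto simp: chart_inv_mem snd_chart_inv subset_iff)
  have xin: "x \<in> snd c ` fst c"
  proof -
    have "x \<in> cball x0 (2*R)" using x zero_le_dist[of x0 x] by (simp del: zero_le_dist)
    then show ?thesis using sub by blast
  qed
  have y0: "snd c (\<gamma> 0) = x" using \<gamma>(2) snd_chart_inv[OF c xin] by simp
  have bound: "snd c (\<gamma> s) \<in> cball x (M * s)" if "0 \<le> s" "\<And>r. 0 \<le> r \<Longrightarrow> r \<le> s \<Longrightarrow> \<gamma> r \<in> O'" for s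
  proof -
    have d: "((\<lambda>r. snd c (\<gamma> r)) has_derivative (\<lambda>h. h *\<^sub>R ham (\<gamma> r) c)) (at r within {0..s})"
      and b: "norm (ham (\<gamma> r) c) \<le> M" if r: "r \<in> {0..s}" for r
    proof -
      have g: "\<gamma> r \<in> O'" using \<open>\<And>r. 0 \<le> r \<Longrightarrow> r \<le> s \<Longrightarrow> \<gamma> r \<in> O'\<close> r by auto
      then show "((\<lambda>r. snd c (\<gamma> r)) has_derivative (\<lambda>h. h *\<^sub>R ham (\<gamma> r) c)) (at r within {0..s})"
        using \<gamma>(1) c unfolding integral_curve_def O'_def has_vector_derivative_def by (blast intro: has_derivative_at_withinI)
      have "ham (\<gamma> r) c = xi c (snd c (\<gamma> r))" using g c unfolding xi_def O'_def by (simp add: chart_inv_snd)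
      then show "norm (ham (\<gamma> r) c) \<le> M" using M g unfolding O'_def by auto
    qed
    have "norm (snd c (\<gamma> s) - snd c (\<gamma> 0)) \<le> M * norm (s - 0)"
      by (rule differentiable_bound[OF convex_real_interval(5) d])
         (use that(1) b in \<open>auto intro!: onorm_scaleR_le\<close>)
    then show ?thesis using y0 that(1) by (simp add: dist_norm norm_minus_commute)
  qed
  have stay: "\<gamma> r \<in> O'" if r: "0 \<le> r" "r \<le> \<tau>" for r
  proof (rule ccontr)
    assume "\<gamma> r \<notin> O'"
    \<comment> \<open>The exit times form a compact set, so there is a first one.\<close>
    define bad where "bad = {0..\<tau>} \<inter> \<gamma> -` (- O')"
    have "closed (\<gamma> -` (- O'))" using cg O' by (intro closed_vimage) auto
    then have "compact bad" unfolding bad_def by (intro compact_Int_closed) auto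
    moreover have "bad \<noteq> {}" using \<open>\<gamma> r \<notin> O'\<close> r unfolding bad_def by auto
    ultimately obtain s where s: "s \<in> bad" "\<And>r. r \<in> bad \<Longrightarrow> s \<le> r" using compact_attains_inf by metis
    have s0: "0 \<le> s" "s \<le> \<tau>" "\<gamma> s \<notin> O'" using s unfolding bad_def by auto
    have before: "\<gamma> r \<in> O'" if "0 \<le> r" "r < s" for r using s(2)[of r] that s0 unfolding bad_def by force
    have inC: "\<gamma> r \<in> C" if "0 \<le> r" "r < s" for r
    proof -
      have "snd c (\<gamma> r) \<in> cball x (M * r)" using that before by (intro bound) auto
      moreover have "M * r \<le> M * \<tau>" using that s0 M0 by simp
      ultimately have "snd c (\<gamma> r) \<in> cball x (M * \<tau>)" by simp
      moreover have "\<gamma> r \<in> fst c" using before[OF that] unfolding O'_def by simp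
      ultimately show ?thesis unfolding C_def using chart_inv_snd[OF c] by (metis image_eqI)
    qed
    have "\<gamma> s \<in> O'"
    proof (cases "s = 0")
      case True
      have "x \<in> ball x0 (2*R)" using x zero_le_dist[of x0 x] by (simp del: zero_le_dist)
      then show ?thesis using True \<gamma>(2) y0 chart_inv_mem[OF c xin] unfolding O'_def by simp
    next
      case False
      have "closed (\<gamma> -` C)" using cg C by (intro closed_vimage) auto
      moreover have "{0..<s} \<subseteq> \<gamma> -` C" using inC by auto
      ultimately have "closure {0..<s} \<subseteq> \<gamma> -` C" by (rule closure_minimal[rotated])
      then show ?thesis using CO s0 False by (auto simp: closure_atLeastLessThan)
    qed
    then show False using s0 by blast
  qed
  show "\<gamma> t \<in> fst c" using stay[OF t] unfolding O'_def by simp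
  show "snd c (\<gamma> t) \<in> cball x (M * t)" using t stay by (intro bound) auto
qed

text \<open>Mean value inequality for the curve minus uniform motion with velocity
  \<open>v\<close>.\<close>

lemma flow_difference:
  assumes c: "c \<in> A" and \<gamma>: "integral_curve A ham \<gamma>" and t: "0 \<le> t"
    and st: "\<And>s. 0 \<le> s \<Longrightarrow> s \<le> t \<Longrightarrow> \<gamma> s \<in> fst c \<and> norm (xi c (snd c (\<gamma> s)) - v) \<le> e"
  shows "norm (snd c (\<gamma> t) - snd c (\<gamma> 0) - t *\<^sub>R v) \<le> e * t"
proof -
  have d: "((\<lambda>r. snd c (\<gamma> r) - r *\<^sub>R v) has_derivative (\<lambda>h. h *\<^sub>R (xi c (snd c (\<gamma> s)) - v))) (at s within {0..t})"
    if s: "s \<in> {0..t}" for s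
  proof -
    have g: "\<gamma> s \<in> fst c" using st s by auto
    have x: "xi c (snd c (\<gamma> s)) = ham (\<gamma> s) c" unfolding xi_def using g c by (simp add: chart_inv_snd)
    have "((\<lambda>r. snd c (\<gamma> r)) has_derivative (\<lambda>h. h *\<^sub>R ham (\<gamma> s) c)) (at s within {0..t})"
      using \<gamma> c g unfolding integral_curve_def has_vector_derivative_def by (blast intro: has_derivative_at_withinI)
    then have "((\<lambda>r. snd c (\<gamma> r) - r *\<^sub>R v) has_derivative (\<lambda>h. h *\<^sub>R ham (\<gamma> s) c - h *\<^sub>R v)) (at s within {0..t})"
      by (auto intro!: derivative_eq_intros)
    then show ?thesis unfolding x by (simp add: scaleR_diff_right)
  qed
  have "norm ((snd c (\<gamma> t) - t *\<^sub>R v) - (snd c (\<gamma> 0) - 0 *\<^sub>R v)) \<le> e * norm (t - 0)"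
  proof (rule differentiable_bound[OF convex_real_interval(5) d])
    show "onorm (\<lambda>h. h *\<^sub>R (xi c (snd c (\<gamma> s)) - v)) \<le> e" if "s \<in> {0..t}" for s
      using st[of s] that by (intro onorm_scaleR_le) simp
  qed (use t in auto)
  then show ?thesis using t by (simp add: algebra_simps)
qed

text \<open>The difference quotients of the flow are holomorphic and converge uniformly to \<open>\<xi>\<close>.\<close>

lemma vholo_on_xi:
  assumes act: "generates_holo_action A L H" and c: "c \<in> A"
  shows "vholo_on (xi c) (snd c ` fst c)"
  unfolding vholo_on_def
proof (intro allI holo_on_local)
  fix j x0 assume x0: "x0 \<in> snd c ` fst c"
  obtain \<Phi> where \<Phi>: "is_flow A ham \<Phi>" "\<And>t. holo_map A (\<Phi> t)"
    using act unfolding generates_holo_action_def by blast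
  have curve: "integral_curve A ham (\<lambda>t. \<Phi> t p)" and \<Phi>0: "\<Phi> 0 p = p" for p
    using \<Phi>(1) unfolding is_flow_def by auto
  obtain R' where R': "R' > 0" "cball x0 R' \<subseteq> snd c ` fst c"
    using open_img[OF c] x0 open_contains_cball by blast
  define R where "R = R' / 2"
  have R: "R > 0" and sub: "cball x0 (2*R) \<subseteq> snd c ` fst c" using R' unfolding R_def by auto
  have cxi: "continuous_on (cball x0 (2*R)) (xi c)" by (rule continuous_on_subset[OF continuous_on_xi[OF c] sub])
  have "bounded (xi c ` cball x0 (2*R))"
    by (intro compact_imp_bounded compact_continuous_image cxi compact_cball)
  then obtain M0 where M0: "\<And>y. y \<in> cball x0 (2*R) \<Longrightarrow> norm (xi c y) \<le> M0" unfolding bounded_iff by blast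
  define M where "M = \<bar>M0\<bar> + 1"
  have M: "M > 0" "\<And>y. y \<in> cball x0 (2*R) \<Longrightarrow> norm (xi c y) \<le> M" unfolding M_def using M0 by fastforce+
  \<comment> \<open>Bounded by \<open>R / (2 * M)\<close>, so a curve starting in
    \<open>ball x0 R\<close> cannot leave \<open>cball x0 (2*R)\<close> within time
    \<open>h n\<close>.\<close>
  define h where "h n = (R / (2 * M)) * inverse (real (Suc n))" for n
  have h0: "h n > 0" for n unfolding h_def using R M by simp
  have Mh: "M * h n < R" for n
  proof -
    have "M * h n = R / 2 * inverse (real (Suc n))" unfolding h_def using M by (simp del: of_nat_Suc)
    also have "\<dots> \<le> R / 2 * 1" using R by (intro mult_left_mono) (auto simp: field_simps)
    also have "\<dots> < R" using R by simp
    finally show ?thesis .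
  qed
  have "h \<longlonglongrightarrow> (R / (2 * M)) * 0" unfolding h_def by (intro tendsto_intros LIMSEQ_inverse_real_of_nat)
  then have hlim: "h \<longlonglongrightarrow> 0" by simp
  have stay: "\<Phi> s (chart_inv c x) \<in> fst c" "snd c (\<Phi> s (chart_inv c x)) \<in> cball x (M * s)"
    if "x \<in> ball x0 R" "0 \<le> s" "s \<le> h n" for x s n
    using flow_stays[OF c sub M(2) that(1) curve _ Mh M(1) that(2,3)] \<Phi>0 by auto
  define f where "f n x = (snd c (\<Phi> (h n) (chart_inv c x)) $ j - x $ j) * of_real (inverse (h n))" for n x
  have hf: "holo_on (f n) (ball x0 R)" for n
  proof -
    have "holo_fun A (\<Phi> (h n) -` fst c) (\<lambda>p. snd c (\<Phi> (h n) p) $ j)"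
      using \<Phi>(2) c unfolding holo_map_def by blast
    then have "holo_on ((\<lambda>p. snd c (\<Phi> (h n) p) $ j) \<circ> chart_inv c) (chart_img c (\<Phi> (h n) -` fst c))"
      using c unfolding holo_fun_def by blast
    then have 1: "holo_on ((\<lambda>p. snd c (\<Phi> (h n) p) $ j) \<circ> chart_inv c) (ball x0 R)"
    proof (rule holo_on_subset)
      show "ball x0 R \<subseteq> chart_img c (\<Phi> (h n) -` fst c)"
      proof
        fix x assume x: "x \<in> ball x0 R"
        then have "x \<in> snd c ` fst c" using sub R by (auto simp: subset_iff)
        then show "x \<in> chart_img c (\<Phi> (h n) -` fst c)"
          using stay(1)[OF x, of "h n" n] h0[of n] by (simp add: mem_chart_img[OF c])
      qed
    qed
    have 2: "holo_on (\<lambda>x::complex^'m. x $ j) (ball x0 R)"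
      by (rule holo_onI[of _ _ "\<lambda>x h. h $ j"])
         (auto intro: bounded_linear.has_derivative[OF bounded_linear_vec_nth has_derivative_ident])
    show ?thesis unfolding f_def
      using holo_on_mult[OF holo_on_diff[OF 1 2] holo_on_const] by (simp add: comp_def)
  qed
  have "uniform_limit (ball x0 R) f (\<lambda>x. xi c x $ j) sequentially"
  proof (rule uniform_limitI)
    fix e :: real assume e: "e > 0"
    have "uniformly_continuous_on (cball x0 (2*R)) (xi c)" by (rule compact_uniformly_continuous[OF cxi compact_cball])
    then obtain \<delta> where \<delta>: "\<delta> > 0" "\<And>x y. x \<in> cball x0 (2*R) \<Longrightarrow> y \<in> cball x0 (2*R) \<Longrightarrow> dist y x < \<delta> \<Longrightarrow> dist (xi c y) (xi c x) < e/2"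
      unfolding uniformly_continuous_on_def using e half_gt_zero by metis
    have "(\<lambda>n. M * h n) \<longlonglongrightarrow> M * 0" by (intro tendsto_intros hlim)
    \<comment> \<open>Within time \<open>h n\<close> every curve moves by at most
      \<open>M * h n\<close>. Once this is below \<open>\<delta>\<close>, uniform continuity keeps
      the field along the curve within \<open>e/2\<close> of its initial value, simultaneously for
      all starting points.\<close>
    then have "\<forall>\<^sub>F n in sequentially. M * h n < \<delta>" using \<delta>(1) by (intro order_tendstoD(2)) auto
    then show "\<forall>\<^sub>F n in sequentially. \<forall>x\<in>ball x0 R. dist (f n x) (xi c x $ j) < e"
    proof (rule eventually_mono, intro ballI)
      fix n x assume n: "M * h n < \<delta>" and x: "x \<in> ball x0 R"
      have x2: "x \<in> cball x0 (2*R)" using x R by simp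
      then have xin: "x \<in> snd c ` fst c" using sub by blast
      have "norm (snd c (\<Phi> (h n) (chart_inv c x)) - snd c (\<Phi> 0 (chart_inv c x)) - h n *\<^sub>R xi c x) \<le> e/2 * h n"
      proof (rule flow_difference[OF c curve])
        fix s assume s: "0 \<le> s" "s \<le> h n"
        note st = stay[OF x s]
        have "M * s \<le> M * h n" using s M by simp
        then have ds: "dist x (snd c (\<Phi> s (chart_inv c x))) \<le> M * h n" using st(2) by simp
        then have m: "snd c (\<Phi> s (chart_inv c x)) \<in> cball x0 (2*R)"
          using x Mh[of n] dist_triangle[of x0 "snd c (\<Phi> s (chart_inv c x))" x] by simp
        have "dist (snd c (\<Phi> s (chart_inv c x))) x < \<delta>" using ds n by (simp add: dist_commute)
        then have "dist (xi c (snd c (\<Phi> s (chart_inv c x)))) (xi c x) < e/2"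
          using \<delta>(2)[OF x2 m] by simp
        then show "\<Phi> s (chart_inv c x) \<in> fst c \<and> norm (xi c (snd c (\<Phi> s (chart_inv c x))) - xi c x) \<le> e/2"
          using st(1) by (simp add: dist_norm)
      qed (use h0[of n] in simp)
      then have b: "norm (snd c (\<Phi> (h n) (chart_inv c x)) - x - h n *\<^sub>R xi c x) \<le> e/2 * h n"
        using \<Phi>0 snd_chart_inv[OF c xin] by simp
      define w where "w = snd c (\<Phi> (h n) (chart_inv c x)) - x - h n *\<^sub>R xi c x"
      have "f n x - xi c x $ j = w $ j * of_real (inverse (h n))"
        unfolding f_def w_def vector_minus_component vector_scaleR_component
        using h0[of n] by (simp add: scaleR_conv_of_real[where 'a=complex] field_simps)
      then have "norm (f n x - xi c x $ j) = norm (w $ j) * inverse (h n)"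
        using h0[of n] by (simp only: norm_mult norm_of_real) simp
      also have "\<dots> \<le> norm w * inverse (h n)" using h0[of n] Finite_Cartesian_Product.norm_nth_le[of w j] by (intro mult_right_mono) auto
      also have "\<dots> \<le> (e/2 * h n) * inverse (h n)" using b h0[of n] unfolding w_def by (intro mult_right_mono) auto
      also have "\<dots> < e" using e h0[of n] by simp
      finally show "dist (f n x) (xi c x $ j) < e" by (simp add: dist_norm)
    qed
  qed
  from holo_on_uniform_limit[OF hf R this]
  show "\<exists>U. x0 \<in> U \<and> holo_on (\<lambda>x. xi c x $ j) U" using R by (intro exI[of _ "ball x0 (R/2)"]) auto
qed

end

section \<open>The quantum Hamiltonian preserves holomorphic sections\<close>

context hermitian_bundle
begin

text \<open>The log weights differ by \<open>log |g|^2\<close> with \<open>g\<close> the transition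
  function, and the (1,0)-part of its differential is \<open>dg / g\<close>.\<close>

lemma dlogw_trans:
  assumes c: "c \<in> A" and x: "x \<in> chart_img c (triv_dom B i \<inter> triv_dom B j)"
  shows "dlogw j c x v = dlogw i c x v + fd (trans B i j \<circ> chart_inv c) x v / (trans B i j \<circ> chart_inv c) x"
proof -
  define S where "S = chart_img c (triv_dom B i \<inter> triv_dom B j)"
  define g where "g = trans B i j \<circ> chart_inv c"
  have S: "open S" unfolding S_def by (intro open_chart_img[OF c] open_Int open_triv)
  have xS: "x \<in> S" using x unfolding S_def .
  have SD: "chart_inv c y \<in> triv_dom B i" "chart_inv c y \<in> triv_dom B j" if "y \<in> S" for y
    using that unfolding S_def by (simp_all add: mem_chart_img[OF c])
  have g: "holo_on g S" using trans_holo[of i j] c unfolding holo_fun_def g_def S_def by blast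
  have gnz: "g x \<noteq> 0" using trans_nonzero[OF SD[OF xS]] unfolding g_def by simp
  have xi: "x \<in> chart_img c (triv_dom B i)" "x \<in> chart_img c (triv_dom B j)"
    using x by (auto simp: mem_chart_img[OF c])
  have eq: "ln ((cmod (g y))\<^sup>2) = logw j c y - logw i c y" if "y \<in> S" for y
    unfolding logw_def g_def comp_def
    using weight_trans[OF SD[OF that]] weight_pos[OF SD(1)[OF that]] trans_nonzero[OF SD[OF that]]
    by (simp add: ln_mult)
  have "2 * Re (fd g x w / g x) = fd (logw j c) x w - fd (logw i c) x w" for w
  proof -
    have "2 * Re (fd g x w / g x) = fd (\<lambda>y. ln ((cmod (g y))\<^sup>2)) x w"
      by (rule fd_ln_norm_square[OF g xS gnz, symmetric])
    also have "fd (\<lambda>y. ln ((cmod (g y))\<^sup>2)) x = fd (\<lambda>y. logw j c y - logw i c y) x"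
      by (rule fd_cong[OF S xS eq])
    also have "\<dots> = (\<lambda>w. fd (logw j c) x w - fd (logw i c) x w)"
      by (intro fd_eqI derivative_intros logw_has_derivative[OF c] xi)
    finally show ?thesis .
  qed
  then have l: "fd (logw j c) x w = fd (logw i c) x w + 2 * Re (fd g x w / g x)" for w
    by (simp add: algebra_simps)
  define q where "q = fd g x v / g x"
  have q: "fd g x (\<i> *s v) / g x = \<i> * q"
    unfolding q_def by (simp add: holo_on_smult[OF g xS])
  show ?thesis unfolding g_def[symmetric] q_def[symmetric]
    unfolding dlogw_def l q q_def[symmetric] by (simp add: complex_eq_iff field_simps)
qed

text \<open>The inhomogeneous term \<open>dg / g\<close> of the connection form absorbs the
  derivative of the transition function; this is why the connection does not depend on the
  frame.\<close>

lemma covariant_derivative_trans: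
  assumes s: "s \<in> holo_sections A B" and c: "c \<in> A" and p: "p \<in> fst c" "p \<in> triv_dom B i" "p \<in> triv_dom B j"
  shows "fd ((\<lambda>z. s z i) \<circ> chart_inv c) (snd c p) v + dlogw i c (snd c p) v * s p i
    = trans B i j p * (fd ((\<lambda>z. s z j) \<circ> chart_inv c) (snd c p) v + dlogw j c (snd c p) v * s p j)"
proof -
  define S where "S = chart_img c (triv_dom B i \<inter> triv_dom B j)"
  define g where "g = trans B i j \<circ> chart_inv c"
  have S: "open S" unfolding S_def by (intro open_chart_img[OF c] open_Int open_triv)
  have x: "snd c p \<in> S" unfolding S_def using p by (intro chart_img_I) auto
  have g: "holo_on g S" using trans_holo[of i j] c unfolding holo_fun_def g_def S_def by blast
  have gp: "g (snd c p) = trans B i j p" unfolding g_def using c p by (simp add: chart_inv_snd)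
  have nz: "trans B i j p \<noteq> 0" using trans_nonzero p by blast
  have "fd ((\<lambda>z. s z i) \<circ> chart_inv c) (snd c p) = fd (\<lambda>y. g y * ((\<lambda>z. s z j) \<circ> chart_inv c) y) (snd c p)"
  proof (rule fd_cong[OF S x])
    fix y assume "y \<in> S"
    then have y: "chart_inv c y \<in> triv_dom B i" "chart_inv c y \<in> triv_dom B j"
      unfolding S_def by (simp_all add: mem_chart_img[OF c])
    show "((\<lambda>z. s z i) \<circ> chart_inv c) y = g y * ((\<lambda>z. s z j) \<circ> chart_inv c) y"
      unfolding g_def comp_def by (rule fibre_trans[OF holo_sections_fibre[OF s] y])
  qed
  also have "\<dots> = (\<lambda>v. g (snd c p) * fd ((\<lambda>z. s z j) \<circ> chart_inv c) (snd c p) v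
      + fd g (snd c p) v * ((\<lambda>z. s z j) \<circ> chart_inv c) (snd c p))"
    by (intro fd_eqI has_derivative_mult holo_on_has_derivative[OF g x] section_has_derivative[OF s c p(1,3)])
  finally have 1: "fd ((\<lambda>z. s z i) \<circ> chart_inv c) (snd c p) v =
      trans B i j p * fd ((\<lambda>z. s z j) \<circ> chart_inv c) (snd c p) v + fd g (snd c p) v * s p j"
    using gp c p by (simp add: chart_inv_snd)
  have 2: "dlogw j c (snd c p) v = dlogw i c (snd c p) v + fd g (snd c p) v / trans B i j p"
    using dlogw_trans[OF c x[unfolded S_def]] gp unfolding g_def by simp
  have 3: "s p i = trans B i j p * s p j" using fibre_trans[OF holo_sections_fibre[OF s]] p by blast
  show ?thesis unfolding 1 2 3 using nz by (simp add: field_simps)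
qed

end

context quantum_system
begin

lemma dlogw_Lk:
  assumes c: "c \<in> A" and x: "x \<in> chart_img c (triv_dom L i)"
  shows "Lk.dlogw i c x v = of_nat k * dlogw i c x v"
proof -
  have "fd (Lk.logw i c) x = fd (\<lambda>y. real k * logw i c y) x"
    by (rule fd_cong[OF open_chart_img[OF c open_triv] x])
       (use weight_pos in \<open>simp add: Lk.logw_def logw_def weight_Lk ln_realpow mem_chart_img[OF c]\<close>)
  also have "\<dots> = (\<lambda>v. real k * fd (logw i c) x v)"
    by (intro fd_eqI derivative_intros logw_has_derivative[OF c x])
  finally show ?thesis unfolding Lk.dlogw_def dlogw_def by (simp add: field_simps)
qed

lemma Hhat_fibre:
  assumes s: "s \<in> holo_sections A Lk" shows "Hhat s z \<in> fibre Lk z"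
  unfolding fibre_def mem_Collect_eq
proof (intro conjI allI impI)
  note sf = Lk.holo_sections_fibre[OF s]
  show "Hhat s z i = 0" if "z \<notin> triv_dom Lk i" for i
    using that Lk.fibre_outside[OF sf that] unfolding Hhat_def quantum_hamiltonian_def chern_connection_def by simp
  fix i j assume ij: "z \<in> triv_dom Lk i \<and> z \<in> triv_dom Lk j"
  then have i: "z \<in> triv_dom L i" and j: "z \<in> triv_dom L j" by auto
  obtain c where c: "c \<in> A" "z \<in> fst c" using ex_chart by blast
  define N where "N l = fd ((\<lambda>z. s z l) \<circ> chart_inv c) (snd c z) (ham z c) + Lk.dlogw l c (snd c z) (ham z c) * s z l" for l
  have H: "Hhat s z l = \<i> / of_nat k * N l + of_real (H z) * s z l" if "z \<in> triv_dom L l" for l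
    unfolding Hhat_eq[OF s c that] N_def dlogw_Lk[OF c(1) chart_img_I[OF c(2) that]] using k
    by (simp add: field_simps)
  have "N i = trans Lk i j z * N j" unfolding N_def
    by (rule Lk.covariant_derivative_trans[OF s c]) (use ij in auto)
  moreover have "s z i = trans Lk i j z * s z j" using Lk.fibre_trans[OF sf] ij by blast
  ultimately show "Hhat s z i = trans Lk i j z * Hhat s z j"
    unfolding H[OF i] H[OF j] by (simp add: algebra_simps)
qed

end

context hamiltonian_system
begin

text \<open>The field is holomorphic, so only the derivative of the connection form can fail to be
  complex linear; by Hamilton's equation its antilinear part is the one that
  \<open>\<i> * dH\<close> removes.\<close>

lemma holo_on_moment:
  assumes act: "generates_holo_action A L H" and c: "c \<in> A"
  shows "holo_on (\<lambda>x. dlogw i c x (xi c x) - \<i> * of_real (H (chart_inv c x))) (chart_img c (triv_dom L i))"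
proof -
  define S where "S = chart_img c (triv_dom L i)"
  have S: "open S" unfolding S_def by (rule open_chart_img[OF c open_triv])
  define u where "u = logw i c"
  have u: "smooth_on u S" unfolding u_def S_def by (rule smooth_on_logw[OF c])
  have SI: "S \<subseteq> snd c ` fst c" unfolding S_def by (auto simp: mem_chart_img[OF c])
  have xiS: "vholo_on (xi c) S" by (rule vholo_on_subset[OF vholo_on_xi[OF act c] SI])
  define E where "E x h = (complex_of_real (hess u x h (xi c x)) - \<i> * of_real (hess u x h (\<i> *s xi c x))) / 2
      + dlogw i c x (fd (xi c) x h) - \<i> * of_real (fd (H \<circ> chart_inv c) x h)" for x h
  have "holo_on (\<lambda>x. dlogw i c x (xi c x) - \<i> * of_real ((H \<circ> chart_inv c) x)) S"
  proof (rule holo_onI_i[where D=E])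
    fix x assume x: "x \<in> S"
    have dfu: "((\<lambda>y. fd u y w) has_derivative (\<lambda>h. hess u x h w)) (at x)" for w
      unfolding hess_def by (intro fd_has_derivative smooth_on_differentiable[OF smooth_on_fd[OF u] x])
    have G: "((\<lambda>y. dlogw i c y w) has_derivative (\<lambda>h. (of_real (hess u x h w) - \<i> * of_real (hess u x h (\<i> *s w))) / 2)) (at x)" for w
      unfolding dlogw_def u_def[symmetric] by (auto intro!: derivative_eq_intros dfu)
    have lin: "linear (dlogw i c y)" if "y \<in> S" for y
    proof -
      have l: "linear (fd u y)" by (rule smooth_on_linear_fd[OF u that])
      show ?thesis unfolding dlogw_def u_def[symmetric]
        by (rule linearI) (auto simp: linear_add[OF l] linear_scale[OF l] linear_add[OF linear_smult]
            linear_scale[OF linear_smult] scaleR_conv_of_real[where 'a=complex] algebra_simps add_divide_distrib diff_divide_distrib)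
    qed
    have "((\<lambda>y. dlogw i c y (xi c y)) has_derivative
        (\<lambda>h. fd (\<lambda>y. dlogw i c y (xi c x)) x h + dlogw i c x (fd (xi c) x h))) (at x)"
      by (rule has_derivative_linear_family[OF S x lin _ vholo_on_has_derivative[OF xiS x]])
         (use G differentiable_def in blast)+
    then have 1: "((\<lambda>y. dlogw i c y (xi c y)) has_derivative
        (\<lambda>h. (of_real (hess u x h (xi c x)) - \<i> * of_real (hess u x h (\<i> *s xi c x))) / 2 + dlogw i c x (fd (xi c) x h))) (at x)"
      unfolding fd_eqI[OF G] .
    have dH: "((H \<circ> chart_inv c) has_derivative fd (H \<circ> chart_inv c) x) (at x)"
      by (intro fd_has_derivative smooth_on_differentiable[OF smooth_on_H[OF c]]) (use x SI in blast)
    show "((\<lambda>x. dlogw i c x (xi c x) - \<i> * of_real ((H \<circ> chart_inv c) x)) has_derivative E x) (at x)"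
      unfolding E_def by (intro derivative_intros 1 dH)
    fix v
    have H': "fd (H \<circ> chart_inv c) x w = levi u x (xi c x) w" for w
      unfolding u_def by (rule xi_eq[OF c x[unfolded S_def]])
    have d: "dlogw i c x (fd (xi c) x (\<i> *s v)) = \<i> * dlogw i c x (fd (xi c) x v)"
      unfolding vholo_on_smult[OF xiS x] by (rule dlogw_i[OF c x[unfolded S_def]])
    note sym = smooth_on_hess_commute[OF S u x]
    have n: "hess u x a (- b) = - hess u x a b" for a b
      using linear_neg[OF smooth_on_linear_hess2[OF S u x]] .
    \<comment> \<open>Inserting Hamilton's equation cancels the term
      \<open>hess u x h (\<i> *s xi c x)\<close>. What remains of the Hessian terms is
      \<open>(hess u x h \<xi> - \<i> * hess u x (\<i> *s h) \<xi>) / 2\<close>, which is complex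
      linear in \<open>h\<close>.\<close>
    show "E x (\<i> *s v) = \<i> * E x v"
      unfolding E_def H' d levi_def
      unfolding sym[of v "xi c x"] sym[of v "\<i> *s xi c x"] sym[of "\<i> *s v" "xi c x"] sym[of "\<i> *s v" "\<i> *s xi c x"]
      by (simp add: complex_eq_iff n field_simps)
  qed
  then show ?thesis unfolding S_def comp_def .
qed

end

text \<open>In a frame the operator is a holomorphic field applied to a holomorphic function, plus a
  multiplication in which the connection form and \<open>H\<close> enter only through the
  combination of \<open>holo_on_moment\<close>.\<close>

lemma (in quantum_system) Hhat_holo:
  assumes act: "generates_holo_action A L H" and s: "s \<in> holo_sections A Lk"
  shows "Hhat s \<in> holo_sections A Lk"
  unfolding holo_sections_def mem_Collect_eq
proof (intro conjI allI)
  show "Hhat s z \<in> fibre Lk z" for z by (rule Hhat_fibre[OF s])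
  fix i
  show "holo_fun A (triv_dom Lk i) (\<lambda>z. Hhat s z i)"
    unfolding holo_fun_def
  proof
    fix c assume c: "c \<in> A"
    define S where "S = chart_img c (triv_dom L i)"
    have S: "open S" unfolding S_def by (rule open_chart_img[OF c open_triv])
    have SI: "S \<subseteq> snd c ` fst c" unfolding S_def by (auto simp: mem_chart_img[OF c])
    have xiS: "vholo_on (xi c) S" by (rule vholo_on_subset[OF vholo_on_xi[OF act c] SI])
    define f where "f = (\<lambda>z. s z i) \<circ> chart_inv c"
    have f: "holo_on f S" using s c unfolding holo_sections_def holo_fun_def f_def S_def by simp
    have 1: "holo_on (\<lambda>x. fd f x (xi c x)) S"
      by (rule holo_on_linear_family[OF S _ holo_on_fd[OF f S] holo_on_smult[OF f] xiS])
         (use holo_on_has_derivative[OF f] has_derivative_linear in blast)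
    have "holo_on (\<lambda>x. \<i> / of_nat k * fd f x (xi c x)
        + \<i> * (dlogw i c x (xi c x) - \<i> * of_real (H (chart_inv c x))) * f x) S"
      by (intro holo_on_add holo_on_mult holo_on_const 1 f)
         (use holo_on_moment[OF act c] in \<open>simp add: S_def\<close>)
    then have "holo_on ((\<lambda>z. Hhat s z i) \<circ> chart_inv c) S"
    proof (rule holo_on_cong[OF S, rotated])
      fix x assume x: "x \<in> S"
      define p where "p = chart_inv c x"
      have p: "p \<in> fst c" "p \<in> triv_dom L i" "snd c p = x"
        using x SI mem_chart_img[OF c] chart_inv_mem[OF c] snd_chart_inv[OF c] unfolding p_def S_def by auto
      show "\<i> / of_nat k * fd f x (xi c x) + \<i> * (dlogw i c x (xi c x) - \<i> * of_real (H (chart_inv c x))) * f x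
          = ((\<lambda>z. Hhat s z i) \<circ> chart_inv c) x"
        using Hhat_eq[OF s c p(1,2)] p(3) unfolding f_def xi_def comp_def p_def[symmetric] by simp
    qed
    then show "holo_on ((\<lambda>z. Hhat s z i) \<circ> chart_inv c) (chart_img c (triv_dom Lk i))"
      unfolding S_def by simp
  qed
qed

section \<open>The Hamiltonian field is divergence free\<close>

text \<open>Third derivatives are symmetric in all three directions, so the six terms of the cyclic
  sum cancel in pairs. This is the closedness of the form on constant vector fields.\<close>

lemma levi_closed:
  fixes u :: "complex^'m::finite \<Rightarrow> real"
  assumes S: "open S" and u: "smooth_on u S" and x: "x \<in> S"
  shows "fd (\<lambda>y. levi u y a b) x h + fd (\<lambda>y. levi u y b h) x a + fd (\<lambda>y. levi u y h a) x b = 0"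
proof -
  define C where "C h a b = fd (\<lambda>y. hess u y a b) x h" for h a b
  have dh: "((\<lambda>y. hess u y a b) has_derivative (\<lambda>h. C h a b)) (at x)" for a b
    unfolding C_def by (intro fd_has_derivative smooth_on_differentiable[OF smooth_on_hess[OF u] x])
  have T: "fd (\<lambda>y. levi u y a b) x h = (C h a (\<i> *s b) - C h (\<i> *s a) b) / 2" for a b h
    unfolding levi_def by (rule fun_cong[OF fd_eqI]) (auto intro!: derivative_eq_intros dh)
  have s1: "C h a b = C a h b" for h a b
    unfolding C_def hess_def using smooth_on_hess_commute[OF S smooth_on_fd[OF u] x] unfolding hess_def .
  have s2: "C h a b = C h b a" for h a b
    unfolding C_def by (rule fun_cong[OF fd_cong[OF S x]]) (rule smooth_on_hess_commute[OF S u])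
  have "C h a (\<i> *s b) = C a (\<i> *s b) h" "C h (\<i> *s a) b = C b h (\<i> *s a)" "C a b (\<i> *s h) = C b (\<i> *s h) a"
    using s1 s2 by metis+
  then show ?thesis unfolding T by (simp add: field_simps)
qed

context hamiltonian_system
begin

text \<open>Cartan's formula: \<open>\<xi>\<close> preserves \<open>\<omega>\<close> because the Hessian of \<open>H\<close> is symmetric and \<open>\<omega>\<close> is closed.\<close>

lemma levi_logw_invariant:
  assumes act: "generates_holo_action A L H" and c: "c \<in> A" and x: "x \<in> chart_img c (triv_dom L i)"
  shows "fd (\<lambda>y. levi (logw i c) y v w) x (xi c x)
    = - levi (logw i c) x (fd (xi c) x v) w - levi (logw i c) x v (fd (xi c) x w)"
proof -
  define S where "S = chart_img c (triv_dom L i)"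
  have S: "open S" unfolding S_def by (rule open_chart_img[OF c open_triv])
  have xS: "x \<in> S" using x unfolding S_def .
  define u where "u = logw i c"
  have u: "smooth_on u S" unfolding u_def S_def by (rule smooth_on_logw[OF c])
  have SI: "S \<subseteq> snd c ` fst c" unfolding S_def by (auto simp: mem_chart_img[OF c])
  have xiS: "vholo_on (xi c) S" by (rule vholo_on_subset[OF vholo_on_xi[OF act c] SI])
  have sH: "smooth_on (H \<circ> chart_inv c) S" by (rule smooth_on_subset[OF smooth_on_H[OF c] SI])
  have sf: "symplectic_form (levi u y)" if "y \<in> S" for y by (rule symplectic_form_levi[OF S u that])
  interpret symplectic_form "levi u x" by (rule sf[OF xS])
  define T where "T h a b = fd (\<lambda>y. levi u y a b) x h" for h a b
  have dl: "(\<lambda>y. levi u y a b) differentiable (at x)" for a b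
    unfolding levi_def by (auto intro!: derivative_intros smooth_on_differentiable[OF smooth_on_hess[OF u] xS])
  \<comment> \<open>Hamilton's equation differentiated along \<open>a\<close>. The left-hand side is
    symmetric in \<open>a\<close> and \<open>b\<close>; closedness and antisymmetry then trade the
    derivatives along \<open>v\<close> and \<open>w\<close> for one along the field.\<close>
  have hessH: "hess (H \<circ> chart_inv c) x a b = T a (xi c x) b + levi u x (fd (xi c) x a) b" for a b
  proof -
    have "hess (H \<circ> chart_inv c) x a b = fd (\<lambda>y. levi u y (xi c y) b) x a"
      unfolding hess_def u_def by (rule fun_cong[OF fd_cong[OF S xS]]) (use xi_eq[OF c] in \<open>simp add: S_def\<close>)
    also have "fd (\<lambda>y. levi u y (xi c y) b) x = (\<lambda>h. fd (\<lambda>y. levi u y (xi c x) b) x h + levi u x (fd (xi c) x h) b)"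
      by (rule fd_eqI, rule has_derivative_linear_family[OF S xS symplectic_form.lin1[OF sf] dl vholo_on_has_derivative[OF xiS xS]])
    finally show ?thesis unfolding T_def .
  qed
  have anti: "T h a b = - T h b a" for h a b
  proof -
    have "fd (\<lambda>y. levi u y a b) x = fd (\<lambda>y. - levi u y b a) x"
      by (rule fd_cong[OF S xS]) (rule symplectic_form.antisym[OF sf])
    also have "\<dots> = (\<lambda>h. - fd (\<lambda>y. levi u y b a) x h)"
      by (intro fd_eqI derivative_intros fd_has_derivative dl)
    finally show ?thesis unfolding T_def by simp
  qed
  have "T v (xi c x) w + levi u x (fd (xi c) x v) w = T w (xi c x) v + levi u x (fd (xi c) x w) v"
    using hessH[of v w] hessH[of w v] smooth_on_hess_commute[OF S sH xS, of v w] by simp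
  moreover have "T v (xi c x) w + T (xi c x) w v + T w v (xi c x) = 0"
    unfolding T_def by (rule levi_closed[OF S u xS])
  moreover have "levi u x (fd (xi c) x w) v = - levi u x v (fd (xi c) x w)" by (rule antisym)
  ultimately show ?thesis
    using anti[of w v "xi c x"] anti[of "xi c x" w v] unfolding T_def u_def by linarith
qed

definition dens :: "('a, 'm) chart \<Rightarrow> complex^'m \<Rightarrow> real" where
  "dens c x = 2 ^ CARD('m) * Re (det (kahler_coeffs L c (chart_inv c x)))"

text \<open>\<open>kahler_coeffs\<close> chooses its frame point by point; a fixed frame exhibits
  the density as a polynomial in second derivatives of one smooth function.\<close>

lemma dens_local:
  assumes c: "c \<in> A" and x: "x \<in> chart_img c (triv_dom L i)"
  shows "dens c x = 2 ^ CARD('m) * Re (det (\<chi> j k. herm_form (levi (logw i c) x) (axis j 1) (axis k 1)))"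
proof -
  have p: "chart_inv c x \<in> fst c" "chart_inv c x \<in> triv_dom L i" "snd c (chart_inv c x) = x"
    using x mem_chart_img[OF c] chart_inv_mem[OF c] snd_chart_inv[OF c] by auto
  have "kahler_coeffs L c (chart_inv c x) = (\<chi> j k. herm_form (levi (logw i c) x) (axis j 1) (axis k 1))"
    using kahler_coeffs_eq[OF c p(1,2)] p(3) by (simp add: vec_eq_iff)
  then show ?thesis unfolding dens_def by simp
qed

lemma dens_pos: "c \<in> A \<Longrightarrow> x \<in> snd c ` fst c \<Longrightarrow> dens c x > 0"
  unfolding dens_def using det_kahler_coeffs(2) chart_inv_mem by simp

lemma Ck_on_dens:
  assumes c: "c \<in> A" shows "Ck_on 1 (dens c) (snd c ` fst c)"
proof (rule Ck_on_local)
  fix x assume x: "x \<in> snd c ` fst c"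
  obtain i where i: "chart_inv c x \<in> triv_dom L i" using ex_triv by blast
  define S where "S = chart_img c (triv_dom L i)"
  have S: "open S" "x \<in> S" unfolding S_def using open_chart_img[OF c open_triv] x i by (simp_all add: mem_chart_img[OF c])
  have u: "smooth_on (logw i c) S" unfolding S_def by (rule smooth_on_logw[OF c])
  have lv: "Ck_on 1 (\<lambda>y. levi (logw i c) y a b) S" for a b
  proof -
    have "Ck_on 1 (\<lambda>y. hess (logw i c) y a b) S" for a b
      using smooth_on_hess[OF u] unfolding smooth_on_def by blast
    then have "Ck_on 1 (\<lambda>y. (1/2) * (hess (logw i c) y a (\<i> *s b) - hess (logw i c) y (\<i> *s a) b)) S"
      by (intro Ck_on_mult Ck_on_diff Ck_on_const S)
    then show ?thesis unfolding levi_def by simp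
  qed
  have hf: "Ck_on 1 (\<lambda>y. herm_form (levi (logw i c) y) a b) S" for a b
  proof -
    have "Ck_on 1 (\<lambda>y. of_real (1/2 * levi (logw i c) y a (\<i> *s b)) - \<i> * of_real (1/2 * levi (logw i c) y a b)) S"
      by (intro Ck_on_diff Ck_on_mult Ck_on_of_real Ck_on_const S lv)
    then show ?thesis
      by (rule Ck_on_cong[OF S(1), rotated]) (simp add: herm_form_def complex_eq_iff)
  qed
  have pr: "Ck_on 1 (\<lambda>y. \<Prod>j\<in>I. f j y) S" if "finite I" "\<And>j. Ck_on 1 (f j) S" for I :: "'m set" and f :: "'m \<Rightarrow> complex^'m \<Rightarrow> complex"
    using that by (induction I rule: finite_induct) (auto intro: Ck_on_const Ck_on_mult S simp del: One_nat_def)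
  have "Ck_on 1 (\<lambda>y. 2 ^ CARD('m) * Re (det (\<chi> j k. herm_form (levi (logw i c) y) (axis j 1) (axis k 1)))) S"
    unfolding det_def
    by (intro Ck_on_mult Ck_on_const Ck_on_Re Ck_on_sum S pr) (simp_all add: hf del: One_nat_def)
  then have "Ck_on 1 (dens c) S"
    by (rule Ck_on_cong[OF S(1), rotated]) (simp add: dens_local[OF c] S_def)
  then show "\<exists>U. open U \<and> x \<in> U \<and> Ck_on 1 (dens c) U" using S by blast
qed

text \<open>By invariance of the form, the derivative of its Gram matrix \<open>a\<close> along the
  field is \<open>N ** a + a ** M\<close> with traces \<open>- t\<close> and \<open>- cnj t\<close>,
  where \<open>t\<close> is the complex trace of the derivative of the field. Jacobi's formula gives
  the density the logarithmic derivative \<open>- 2 * Re t\<close>, and the Euclidean divergence of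
  the field is \<open>2 * Re t\<close>.\<close>

lemma dens_xi_divergence:
  assumes act: "generates_holo_action A L H" and c: "c \<in> A" and xin: "x \<in> snd c ` fst c"
  shows "(\<Sum>b\<in>Basis. fd (\<lambda>y. (dens c y *\<^sub>R xi c y) \<bullet> b) x b) = 0"
proof -
  obtain i where i: "chart_inv c x \<in> triv_dom L i" using ex_triv by blast
  define S where "S = chart_img c (triv_dom L i)"
  have S: "open S" "x \<in> S" unfolding S_def using open_chart_img[OF c open_triv] xin i by (simp_all add: mem_chart_img[OF c])
  define u where "u = logw i c"
  have u: "smooth_on u S" unfolding S_def u_def by (rule smooth_on_logw[OF c])
  interpret symplectic_form "levi u x" by (rule symplectic_form_levi[OF S(1) u S(2)])
  have xiS: "vholo_on (xi c) (snd c ` fst c)" by (rule vholo_on_xi[OF act c])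
  define D where "D = fd (xi c) x"
  have dxi: "(xi c has_derivative D) (at x)" unfolding D_def by (rule vholo_on_has_derivative[OF xiS xin])
  have Di: "D (\<i> *s v) = \<i> *s D v" for v unfolding D_def by (rule vholo_on_smult[OF xiS xin])
  define t where "t = (\<Sum>j\<in>UNIV. D (axis j 1) $ j)"
  define a where "a y = (\<chi> j k. herm_form (levi u y) (axis j 1) (axis k 1))" for y
  define a' where "a' h = (\<chi> j k. Complex (fd (\<lambda>y. levi u y (axis j 1) (\<i> *s axis k 1)) x h / 2)
      (- fd (\<lambda>y. levi u y (axis j 1) (axis k 1)) x h / 2))" for h
  have dl: "((\<lambda>y. levi u y v w) has_derivative fd (\<lambda>y. levi u y v w) x) (at x)" for v w
    by (rule fd_has_derivative)
       (auto simp: levi_def intro!: derivative_intros smooth_on_differentiable[OF smooth_on_hess[OF u] S(2)])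
  have da: "((\<lambda>y. a y $ j $ k) has_derivative (\<lambda>h. a' h $ j $ k)) (at x)" for j k
    unfolding a_def a'_def vec_lambda_beta herm_form_def Complex_eq by (auto intro!: derivative_eq_intros dl)
  \<comment> \<open>\<open>N\<close> is minus the transpose of the matrix of \<open>D\<close>,
    \<open>M\<close> minus its conjugate, corresponding to the linear and the conjugate linear
    slot.\<close>
  define N where "N = (\<chi> j l. - D (axis j 1) $ l)"
  define M where "M = (\<chi> l k. - cnj (D (axis k 1) $ l))"
  have "a' (xi c x) = N ** a x + a x ** M"
  proof -
    have "a' (xi c x) $ j $ k = (N ** a x + a x ** M) $ j $ k" for j k
    proof -
      have "a' (xi c x) $ j $ k = - herm_form (levi u x) (D (axis j 1)) (axis k 1) - herm_form (levi u x) (axis j 1) (D (axis k 1))"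
        unfolding a'_def u_def vec_lambda_beta levi_logw_invariant[OF act c S(2)[unfolded S_def]]
        unfolding D_def[symmetric] Di herm_form_def by (simp add: complex_eq_iff field_simps)
      also have "herm_form (levi u x) (D (axis j 1)) (axis k 1) = (\<Sum>l\<in>UNIV. a x $ l $ k * D (axis j 1) $ l)"
        unfolding herm_form_expand[of "D (axis j 1)"] a_def by (simp add: axis_def if_distrib[of cnj] if_distrib[of "(*) _"] cong: if_cong)
      also have "herm_form (levi u x) (axis j 1) (D (axis k 1)) = (\<Sum>l\<in>UNIV. a x $ j $ l * cnj (D (axis k 1) $ l))"
      proof -
        have "herm_form (levi u x) (axis j 1) (D (axis k 1)) =
          (\<Sum>i\<in>UNIV. \<Sum>l\<in>UNIV. a x $ i $ l * ((axis j 1 :: complex^'m) $ i * cnj (D (axis k 1) $ l)))"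
          unfolding herm_form_expand[of "axis j 1" "D (axis k 1)"] a_def by simp
        also have "\<dots> = (\<Sum>i\<in>UNIV. if i = j then (\<Sum>l\<in>UNIV. a x $ i $ l * cnj (D (axis k 1) $ l)) else 0)"
          by (rule sum.cong) (auto simp: axis_def)
        finally show ?thesis by simp
      qed
      finally show ?thesis
        unfolding N_def M_def matrix_matrix_mult_def by (simp add: sum_negf mult.commute)
    qed
    then show ?thesis by (simp add: vec_eq_iff)
  qed
  then have "ddet (a x) (a' (xi c x)) = (trace N + trace M) * det (a x)"
    by (simp add: ddet_add ddet_mult_left ddet_mult_right distrib_right)
  moreover have "trace N = - t" unfolding trace_def N_def t_def by (simp add: sum_negf)
  moreover have "trace M = - cnj t" unfolding trace_def M_def t_def by (simp add: sum_negf)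
  ultimately have "ddet (a x) (a' (xi c x)) = of_real (- 2 * Re t) * det (a x)"
    by (simp add: complex_eq_iff)
  then have Rd: "Re (ddet (a x) (a' (xi c x))) = - 2 * Re t * Re (det (a x))" by simp
  have "((\<lambda>y. 2 ^ CARD('m) * Re (det (a y))) has_derivative (\<lambda>h. 2 ^ CARD('m) * Re (ddet (a x) (a' h)))) (at x)"
    by (intro has_derivative_mult_right has_derivative_Re has_derivative_det da)
  then have dd: "(dens c has_derivative (\<lambda>h. 2 ^ CARD('m) * Re (ddet (a x) (a' h)))) (at x)"
    by (rule has_derivative_transform_within_open[OF _ S])
       (simp add: dens_local[OF c] S_def a_def u_def)
  have dens: "dens c x = 2 ^ CARD('m) * Re (det (a x))"
    using dens_local[OF c S(2)[unfolded S_def]] unfolding a_def u_def .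
  have "fd (dens c) x (xi c x) = - 2 * Re t * dens c x"
    unfolding fd_eqI[OF dd] Rd dens by simp
  moreover have "(\<Sum>b\<in>Basis. fd (\<lambda>y. (dens c y *\<^sub>R xi c y) \<bullet> b) x b) =
     (\<Sum>b\<in>Basis. (xi c x \<bullet> b) * fd (dens c) x b) + dens c x * (\<Sum>b\<in>Basis. D b \<bullet> b)"
  proof -
    have d: "(dens c has_derivative fd (dens c) x) (at x)" using dd fd_eqI by metis
    have e: "((\<lambda>y. (dens c y *\<^sub>R xi c y) \<bullet> b) has_derivative (\<lambda>h. (dens c x *\<^sub>R D h + fd (dens c) x h *\<^sub>R xi c x) \<bullet> b)) (at x)" for b
      by (intro derivative_intros has_derivative_scaleR d dxi)
    have "fd (\<lambda>y. (dens c y *\<^sub>R xi c y) \<bullet> b) x b = dens c x * (D b \<bullet> b) + (xi c x \<bullet> b) * fd (dens c) x b" for b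
      unfolding fd_eqI[OF e] by (simp add: inner_add_left)
    then show ?thesis by (simp add: sum.distrib sum_distrib_left)
  qed
  moreover have "(\<Sum>b\<in>Basis. (xi c x \<bullet> b) * fd (dens c) x b) = fd (dens c) x (xi c x)"
  proof -
    have "linear (fd (dens c) x)" using dd fd_eqI has_derivative_linear by metis
    from linear_Basis_expand[OF this, of "xi c x"] show ?thesis by simp
  qed
  moreover have "(\<Sum>b\<in>Basis. D b \<bullet> b) = 2 * Re t" unfolding t_def by (rule real_trace_complex_linear[of D]) (rule Di)
  ultimately show ?thesis by simp
qed

end

section \<open>Integration by parts\<close>

locale quantization = quantum_system A L H k
  for A :: "('a::t2_space, 'm::finite) chart set" and L :: "('a, 'i) herm_line_bundle" and H :: "'a \<Rightarrow> real"
    and k :: nat +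
  fixes vol :: "'a measure"
  assumes compact_UNIV: "compact (UNIV :: 'a set)"
    and liouville: "is_liouville_measure A L vol"
    and act: "generates_holo_action A L H"
begin

lemma sets_vol [simp, measurable_cong]: "sets vol = sets borel"
  using liouville unfolding is_liouville_measure_def by blast

lemma space_vol [simp]: "space vol = UNIV"
  using sets_eq_imp_space_eq[OF sets_vol] by simp

section \<open>The Liouville measure in charts\<close>

lemma emeasure_vol_chart:
  assumes "c \<in> A" "E \<in> sets borel" "E \<subseteq> fst c"
  shows "emeasure vol E = (\<integral>\<^sup>+x. ennreal (dens c x) * indicator (snd c ` E) x \<partial>lborel)"
  using liouville assms unfolding is_liouville_measure_def dens_def by blast

lemma continuous_on_dens: "c \<in> A \<Longrightarrow> continuous_on (snd c ` fst c) (dens c)"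
  by (rule Ck_on_imp_continuous_on[OF Ck_on_dens])

lemma borel_dens: "c \<in> A \<Longrightarrow> (\<lambda>x. indicator (snd c ` fst c) x *\<^sub>R dens c x) \<in> borel_measurable borel"
  by (intro borel_measurable_continuous_on_indicator continuous_on_dens borel_open open_img)

text \<open>In a chart the density is positive, and a nonempty open set of coordinates is not
  negligible. Definiteness of the inner product on continuous sections rests on this.\<close>

lemma emeasure_vol_open_pos:
  assumes U: "open U" "p \<in> U" shows "emeasure vol U > 0"
proof -
  obtain c where c: "c \<in> A" "p \<in> fst c" using ex_chart by blast
  define V where "V = U \<inter> fst c"
  have V: "open V" "V \<subseteq> fst c" unfolding V_def using U open_dom[OF c(1)] by auto
  have img: "snd c ` V = chart_img c U" unfolding V_def chart_img_def by (simp add: Int_commute)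
  have O: "open (snd c ` V)" unfolding img by (rule open_chart_img[OF c(1) U(1)])
  have ne: "snd c ` V \<noteq> {}" using U c unfolding V_def by blast
  have sub: "snd c ` V \<subseteq> snd c ` fst c" using V by blast
  have m: "(\<lambda>x. ennreal (dens c x) * indicator (snd c ` V) x) \<in> borel_measurable lborel"
  proof -
    have "(\<lambda>x. ennreal (indicator (snd c ` V) x *\<^sub>R dens c x)) \<in> borel_measurable borel"
      using borel_measurable_continuous_on_indicator[OF borel_open[OF O] continuous_on_subset[OF continuous_on_dens[OF c(1)] sub]]
      by measurable
    moreover have "(\<lambda>x. ennreal (indicator (snd c ` V) x *\<^sub>R dens c x)) = (\<lambda>x. ennreal (dens c x) * indicator (snd c ` V) x)"
      by (auto simp: indicator_def)
    ultimately show ?thesis by simp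
  qed
  have "emeasure vol V \<noteq> 0"
  proof
    assume "emeasure vol V = 0"
    then have "AE x in lborel. ennreal (dens c x) * indicator (snd c ` V) x = 0"
      using emeasure_vol_chart[OF c(1) borel_open[OF V(1)] V(2)] nn_integral_0_iff_AE[OF m] by simp
    then have "AE x in lborel. x \<notin> snd c ` V"
    proof (rule AE_mp, intro AE_I2 impI notI)
      fix x assume z: "ennreal (dens c x) * indicator (snd c ` V) x = 0" and x: "x \<in> snd c ` V"
      have "dens c x > 0" using dens_pos[OF c(1)] x sub by blast
      then show False using z x by simp
    qed
    then have "snd c ` V \<in> null_sets lborel" using O by (simp add: AE_iff_null_sets borel_open)
    then have "negligible (snd c ` V)" by (simp add: negligible_iff_null_sets null_sets_completionI)
    then show False using open_not_negligible[OF O ne] by blast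
  qed
  moreover have "emeasure vol V \<le> emeasure vol U"
    unfolding V_def using U by (intro emeasure_mono) auto
  ultimately show ?thesis by (metis less_le_trans not_gr_zero)
qed

text \<open>The measure is prescribed only inside charts. A coordinate ball has finite measure
  because the density is bounded on the closed ball; compactness of the manifold later sums finitely
  many of these.\<close>

lemma vol_locally_finite: "\<exists>U. open U \<and> p \<in> U \<and> emeasure vol U < \<infinity>"
proof -
  obtain c where c: "c \<in> A" "p \<in> fst c" using ex_chart by blast
  have "snd c p \<in> snd c ` fst c" using c by blast
  then obtain r where r: "r > 0" "cball (snd c p) r \<subseteq> snd c ` fst c"
    using open_img[OF c(1)] open_contains_cball by blast
  define U where "U = {q \<in> fst c. snd c q \<in> ball (snd c p) r}"
  have U: "open U" "p \<in> U" "U \<subseteq> fst c"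
    unfolding U_def using open_chart_preimage[OF c(1) open_ball] c r by auto
  have "bounded (dens c ` cball (snd c p) r)"
    by (intro compact_imp_bounded compact_continuous_image compact_cball continuous_on_subset[OF continuous_on_dens[OF c(1)] r(2)])
  then obtain M where "\<forall>y\<in>dens c ` cball (snd c p) r. norm y \<le> M" unfolding bounded_iff by blast
  then have M: "\<bar>dens c x\<bar> \<le> M" if "x \<in> cball (snd c p) r" for x using that by auto
  have "emeasure vol U = (\<integral>\<^sup>+x. ennreal (dens c x) * indicator (snd c ` U) x \<partial>lborel)"
    by (rule emeasure_vol_chart[OF c(1) borel_open[OF U(1)] U(3)])
  also have "\<dots> \<le> (\<integral>\<^sup>+x. ennreal M * indicator (cball (snd c p) r) x \<partial>lborel)"
  proof (rule nn_integral_mono)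
    fix x
    show "ennreal (dens c x) * indicator (snd c ` U) x \<le> ennreal M * indicator (cball (snd c p) r) x"
    proof (cases "x \<in> snd c ` U")
      case True
      then have "x \<in> cball (snd c p) r" unfolding U_def by auto
      then show ?thesis using True M[of x] by (simp add: ennreal_leI)
    qed simp
  qed
  also have "\<dots> = ennreal M * emeasure lborel (cball (snd c p) r)"
    by (simp add: nn_integral_cmult_indicator)
  also have "\<dots> < \<infinity>"
    using emeasure_compact_finite[OF compact_cball, of "snd c p" r] by (simp add: ennreal_mult_less_top)
  finally show ?thesis using U by blast
qed

sublocale finite_measure vol
proof
  obtain W where W: "\<And>p. open (W p) \<and> p \<in> W p \<and> emeasure vol (W p) < \<infinity>" using vol_locally_finite by metis
  have "UNIV \<subseteq> (\<Union>p\<in>UNIV. W p)" using W by blast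
  then obtain F where F: "finite F" "UNIV \<subseteq> (\<Union>p\<in>F. W p)"
    using compactE_image[OF compact_UNIV, of UNIV W] W by metis
  have "(\<Union>p\<in>F. W p) = UNIV" using F by blast
  then have "emeasure vol UNIV = emeasure vol (\<Union>p\<in>F. W p)" by simp
  also have "\<dots> \<le> (\<Sum>p\<in>F. emeasure vol (W p))"
    using F W by (intro emeasure_subadditive_finite) auto
  also have "\<dots> < \<infinity>" using F W by (simp add: less_top)
  finally show "emeasure vol (space vol) \<noteq> \<infinity>" by simp
qed

lemma integrable_vol_continuous:
  fixes f :: "'a \<Rightarrow> 'b::{banach, second_countable_topology}"
  assumes "continuous_on UNIV f" shows "integrable vol f"
proof -
  have "bounded (f ` UNIV)" by (rule compact_imp_bounded[OF compact_continuous_image[OF assms compact_UNIV]])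
  then obtain M where M: "\<And>x. norm (f x) \<le> M" unfolding bounded_iff by auto
  have "f \<in> borel_measurable vol" using borel_measurable_continuous_onI[OF assms] by simp
  then show ?thesis by (intro integrable_const_bound[of _ M]) (use M in auto)
qed

text \<open>Restricted to a chart domain, the measure is the image of weighted Lebesgue measure
  under the inverse chart. This is checked on Borel sets and then transferred to integrals.\<close>

lemma integral_vol_chart:
  fixes G :: "'a \<Rightarrow> complex"
  assumes c: "c \<in> A" and G: "G \<in> borel_measurable borel" "\<And>p. p \<notin> fst c \<Longrightarrow> G p = 0"
  shows "(\<integral>p. G p \<partial>vol) = (\<integral>x. (indicator (snd c ` fst c) x *\<^sub>R dens c x) *\<^sub>R G (chart_inv c x) \<partial>lborel)"
proof -
  let ?I = "snd c ` fst c"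
  \<comment> \<open>\<open>chart_inv\<close> is arbitrary off the image of the chart; a constant
    value there makes the map Borel measurable.\<close>
  define \<iota> where "\<iota> x = (if x \<in> ?I then chart_inv c x else undefined)" for x
  have oI: "?I \<in> sets borel" by (intro borel_open open_img c)
  have \<iota>: "\<iota> \<in> borel_measurable borel"
    unfolding \<iota>_def by (rule borel_measurable_continuous_on_if[OF oI continuous_on_chart_inv[OF c]]) simp
  define \<rho> where "\<rho> x = indicator ?I x *\<^sub>R dens c x" for x
  have \<rho>: "\<rho> \<in> borel_measurable borel" unfolding \<rho>_def by (rule borel_dens[OF c])
  have \<rho>0: "\<rho> x \<ge> 0" for x unfolding \<rho>_def using dens_pos[OF c, of x] by (auto simp: indicator_def intro: less_imp_le)
  have fc: "fst c \<in> sets borel" by (intro borel_open open_dom c)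
  have "density vol (\<lambda>p. ennreal (indicator (fst c) p)) = distr (density lborel (\<lambda>x. ennreal (\<rho> x))) borel \<iota>"
  proof (rule measure_eqI)
    show "sets (density vol (\<lambda>p. ennreal (indicator (fst c) p))) = sets (distr (density lborel (\<lambda>x. ennreal (\<rho> x))) borel \<iota>)" by simp
    fix E assume "E \<in> sets (density vol (\<lambda>p. ennreal (indicator (fst c) p)))"
    then have E: "E \<in> sets borel" by simp
    have "emeasure (density vol (\<lambda>p. ennreal (indicator (fst c) p))) E = (\<integral>\<^sup>+p. ennreal (indicator (fst c) p) * indicator E p \<partial>vol)"
      using E fc by (intro emeasure_density) auto
    also have "\<dots> = (\<integral>\<^sup>+p. indicator (fst c \<inter> E) p \<partial>vol)"
      by (intro nn_integral_cong) (simp add: indicator_def)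
    also have "\<dots> = emeasure vol (fst c \<inter> E)" using E fc by (intro nn_integral_indicator) simp
    also have "\<dots> = (\<integral>\<^sup>+x. ennreal (dens c x) * indicator (snd c ` (fst c \<inter> E)) x \<partial>lborel)"
      using E fc by (intro emeasure_vol_chart[OF c]) auto
    also have "\<dots> = (\<integral>\<^sup>+x. ennreal (\<rho> x) * indicator (\<iota> -` E) x \<partial>lborel)"
    proof (rule nn_integral_cong)
      fix x
      have "x \<in> snd c ` (fst c \<inter> E) \<longleftrightarrow> x \<in> ?I \<and> chart_inv c x \<in> E"
        using mem_chart_img[OF c, of x E] unfolding chart_img_def .
      then show "ennreal (dens c x) * indicator (snd c ` (fst c \<inter> E)) x = ennreal (\<rho> x) * indicator (\<iota> -` E) x"
        unfolding \<rho>_def \<iota>_def by (simp add: indicator_def)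
    qed
    also have "\<dots> = emeasure (density lborel (\<lambda>x. ennreal (\<rho> x))) (\<iota> -` E)"
      using \<rho> measurable_sets[OF \<iota> E] by (intro emeasure_density[symmetric]) auto
    also have "\<dots> = emeasure (distr (density lborel (\<lambda>x. ennreal (\<rho> x))) borel \<iota>) E"
      using \<iota> E by (subst emeasure_distr) auto
    finally show "emeasure (density vol (\<lambda>p. ennreal (indicator (fst c) p))) E = emeasure (distr (density lborel (\<lambda>x. ennreal (\<rho> x))) borel \<iota>) E" .
  qed
  note eq = this
  have "(\<integral>p. G p \<partial>vol) = (\<integral>p. indicator (fst c) p *\<^sub>R G p \<partial>vol)"
    using G(2) by (intro Bochner_Integration.integral_cong) (auto simp: indicator_def)
  also have "\<dots> = integral\<^sup>L (density vol (\<lambda>p. ennreal (indicator (fst c) p))) G"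
    using G(1) fc by (intro integral_density[symmetric]) auto
  also have "\<dots> = (\<integral>x. G (\<iota> x) \<partial>density lborel (\<lambda>x. ennreal (\<rho> x)))"
    unfolding eq using \<iota> G(1) by (intro integral_distr) auto
  also have "\<dots> = (\<integral>x. \<rho> x *\<^sub>R G (\<iota> x) \<partial>lborel)"
    using \<rho> \<rho>0 measurable_compose[OF \<iota> G(1)] by (intro integral_density) auto
  also have "\<dots> = (\<integral>x. (indicator ?I x *\<^sub>R dens c x) *\<^sub>R G (chart_inv c x) \<partial>lborel)"
    by (intro Bochner_Integration.integral_cong) (auto simp: \<rho>_def \<iota>_def indicator_def)
  finally show ?thesis .
qed

section \<open>Integrals of derivatives along the Hamiltonian field\<close>

definition dham :: "('a \<Rightarrow> complex) \<Rightarrow> 'a \<Rightarrow> complex" where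
  "dham f p = differential A f p (ham p)"

lemma dham_chart:
  assumes "((f \<circ> chart_inv c) has_derivative D) (at (snd c p))" "c \<in> A" "p \<in> fst c"
  shows "dham f p = D (ham p c)"
  unfolding dham_def by (rule differential_chart[OF ham_tangent assms(2,3,1)])

lemma continuous_on_dham:
  assumes f: "C1_fun UNIV f" shows "continuous_on UNIV (dham f)"
proof (rule continuous_at_imp_continuous_on, rule ballI)
  fix p
  obtain c where c: "c \<in> A" "p \<in> fst c" using ex_chart by blast
  let ?I = "snd c ` fst c"
  define F where "F = f \<circ> chart_inv c"
  have F: "Ck_on 1 F ?I" using f c unfolding C1_fun_def F_def chart_img_UNIV by blast
  have dF: "(F has_derivative fd F x) (at x)" if "x \<in> ?I" for x
    using F that Ck_on_has_derivative[of 0 F] by simp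
  have cF: "continuous_on ?I (\<lambda>x. fd F x b)" for b
    using F by (simp add: Ck_on.simps One_nat_def)
  have "continuous_on ?I (\<lambda>x. \<Sum>b\<in>Basis. (xi c x \<bullet> b) *\<^sub>R fd F x b)"
    by (intro continuous_intros cF continuous_on_xi[OF c(1)])
  then have "continuous_on (fst c) (\<lambda>q. \<Sum>b\<in>Basis. (xi c (snd c q) \<bullet> b) *\<^sub>R fd F (snd c q) b)"
    by (rule continuous_on_compose2) (use continuous_on_chart[OF c(1)] in auto)
  then have "continuous_on (fst c) (dham f)"
  proof (rule continuous_on_eq)
    fix q assume q: "q \<in> fst c"
    have x: "snd c q \<in> ?I" using q by blast
    have "dham f q = fd F (snd c q) (xi c (snd c q))"
      using dham_chart[OF dF[OF x, unfolded F_def] c(1) q] q c(1) unfolding xi_def F_def by (simp add: chart_inv_snd)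
    also have "\<dots> = (\<Sum>b\<in>Basis. (xi c (snd c q) \<bullet> b) *\<^sub>R fd F (snd c q) b)"
      by (rule linear_Basis_expand[OF has_derivative_linear[OF dF[OF x]]])
    finally show "(\<Sum>b\<in>Basis. (xi c (snd c q) \<bullet> b) *\<^sub>R fd F (snd c q) b) = dham f q" ..
  qed
  then show "isCont (dham f) p" using continuous_on_eq_continuous_at[OF open_dom[OF c(1)]] c by blast
qed

text \<open>In coordinates the integrand is the derivative of \<open>f\<close> along the field times
  the density, and this weighted field is divergence free; compact support in the chart then gives
  0.\<close>

lemma integral_dham_chart:
  assumes f: "C1_fun UNIV f" and c: "c \<in> A" and K: "compact K" "K \<subseteq> fst c" "\<And>p. p \<notin> K \<Longrightarrow> f p = 0"
  shows "(\<integral>p. dham f p \<partial>vol) = 0"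
proof -
  let ?I = "snd c ` fst c"
  define F where "F = f \<circ> chart_inv c"
  have F: "Ck_on 1 F ?I" using f c unfolding C1_fun_def F_def chart_img_UNIV by blast
  have dF: "(F has_derivative fd F x) (at x)" if "x \<in> ?I" for x
    using F that Ck_on_has_derivative[of 0 F] by simp
  have "dham f p = 0" if "p \<notin> K" for p
  proof -
    obtain d where d: "d \<in> A" "p \<in> fst d" using ex_chart by blast
    have "open (chart_img d (- K))" by (rule open_chart_img[OF d(1)]) (use compact_imp_closed[OF K(1)] in auto)
    moreover have "snd d p \<in> chart_img d (- K)" using d that by (intro chart_img_I) auto
    ultimately have "((f \<circ> chart_inv d) has_derivative (\<lambda>h. 0)) (at (snd d p))"
      by (rule has_derivative_transform_within_open[OF has_derivative_const])
         (use K(3) d in \<open>simp add: mem_chart_img\<close>)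
    from dham_chart[OF this d] show ?thesis .
  qed
  then have "(\<integral>p. dham f p \<partial>vol) = (\<integral>x. (indicator ?I x *\<^sub>R dens c x) *\<^sub>R dham f (chart_inv c x) \<partial>lborel)"
    using K(2) borel_measurable_continuous_onI[OF continuous_on_dham[OF f]]
    by (intro integral_vol_chart[OF c]) auto
  also have "\<dots> = (\<integral>x. indicator ?I x *\<^sub>R (fd F x (dens c x *\<^sub>R xi c x)
      + (\<Sum>b\<in>Basis. fd (\<lambda>y. (dens c y *\<^sub>R xi c y) \<bullet> b) x b) *\<^sub>R F x) \<partial>lborel)"
  proof (rule Bochner_Integration.integral_cong[OF refl])
    fix x
    show "(indicator ?I x *\<^sub>R dens c x) *\<^sub>R dham f (chart_inv c x) = indicator ?I x *\<^sub>R (fd F x (dens c x *\<^sub>R xi c x)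
      + (\<Sum>b\<in>Basis. fd (\<lambda>y. (dens c y *\<^sub>R xi c y) \<bullet> b) x b) *\<^sub>R F x)"
    proof (cases "x \<in> ?I")
      case True
      have l: "linear (fd F x)" using dF[OF True] has_derivative_linear by blast
      have "dham f (chart_inv c x) = fd F x (xi c x)"
        using dham_chart[of f c "fd F x" "chart_inv c x"] dF[OF True] True c
        by (simp add: snd_chart_inv chart_inv_mem xi_def F_def)
      then show ?thesis using True dens_xi_divergence[OF act c True] linear_scale[OF l] by simp
    qed simp
  qed
  also have "\<dots> = 0"
  proof (rule integral_divergence[OF open_img[OF c] _ _ _ F])
    show "compact (snd c ` K)" by (intro compact_continuous_image continuous_on_subset[OF continuous_on_chart[OF c]] K)
    show "snd c ` K \<subseteq> ?I" using K by blast
    show "F x = 0" if "x \<in> ?I - snd c ` K" for x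
    proof -
      have "chart_inv c x \<notin> K" using that snd_chart_inv[OF c, of x] by (metis Diff_iff image_eqI)
      then show ?thesis unfolding F_def using K(3) by simp
    qed
    fix b :: "complex^'m"
    have xiI: "vholo_on (xi c) ?I" by (rule vholo_on_xi[OF act c])
    have comp: "Ck_on 1 (\<lambda>x. xi c x $ j) ?I" for j
      using xiI holo_on_Ck_on[OF _ open_img[OF c]] unfolding vholo_on_def by blast
    have "Ck_on 1 (\<lambda>x. dens c x * (\<Sum>j\<in>UNIV. Re (xi c x $ j) * Re (b $ j) + Im (xi c x $ j) * Im (b $ j))) ?I"
      by (intro Ck_on_mult Ck_on_sum Ck_on_add Ck_on_Re Ck_on_Im Ck_on_const Ck_on_dens open_img c comp)
    moreover have "(dens c x *\<^sub>R xi c x) \<bullet> b = dens c x * (\<Sum>j\<in>UNIV. Re (xi c x $ j) * Re (b $ j) + Im (xi c x $ j) * Im (b $ j))" for x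
      unfolding inner_scaleR_left by (simp only: inner_vec_def inner_complex_def)
    ultimately show "Ck_on 1 (\<lambda>x. (dens c x *\<^sub>R xi c x) \<bullet> b) ?I" by (simp only:)
  qed
  finally show ?thesis .
qed

text \<open>A partition of unity reduces to functions supported in charts: finitely many bumps are
  positive on a cover, and division by their positive sum \<open>S\<close> normalises them.\<close>

lemma integral_dham:
  assumes f: "C1_fun UNIV f" shows "(\<integral>p. dham f p \<partial>vol) = 0"
proof -
  have "\<exists>\<beta> c K. C1_fun UNIV (\<beta> :: 'a \<Rightarrow> real) \<and> (\<forall>q. 0 \<le> \<beta> q) \<and> \<beta> p > 0 \<and> c \<in> A \<and>
    compact K \<and> K \<subseteq> fst c \<and> (\<forall>q. q \<notin> K \<longrightarrow> \<beta> q = 0)" for p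
  proof -
    obtain c where c: "c \<in> A" "p \<in> fst c" using ex_chart by blast
    obtain \<beta> :: "'a \<Rightarrow> real" and K where "C1_fun UNIV \<beta>" "\<And>q. 0 \<le> \<beta> q" "\<beta> p > 0"
      "compact K" "K \<subseteq> fst c" "K \<subseteq> UNIV" "\<And>q. q \<notin> K \<Longrightarrow> \<beta> q = 0"
      using bump_function[OF c open_UNIV UNIV_I] by blast
    then show ?thesis using c(1)
      by (intro exI[of _ \<beta>] exI[of _ c] exI[of _ K] conjI allI impI) auto
  qed
  then obtain \<beta> :: "'a \<Rightarrow> 'a \<Rightarrow> real" and c K where \<beta>: "\<And>p. C1_fun UNIV (\<beta> p)" "\<And>p q. 0 \<le> \<beta> p q" "\<And>p. \<beta> p p > 0"
    "\<And>p. c p \<in> A" "\<And>p. compact (K p)" "\<And>p. K p \<subseteq> fst (c p)" "\<And>p q. q \<notin> K p \<Longrightarrow> \<beta> p q = 0"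
    by metis
  define W where "W p = {q. \<beta> p q > 0}" for p
  have W: "open (W p)" "p \<in> W p" for p
    unfolding W_def using open_Collect_less[OF continuous_on_const C1_fun_continuous_on[OF \<beta>(1)]] \<beta>(3) by auto
  have "UNIV \<subseteq> (\<Union>p\<in>UNIV. W p)" using W by blast
  then obtain I where I: "finite I" "UNIV \<subseteq> (\<Union>p\<in>I. W p)"
    using compactE_image[OF compact_UNIV, of UNIV W] W by metis
  define S where "S q = (\<Sum>p\<in>I. \<beta> p q)" for q
  have S: "S q > 0" for q
  proof -
    obtain p where "p \<in> I" "\<beta> p q > 0" using I(2) unfolding W_def by blast
    then show ?thesis unfolding S_def using I(1) \<beta>(2) by (intro sum_pos2[of I p]) auto
  qed
  have S1: "C1_fun UNIV (\<lambda>q. inverse (S q))"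
  proof (rule C1_fun_inverse)
    show "C1_fun UNIV S" unfolding S_def by (intro C1_fun_sum \<beta>(1)) simp
    show "S q \<noteq> 0" for q using S[of q] by simp
  qed simp
  define g where "g p q = \<beta> p q *\<^sub>R (inverse (S q) *\<^sub>R f q)" for p q
  have g1: "C1_fun UNIV (g p)" for p
    unfolding g_def by (intro C1_fun_scaleR \<beta>(1) S1 f) simp_all
  have fg: "f q = (\<Sum>p\<in>I. g p q)" for q
  proof -
    have "(\<Sum>p\<in>I. g p q) = S q *\<^sub>R (inverse (S q) *\<^sub>R f q)" unfolding g_def S_def by (rule scaleR_sum_left[symmetric])
    then show ?thesis using S[of q] by simp
  qed
  have "dham f q = (\<Sum>p\<in>I. dham (g p) q)" for q
  proof -
    obtain d where d: "d \<in> A" "q \<in> fst d" using ex_chart by blast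
    have dg: "((g p \<circ> chart_inv d) has_derivative fd (g p \<circ> chart_inv d) (snd d q)) (at (snd d q))" for p
      by (rule C1_fun_has_derivative[OF g1 d]) simp
    have "(\<lambda>x. \<Sum>p\<in>I. (g p \<circ> chart_inv d) x) = f \<circ> chart_inv d" using fg by auto
    moreover have "((\<lambda>x. \<Sum>p\<in>I. (g p \<circ> chart_inv d) x) has_derivative (\<lambda>h. \<Sum>p\<in>I. fd (g p \<circ> chart_inv d) (snd d q) h)) (at (snd d q))"
      by (intro has_derivative_sum dg)
    ultimately have "((f \<circ> chart_inv d) has_derivative (\<lambda>h. \<Sum>p\<in>I. fd (g p \<circ> chart_inv d) (snd d q) h)) (at (snd d q))" by simp
    from dham_chart[OF this d] show ?thesis using dham_chart[OF dg d] by simp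
  qed
  then have "(\<integral>q. dham f q \<partial>vol) = (\<integral>q. (\<Sum>p\<in>I. dham (g p) q) \<partial>vol)" by simp
  also have "\<dots> = (\<Sum>p\<in>I. \<integral>q. dham (g p) q \<partial>vol)"
    by (intro Bochner_Integration.integral_sum integrable_vol_continuous continuous_on_dham g1)
  also have "\<dots> = 0"
  proof (intro sum.neutral ballI)
    fix p
    show "(\<integral>q. dham (g p) q \<partial>vol) = 0"
      by (rule integral_dham_chart[OF g1 \<beta>(4)[of p] \<beta>(5)[of p] \<beta>(6)[of p]]) (simp add: g_def \<beta>(7))
  qed
  finally show ?thesis .
qed

text \<open>The Chern connection is compatible with the metric, so the derivative of the pairing is
  the sum of both covariant derivatives. In the difference the real multiplication by
  \<open>H\<close> cancels, and conjugating \<open>\<i> / k\<close> turns the minus sign into the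
  plus of that sum.\<close>

lemma herm_Hhat_diff:
  assumes s: "s \<in> holo_sections A Lk" and t: "t \<in> holo_sections A Lk"
  defines "f \<equiv> \<lambda>z. herm Lk z (s z) (t z)"
  shows "C1_fun UNIV f"
    and "herm Lk z (Hhat s z) (t z) - herm Lk z (s z) (Hhat t z) = \<i> / of_nat k * dham f z"
proof -
  note sf = Lk.holo_sections_fibre[OF s] and tf = Lk.holo_sections_fibre[OF t]
  have main: "(f \<circ> chart_inv c) y = of_real (exp (real k * logw i c y)) * ((\<lambda>z. s z i) \<circ> chart_inv c) y * cnj (((\<lambda>z. t z i) \<circ> chart_inv c) y)"
    if c: "c \<in> A" and y: "y \<in> chart_img c (triv_dom L i)" for c i y
  proof -
    have p: "chart_inv c y \<in> triv_dom L i" using y mem_chart_img[OF c] by blast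
    then have "exp (real k * ln (weight L i (chart_inv c y))) = weight L i (chart_inv c y) ^ k"
      using weight_pos by (simp add: exp_of_nat_mult)
    then show ?thesis unfolding f_def logw_def comp_def
      using Lk.herm_eq[OF sf tf, of "chart_inv c y" i] p by (simp add: weight_Lk)
  qed
  show "C1_fun UNIV f"
  proof (rule C1_fun_local)
    fix p :: 'a
    obtain i where i: "p \<in> triv_dom L i" using ex_triv by blast
    have "C1_fun (triv_dom L i) f"
      unfolding C1_fun_def
    proof
      fix c assume c: "c \<in> A"
      have S: "open (chart_img c (triv_dom L i))" by (rule open_chart_img[OF c open_triv])
      have hs: "Ck_on 1 ((\<lambda>z. s z i) \<circ> chart_inv c) (chart_img c (triv_dom L i))"
        if "s \<in> holo_sections A Lk" for s
        using that c by (intro holo_on_Ck_on[OF _ S]) (simp add: holo_sections_def holo_fun_def)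
      have "Ck_on 1 (\<lambda>y. of_real (weight Lk i (chart_inv c y)) * ((\<lambda>z. s z i) \<circ> chart_inv c) y * cnj (((\<lambda>z. t z i) \<circ> chart_inv c) y)) (chart_img c (triv_dom L i))"
      proof (intro Ck_on_mult Ck_on_of_real Ck_on_cnj S hs s t)
        show "Ck_on 1 (\<lambda>y. weight Lk i (chart_inv c y)) (chart_img c (triv_dom L i))"
          using smooth_fun_C1_fun[OF Lk.weight_smooth[of i]] c unfolding C1_fun_def comp_def by simp
      qed
      then show "Ck_on 1 (f \<circ> chart_inv c) (chart_img c (triv_dom L i))"
        by (rule Ck_on_cong[OF S, rotated])
           (simp add: f_def Lk.herm_eq[OF sf tf, of _ i] mem_chart_img[OF c])
    qed
    then show "\<exists>V. open V \<and> p \<in> V \<and> C1_fun V f" using i open_triv by blast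
  qed
  obtain c i where c: "c \<in> A" "z \<in> fst c" and i: "z \<in> triv_dom L i" using ex_chart ex_triv by blast
  have i': "z \<in> triv_dom Lk i" using i by simp
  define x where "x = snd c z"
  have x: "x \<in> chart_img c (triv_dom L i)" unfolding x_def by (rule chart_img_I[OF c(2) i])
  define v where "v = ham z c"
  define S where "S = (\<lambda>z. s z i) \<circ> chart_inv c"
  define T where "T = (\<lambda>z. t z i) \<circ> chart_inv c"
  have Sx: "S x = s z i" and Tx: "T x = t z i" unfolding S_def T_def x_def using c by (simp_all add: chart_inv_snd)
  have dS: "(S has_derivative fd S x) (at x)" and dT: "(T has_derivative fd T x) (at x)"
    unfolding S_def T_def x_def using Lk.section_has_derivative[OF s c i'] Lk.section_has_derivative[OF t c i'] .
  have dl: "(logw i c has_derivative fd (logw i c) x) (at x)" by (rule logw_has_derivative[OF c(1) x])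
  define w where "w = complex_of_real (exp (real k * logw i c x))"
  define D where "D h = w * (of_nat k * of_real (fd (logw i c) x h)) * S x * cnj (T x)
     + w * fd S x h * cnj (T x) + w * S x * cnj (fd T x h)" for h
  have "((\<lambda>y. of_real (exp (real k * logw i c y)) * S y * cnj (T y)) has_derivative D) (at x)"
    unfolding D_def w_def by (auto intro!: derivative_eq_intros dS dT dl simp: algebra_simps)
  then have "((f \<circ> chart_inv c) has_derivative D) (at x)"
    by (rule has_derivative_transform_within_open[OF _ open_chart_img[OF c(1) open_triv] x])
       (use main[OF c(1)] in \<open>simp add: S_def T_def\<close>)
  then have dh: "dham f z = D v" unfolding v_def x_def by (rule dham_chart[OF _ c])
  have ww: "complex_of_real (weight Lk i z) = w"
    unfolding w_def logw_def x_def using c weight_pos[OF i] by (simp add: weight_Lk chart_inv_snd exp_of_nat_mult)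
  have h1: "herm Lk z (Hhat s z) (t z) = w * Hhat s z i * cnj (t z i)"
    unfolding Lk.herm_eq[OF Hhat_fibre[OF s] tf i'] ww ..
  have h2: "herm Lk z (s z) (Hhat t z) = w * s z i * cnj (Hhat t z i)"
    unfolding Lk.herm_eq[OF sf Hhat_fibre[OF t] i'] ww ..
  have dl2: "complex_of_real (fd (logw i c) x v) = dlogw i c x v + cnj (dlogw i c x v)"
    unfolding dlogw_def by (simp add: complex_eq_iff)
  have k0: "of_nat k \<noteq> (0::complex)" using k by simp
  show "herm Lk z (Hhat s z) (t z) - herm Lk z (s z) (Hhat t z) = \<i> / of_nat k * dham f z"
    unfolding h1 h2 Hhat_eq[OF s c i] Hhat_eq[OF t c i] dh D_def dl2
    unfolding S_def[symmetric] T_def[symmetric] x_def[symmetric] v_def[symmetric] Sx Tx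
    using k0 by (simp add: field_simps)
qed

lemma L2_inner_Hhat:
  assumes s: "s \<in> holo_sections A Lk" and t: "t \<in> holo_sections A Lk"
  shows "L2_inner Lk vol (Hhat s) t = L2_inner Lk vol s (Hhat t)"
proof -
  have cs: "Lk.cont_section r" if "r \<in> holo_sections A Lk" for r by (rule Lk.holo_sections_cont_section[OF that])
  have i: "integrable vol (\<lambda>z. herm Lk z (q z) (r z))" if "q \<in> holo_sections A Lk" "r \<in> holo_sections A Lk" for q r
    by (intro integrable_vol_continuous Lk.continuous_on_herm cs that)
  have "L2_inner Lk vol (Hhat s) t - L2_inner Lk vol s (Hhat t) = (\<integral>z. herm Lk z (Hhat s z) (t z) - herm Lk z (s z) (Hhat t z) \<partial>vol)"
    unfolding L2_inner_def using i s t Hhat_holo[OF act] by (intro Bochner_Integration.integral_diff[symmetric]) auto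
  also have "\<dots> = \<i> / of_nat k * (\<integral>z. dham (\<lambda>z. herm Lk z (s z) (t z)) z \<partial>vol)"
    unfolding herm_Hhat_diff(2)[OF s t] by simp
  also have "\<dots> = 0" using integral_dham[OF herm_Hhat_diff(1)[OF s t]] by simp
  finally show ?thesis by simp
qed

end

section \<open>The Bergman kernel\<close>

context hermitian_bundle
begin

lemma herm_diff_left: "herm B z (\<lambda>i. u i - v i) t = herm B z u t - herm B z v t"
  unfolding herm_def Let_def by (simp add: algebra_simps)

lemma herm_scale_left: "herm B z (\<lambda>i. a * u i) v = a * herm B z u v"
  unfolding herm_def Let_def by simp

lemma herm_scale_right: "herm B z u (\<lambda>i. a * v i) = cnj a * herm B z u v"
  unfolding herm_def Let_def by simp

lemma herm_cnj: "herm B z u v = cnj (herm B z v u)"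
  unfolding herm_def Let_def by simp

lemma cont_section_fibre: "cont_section s \<Longrightarrow> s z \<in> fibre B z"
  unfolding cont_section_def by blast

lemma cont_section_comb:
  assumes "cont_section s" "cont_section t" shows "cont_section (\<lambda>z i. a * s z i + b * t z i)"
  using assms fibre_add unfolding cont_section_def by (auto intro!: continuous_intros)

lemma cont_section_diff:
  assumes "cont_section s" "cont_section t" shows "cont_section (\<lambda>z i. s z i - t z i)"
  using cont_section_comb[OF assms, of 1 "-1"] by simp

lemma holo_sections_comb:
  assumes "s \<in> holo_sections A B" "t \<in> holo_sections A B"
  shows "(\<lambda>z i. a * s z i + b * t z i) \<in> holo_sections A B"
  using assms fibre_add unfolding holo_sections_def holo_fun_def
  by (auto simp: comp_def intro!: holo_on_add holo_on_cmult)

end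

locale bergman = quantization A L H k vol
  for A :: "('a::t2_space, 'm::finite) chart set" and L :: "('a, 'i) herm_line_bundle" and H :: "'a \<Rightarrow> real"
    and k :: nat and vol :: "'a measure" +
  fixes P :: "('a, 'i) sect \<Rightarrow> ('a, 'i) sect"
    and K :: "'a \<Rightarrow> 'a \<Rightarrow> ('i \<Rightarrow> complex) \<Rightarrow> 'i \<Rightarrow> complex"
  assumes bergman: "is_bergman_projection A (tensor_power L k) vol P"
    and schwartz: "is_schwartz_kernel (tensor_power L k) vol P K"
begin

section \<open>Inner products and the projection on continuous sections\<close>

abbreviation inner2 :: "('a, 'i) sect \<Rightarrow> ('a, 'i) sect \<Rightarrow> complex" where
  "inner2 \<equiv> L2_inner Lk vol"

lemma integrable_herm:
  assumes "Lk.cont_section s" "Lk.cont_section t" shows "integrable vol (\<lambda>z. herm Lk z (s z) (t z))"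
  by (intro integrable_vol_continuous Lk.continuous_on_herm assms)

lemma inner2_diff_left:
  assumes "Lk.cont_section s" "Lk.cont_section s'" "Lk.cont_section t"
  shows "inner2 (\<lambda>z i. s z i - s' z i) t = inner2 s t - inner2 s' t"
  unfolding L2_inner_def Lk.herm_diff_left
  by (intro Bochner_Integration.integral_diff integrable_herm assms)

lemma inner2_cnj: "inner2 s t = cnj (inner2 t s)"
  unfolding L2_inner_def by (subst Lk.herm_cnj) simp

lemma inner2_scale_left: "inner2 (\<lambda>z i. a * s z i) t = a * inner2 s t"
  unfolding L2_inner_def Lk.herm_scale_left by simp

lemma inner2_scale_right: "inner2 s (\<lambda>z i. a * t z i) = cnj a * inner2 s t"
  unfolding L2_inner_def Lk.herm_scale_right by simp

lemma inner2_diff_right: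
  assumes "Lk.cont_section s" "Lk.cont_section t" "Lk.cont_section t'"
  shows "inner2 s (\<lambda>z i. t z i - t' z i) = inner2 s t - inner2 s t'"
  using inner2_diff_left[OF assms(2,3,1)] inner2_cnj[of s] by (metis complex_cnj_diff)

lemma cont_section_L2:
  assumes "Lk.cont_section s" shows "s \<in> L2_sections Lk vol"
  unfolding L2_sections_def mem_Collect_eq
proof (intro conjI allI)
  show "s z \<in> fibre Lk z" for z by (rule Lk.cont_section_fibre[OF assms])
  show "integrable vol (\<lambda>z. herm Lk z (s z) (s z))" by (rule integrable_herm[OF assms assms])
  fix i
  have "(\<lambda>z. indicator (triv_dom Lk i) z *\<^sub>R s z i) \<in> borel_measurable borel"
    using assms unfolding Lk.cont_section_def
    by (intro borel_measurable_continuous_on_indicator borel_open Lk.open_triv) blast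
  moreover have "(\<lambda>z. indicator (triv_dom Lk i) z *\<^sub>R s z i) = (\<lambda>z. s z i)"
    using Lk.fibre_outside[OF Lk.cont_section_fibre[OF assms]] by (auto simp: indicator_def)
  ultimately show "(\<lambda>z. s z i) \<in> borel_measurable vol" by simp
qed

text \<open>A positive value would persist on an open set, and open neighbourhoods have positive
  measure.\<close>

lemma continuous_integral_zero:
  fixes n :: "'a \<Rightarrow> real"
  assumes n: "continuous_on UNIV n" "\<And>z. n z \<ge> 0" and 0: "(\<integral>z. n z \<partial>vol) = 0"
  shows "n z = 0"
proof (rule ccontr)
  assume "n z \<noteq> 0"
  then have z: "z \<in> {z. n z > 0}" using n(2)[of z] by simp
  have o: "open {z. n z > 0}" by (rule open_Collect_less[OF continuous_on_const n(1)])
  have "AE z in vol. n z = 0"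
    using integral_nonneg_eq_0_iff_AE[OF integrable_vol_continuous[OF n(1)]] n(2) 0 by simp
  then have "AE z in vol. z \<notin> {z. n z > 0}" by (rule AE_mp) (auto intro: AE_I2)
  then have "{z. n z > 0} \<in> null_sets vol" using o by (simp add: AE_iff_null_sets borel_open)
  then show False using emeasure_vol_open_pos[OF o z] by auto
qed

lemma herm_self_real:
  assumes "Lk.cont_section s"
  shows "herm Lk z (s z) (s z) = of_real (Re (herm Lk z (s z) (s z)))" "Re (herm Lk z (s z) (s z)) \<ge> 0"
    and "Re (herm Lk z (s z) (s z)) = 0 \<Longrightarrow> s z = (\<lambda>i. 0)"
proof -
  obtain i where i: "z \<in> triv_dom Lk i" using Lk.ex_triv by blast
  note h = Lk.herm_self[OF Lk.cont_section_fibre[OF assms] i]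
  show "herm Lk z (s z) (s z) = of_real (Re (herm Lk z (s z) (s z)))" "Re (herm Lk z (s z) (s z)) \<ge> 0"
    "Re (herm Lk z (s z) (s z)) = 0 \<Longrightarrow> s z = (\<lambda>i. 0)"
    using h Lk.weight_pos[OF i] Lk.fibre_eq_zero_iff[OF Lk.cont_section_fibre[OF assms] i] by auto
qed

lemma inner2_self:
  assumes s: "Lk.cont_section s"
  shows "inner2 s s = of_real (Re (inner2 s s))" "Re (inner2 s s) \<ge> 0"
    and "inner2 s s = 0 \<Longrightarrow> s = (\<lambda>z i. 0)"
proof -
  define n where "n z = Re (herm Lk z (s z) (s z))" for z
  have i: "inner2 s s = of_real (\<integral>z. n z \<partial>vol)"
    unfolding L2_inner_def n_def using herm_self_real(1)[OF s] by (metis (no_types, lifting) Bochner_Integration.integral_cong integral_complex_of_real)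
  have n: "n z \<ge> 0" for z unfolding n_def by (rule herm_self_real(2)[OF s])
  have cn: "continuous_on UNIV n"
    unfolding n_def by (intro continuous_on_Re Lk.continuous_on_herm s)
  show "inner2 s s = of_real (Re (inner2 s s))" "Re (inner2 s s) \<ge> 0" using i n by auto
  assume "inner2 s s = 0"
  then have "(\<integral>z. n z \<partial>vol) = 0" using i by simp
  from continuous_integral_zero[OF cn n this] show "s = (\<lambda>z i. 0)"
    using herm_self_real(3)[OF s] unfolding n_def by blast
qed

lemma P_holo: "Lk.cont_section s \<Longrightarrow> P s \<in> holo_sections A Lk"
  using bergman cont_section_L2 unfolding is_bergman_projection_def by blast

lemma P_cont: "Lk.cont_section s \<Longrightarrow> Lk.cont_section (P s)"
  by (rule Lk.holo_sections_cont_section[OF P_holo])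

lemma P_orthogonal:
  assumes "Lk.cont_section s" "t \<in> holo_sections A Lk" shows "inner2 s t = inner2 (P s) t"
proof -
  have "inner2 (\<lambda>z i. s z i - P s z i) t = 0"
    using bergman cont_section_L2[OF assms(1)] assms(2) unfolding is_bergman_projection_def by blast
  then show ?thesis
    using inner2_diff_left[OF assms(1) P_cont[OF assms(1)] Lk.holo_sections_cont_section[OF assms(2)]] by simp
qed

text \<open>Both sides equal \<open>inner2 (P s) (P t)\<close>, since the images of \<open>P\<close>
  are holomorphic.\<close>

lemma P_symmetric:
  assumes "Lk.cont_section s" "Lk.cont_section t" shows "inner2 (P s) t = inner2 s (P t)"
proof -
  have "inner2 (P s) t = cnj (inner2 t (P s))" by (rule inner2_cnj)
  also have "\<dots> = cnj (inner2 (P t) (P s))" using P_orthogonal[OF assms(2) P_holo[OF assms(1)]] by simp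
  also have "\<dots> = inner2 (P s) (P t)" by (rule inner2_cnj[symmetric])
  also have "\<dots> = inner2 s (P t)" by (rule P_orthogonal[OF assms(1) P_holo[OF assms(2)], symmetric])
  finally show ?thesis .
qed

text \<open>The difference \<open>t - P t\<close> is holomorphic as well as orthogonal to all
  holomorphic sections, hence to itself.\<close>

lemma P_holo_id:
  assumes "t \<in> holo_sections A Lk" shows "P t = t"
proof -
  note tc = Lk.holo_sections_cont_section[OF assms]
  define \<sigma> where "\<sigma> = (\<lambda>z i. 1 * t z i + (-1) * P t z i)"
  have sh: "\<sigma> \<in> holo_sections A Lk" unfolding \<sigma>_def by (intro Lk.holo_sections_comb assms P_holo tc)
  have e: "\<sigma> = (\<lambda>z i. t z i - P t z i)" unfolding \<sigma>_def by simp
  have "inner2 \<sigma> \<sigma> = inner2 t \<sigma> - inner2 (P t) \<sigma>"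
    using inner2_diff_left[OF tc P_cont[OF tc] Lk.holo_sections_cont_section[OF sh]] unfolding e .
  then have "inner2 \<sigma> \<sigma> = 0" using P_orthogonal[OF tc sh] by simp
  then have "\<sigma> = (\<lambda>z i. 0)" by (rule inner2_self(3)[OF Lk.holo_sections_cont_section[OF sh]])
  then show ?thesis unfolding e by (simp add: fun_eq_iff)
qed

section \<open>Symmetry and reproducing property of the kernel\<close>

lemma K_fibre: "u \<in> fibre Lk w \<Longrightarrow> K z w u \<in> fibre Lk z"
  using schwartz unfolding is_schwartz_kernel_def by blast

lemma K_scale:
  assumes "u \<in> fibre Lk w" shows "K z w (\<lambda>i. a * u i) = (\<lambda>i. a * K z w u i)"
proof -
  have "K z w (\<lambda>i. a * u i + 0 * u i) = (\<lambda>i. a * K z w u i + 0 * K z w u i)"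
    using schwartz assms unfolding is_schwartz_kernel_def by blast
  then show ?thesis by simp
qed

lemma K_frame:
  assumes "u \<in> fibre Lk w" "w \<in> triv_dom Lk j" shows "K z w u i = u j * K z w (frame Lk j w) i"
proof -
  have "K z w u = K z w (\<lambda>i. u j * frame Lk j w i)" using Lk.fibre_scale_frame[OF assms] by simp
  then show ?thesis using K_scale[OF Lk.frame_in_fibre[OF assms(2)]] by simp
qed

lemma K_continuous: "continuous_on (triv_dom Lk i \<times> triv_dom Lk j) (\<lambda>(z, w). K z w (frame Lk j w) i)"
  using schwartz unfolding is_schwartz_kernel_def by blast

lemma P_integral:
  assumes "Lk.cont_section s" shows "has_bochner_integral vol (\<lambda>w. K z w (s w) i) (P s z i)"
  using schwartz cont_section_L2[OF assms] unfolding is_schwartz_kernel_def by blast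

lemma cont_section_K:
  assumes "u \<in> fibre Lk w" shows "Lk.cont_section (\<lambda>z. K z w u)"
  unfolding Lk.cont_section_def
proof (intro conjI allI)
  show "K z w u \<in> fibre Lk z" for z by (rule K_fibre[OF assms])
  fix i
  obtain j where j: "w \<in> triv_dom Lk j" using Lk.ex_triv by blast
  have "continuous_on (triv_dom Lk i) (\<lambda>z. (\<lambda>(z, w). K z w (frame Lk j w) i) (z, w))"
    by (rule continuous_on_compose2[OF K_continuous[of i j]]) (use j in \<open>auto intro!: continuous_intros\<close>)
  then show "continuous_on (triv_dom Lk i) (\<lambda>z. K z w u i)"
    unfolding K_frame[OF assms j] by (auto intro!: continuous_intros)
qed

text \<open>A nonnegative weight that sees only points where \<open>f\<close> is close to
  \<open>a\<close> averages \<open>f\<close> to about \<open>a\<close>. The total weight is kept as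
  a factor instead of being normalised, so the estimate can be iterated for two variables.\<close>

lemma average_bound:
  fixes f :: "'a \<Rightarrow> complex" and \<beta> :: "'a \<Rightarrow> real"
  assumes \<beta>: "continuous_on UNIV \<beta>" "\<And>z. \<beta> z \<ge> 0" and f: "integrable vol (\<lambda>z. of_real (\<beta> z) * f z)"
    and bd: "\<And>z. \<beta> z \<noteq> 0 \<Longrightarrow> norm (f z - a) \<le> e"
  shows "norm ((\<integral>z. of_real (\<beta> z) * f z \<partial>vol) - of_real (\<integral>z. \<beta> z \<partial>vol) * a) \<le> (\<integral>z. \<beta> z \<partial>vol) * e"
proof -
  have i\<beta>: "integrable vol \<beta>" by (rule integrable_vol_continuous[OF \<beta>(1)])
  have ia: "integrable vol (\<lambda>z. of_real (\<beta> z) * a)" using i\<beta> by simp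
  have "(\<integral>z. of_real (\<beta> z) * f z \<partial>vol) - of_real (\<integral>z. \<beta> z \<partial>vol) * a = (\<integral>z. of_real (\<beta> z) * f z - of_real (\<beta> z) * a \<partial>vol)"
    using Bochner_Integration.integral_diff[OF f ia] by simp
  also have "norm \<dots> \<le> (\<integral>z. norm (of_real (\<beta> z) * f z - of_real (\<beta> z) * a) \<partial>vol)"
    by (rule integral_norm_bound)
  also have "\<dots> \<le> (\<integral>z. \<beta> z * e \<partial>vol)"
  proof (rule integral_mono)
    show "integrable vol (\<lambda>z. norm (of_real (\<beta> z) * f z - of_real (\<beta> z) * a))"
      by (intro integrable_norm Bochner_Integration.integrable_diff f ia)
    show "integrable vol (\<lambda>z. \<beta> z * e)" using i\<beta> by simp
    fix z
    have "norm (of_real (\<beta> z) * f z - of_real (\<beta> z) * a) = \<beta> z * norm (f z - a)"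
      using \<beta>(2)[of z] by (simp add: right_diff_distrib[symmetric] norm_mult)
    also have "\<dots> \<le> \<beta> z * e" using \<beta>(2)[of z] bd[of z] by (cases "\<beta> z = 0") (auto intro: mult_left_mono)
    finally show "norm (of_real (\<beta> z) * f z - of_real (\<beta> z) * a) \<le> \<beta> z * e" .
  qed
  finally show ?thesis by simp
qed

text \<open>A frame exists only over its trivialization; a cutoff supported there extends it by zero
  to a global continuous section on which \<open>P\<close> can be evaluated.\<close>

lemma bump_section:
  assumes w: "w \<in> triv_dom Lk j" and U: "open U" "w \<in> U"
  obtains \<beta> :: "'a \<Rightarrow> real" where "continuous_on UNIV \<beta>" "\<And>q. \<beta> q \<ge> 0" "(\<integral>q. \<beta> q \<partial>vol) > 0"
    "\<And>q. \<beta> q \<noteq> 0 \<Longrightarrow> q \<in> U \<inter> triv_dom Lk j" "Lk.cont_section (\<lambda>q i. of_real (\<beta> q) * frame Lk j q i)"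
proof -
  obtain c where c: "c \<in> A" "w \<in> fst c" using ex_chart by blast
  have U': "open (U \<inter> triv_dom Lk j)" "w \<in> U \<inter> triv_dom Lk j" using U w Lk.open_triv by auto
  obtain \<beta> :: "'a \<Rightarrow> real" and C where \<beta>: "C1_fun UNIV \<beta>" "\<And>q. 0 \<le> \<beta> q" "\<beta> w > 0"
    "compact C" "C \<subseteq> fst c" "C \<subseteq> U \<inter> triv_dom Lk j" "\<And>q. q \<notin> C \<Longrightarrow> \<beta> q = 0"
    using bump_function[OF c U'] by blast
  have c\<beta>: "continuous_on UNIV \<beta>" by (rule C1_fun_continuous_on[OF \<beta>(1)]) simp
  have pos: "(\<integral>q. \<beta> q \<partial>vol) > 0"
  proof -
    have "(\<integral>q. \<beta> q \<partial>vol) \<noteq> 0" using continuous_integral_zero[OF c\<beta> \<beta>(2), of w] \<beta>(3) by auto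
    moreover have "(\<integral>q. \<beta> q \<partial>vol) \<ge> 0" using \<beta>(2) by simp
    ultimately show ?thesis by simp
  qed
  have "Lk.cont_section (\<lambda>q i. of_real (\<beta> q) * frame Lk j q i)"
    unfolding Lk.cont_section_def
  proof (intro conjI allI)
    show "(\<lambda>i. complex_of_real (\<beta> q) * frame Lk j q i) \<in> fibre Lk q" for q
    proof (cases "q \<in> triv_dom Lk j")
      case True
      show ?thesis using Lk.fibre_add[OF Lk.frame_in_fibre[OF True] Lk.frame_in_fibre[OF True], of "of_real (\<beta> q)" 0] by simp
    next
      case False
      then have "\<beta> q = 0" using \<beta>(6,7) by blast
      then show ?thesis using Lk.fibre_zero by simp
    qed
    fix i
    show "continuous_on (triv_dom Lk i) (\<lambda>q. complex_of_real (\<beta> q) * frame Lk j q i)"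
    proof (rule continuous_at_imp_continuous_on, rule ballI)
      fix q assume q: "q \<in> triv_dom Lk i"
      show "isCont (\<lambda>q. complex_of_real (\<beta> q) * frame Lk j q i) q"
      proof (cases "q \<in> C")
        case True
        define V where "V = triv_dom Lk i \<inter> triv_dom Lk j"
        have V: "open V" "q \<in> V" unfolding V_def using Lk.open_triv q True \<beta>(6) by auto
        have "continuous_on V (\<lambda>q. complex_of_real (\<beta> q) * trans Lk i j q)"
          using Lk.holo_fun_continuous_on[OF Lk.trans_holo[of i j]] V(1) unfolding V_def
          by (intro continuous_intros continuous_on_subset[OF c\<beta>]) auto
        then have "continuous_on V (\<lambda>q. complex_of_real (\<beta> q) * frame Lk j q i)"
          by (rule continuous_on_eq) (simp add: V_def frame_def)
        then show ?thesis using V by (simp add: continuous_on_eq_continuous_at)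
      next
        case False
        have "continuous_on (- C) (\<lambda>q. complex_of_real (\<beta> q) * frame Lk j q i)"
          by (rule continuous_on_eq[of _ "\<lambda>q. 0"]) (use \<beta>(7) in auto)
        then show ?thesis using False compact_imp_closed[OF \<beta>(4)] by (simp add: continuous_on_eq_continuous_at open_Compl)
      qed
    qed
  qed
  moreover have "q \<in> U \<inter> triv_dom Lk j" if "\<beta> q \<noteq> 0" for q using that \<beta>(6,7) by blast
  ultimately show ?thesis using that[OF c\<beta> \<beta>(2) pos] by blast
qed

text \<open>Both sides are recovered from averages against bumps concentrated at \<open>z\<close> and \<open>w\<close>.\<close>

lemma K_hermitian:
  assumes z: "z \<in> triv_dom Lk i" and w: "w \<in> triv_dom Lk j"
  shows "of_real (weight Lk i z) * K z w (frame Lk j w) i = cnj (of_real (weight Lk j w) * K w z (frame Lk i z) j)"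
proof -
  define F where "F = (\<lambda>(z, w). of_real (weight Lk i z) * K z w (frame Lk j w) i)"
  define G where "G = (\<lambda>(z, w). cnj (of_real (weight Lk j w) * K w z (frame Lk i z) j))"
  let ?D = "triv_dom Lk i \<times> triv_dom Lk j"
  have D: "open ?D" "(z, w) \<in> ?D" using Lk.open_triv z w by (auto intro: open_Times)
  have cF: "continuous_on ?D F"
  proof -
    have "continuous_on ?D (\<lambda>p. of_real (weight Lk i (fst p)) * (\<lambda>(z, w). K z w (frame Lk j w) i) p)"
      by (intro continuous_intros K_continuous continuous_on_compose2[OF Lk.continuous_on_weight]) auto
    then show ?thesis unfolding F_def by (simp add: case_prod_unfold)
  qed
  have cG: "continuous_on ?D G"
  proof -
    have "continuous_on ?D (\<lambda>p. (\<lambda>(z, w). K z w (frame Lk i w) j) (snd p, fst p))"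
      by (rule continuous_on_compose2[OF K_continuous[of j i]]) (auto intro!: continuous_intros)
    then have "continuous_on ?D (\<lambda>p. cnj (of_real (weight Lk j (snd p)) * (\<lambda>(z, w). K z w (frame Lk i w) j) (snd p, fst p)))"
      by (intro continuous_intros continuous_on_compose2[OF Lk.continuous_on_weight]) auto
    then show ?thesis unfolding G_def by (simp add: case_prod_unfold)
  qed
  have "norm (F (z, w) - G (z, w)) \<le> 2 * e" if e: "e > 0" for e
  proof -
    define O' where "O' = {p \<in> ?D. dist (F p) (F (z, w)) < e \<and> dist (G p) (G (z, w)) < e}"
    have "O' = (F -` ball (F (z, w)) e \<inter> ?D) \<inter> (G -` ball (G (z, w)) e \<inter> ?D)"
      unfolding O'_def by (auto simp: dist_commute)
    moreover have "open (F -` ball (F (z, w)) e \<inter> ?D)" "open (G -` ball (G (z, w)) e \<inter> ?D)"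
      using continuous_on_open_vimage[OF D(1)] cF cG open_ball by blast+
    ultimately have "open O'" by auto
    moreover have "(z, w) \<in> O'" unfolding O'_def using D e by simp
    ultimately obtain U V where UV: "open U" "open V" "(z, w) \<in> U \<times> V" "U \<times> V \<subseteq> O'"
      by (rule open_prod_elim)
    have bd: "norm (F (z', w') - F (z, w)) \<le> e" "norm (G (z', w') - G (z, w)) \<le> e" if "z' \<in> U" "w' \<in> V" for z' w'
    proof -
      have "(z', w') \<in> O'" using UV(4) that by blast
      then show "norm (F (z', w') - F (z, w)) \<le> e" "norm (G (z', w') - G (z, w)) \<le> e"
        unfolding O'_def by (auto simp: dist_norm)
    qed
    from UV(3) have zU: "z \<in> U" and wV: "w \<in> V" by auto
    obtain \<beta>1 where \<beta>1: "continuous_on UNIV \<beta>1" "\<And>q. \<beta>1 q \<ge> 0" "(\<integral>q. \<beta>1 q \<partial>vol) > 0"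
      "\<And>q. \<beta>1 q \<noteq> 0 \<Longrightarrow> q \<in> V \<inter> triv_dom Lk j" "Lk.cont_section (\<lambda>q l. of_real (\<beta>1 q) * frame Lk j q l)"
      using bump_section[OF w UV(2) wV] by blast
    obtain \<beta>2 where \<beta>2: "continuous_on UNIV \<beta>2" "\<And>q. \<beta>2 q \<ge> 0" "(\<integral>q. \<beta>2 q \<partial>vol) > 0"
      "\<And>q. \<beta>2 q \<noteq> 0 \<Longrightarrow> q \<in> U \<inter> triv_dom Lk i" "Lk.cont_section (\<lambda>q l. of_real (\<beta>2 q) * frame Lk i q l)"
      using bump_section[OF z UV(1) zU] by blast
    \<comment> \<open>\<open>s1\<close> is concentrated near \<open>w\<close> and \<open>s2\<close>
      near \<open>z\<close>, so that \<open>P s1\<close> near \<open>z\<close> and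
      \<open>P s2\<close> near \<open>w\<close> probe the two kernel values to be compared.\<close>
    define s1 where "s1 = (\<lambda>q l. complex_of_real (\<beta>1 q) * frame Lk j q l)"
    define s2 where "s2 = (\<lambda>q l. complex_of_real (\<beta>2 q) * frame Lk i q l)"
    have s: "Lk.cont_section s1" "Lk.cont_section s2" unfolding s1_def s2_def by (rule \<beta>1(5), rule \<beta>2(5))
    define b1 where "b1 = (\<integral>q. \<beta>1 q \<partial>vol)"
    define b2 where "b2 = (\<integral>q. \<beta>2 q \<partial>vol)"
    have b: "b1 > 0" "b2 > 0" unfolding b1_def b2_def by (rule \<beta>1(3), rule \<beta>2(3))
    have Kz: "K x y (\<lambda>l. 0) l' = 0" for x y l'
      using K_scale[OF Lk.fibre_zero, of x y 0] by simp
    have Ks1: "K x q (s1 q) l = of_real (\<beta>1 q) * K x q (frame Lk j q) l" for x q l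
      using K_scale[OF Lk.frame_in_fibre, of q j x "of_real (\<beta>1 q)"] \<beta>1(4)[of q] Kz unfolding s1_def
      by (cases "\<beta>1 q = 0") auto
    have Ks2: "K x q (s2 q) l = of_real (\<beta>2 q) * K x q (frame Lk i q) l" for x q l
      using K_scale[OF Lk.frame_in_fibre, of q i x "of_real (\<beta>2 q)"] \<beta>2(4)[of q] Kz unfolding s2_def
      by (cases "\<beta>2 q = 0") auto
    have in1: "norm (of_real (weight Lk i q) * P s1 q i - of_real b1 * F (z, w)) \<le> b1 * e" if q: "\<beta>2 q \<noteq> 0" for q
    proof -
      have "has_bochner_integral vol (\<lambda>r. of_real (weight Lk i q) * K q r (s1 r) i) (of_real (weight Lk i q) * P s1 q i)"
        by (intro has_bochner_integral_mult_right P_integral s)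
      then have I: "has_bochner_integral vol (\<lambda>r. of_real (\<beta>1 r) * F (q, r)) (of_real (weight Lk i q) * P s1 q i)"
        unfolding Ks1 F_def by (simp add: mult_ac)
      have "norm ((\<integral>r. of_real (\<beta>1 r) * F (q, r) \<partial>vol) - of_real b1 * F (z, w)) \<le> b1 * e"
        unfolding b1_def
        by (rule average_bound[OF \<beta>1(1,2)])
           (use I has_bochner_integral_iff bd(1) \<beta>1(4) \<beta>2(4)[OF q] in auto)
      then show ?thesis using has_bochner_integral_integral_eq[OF I] by simp
    qed
    have in2: "norm (of_real (weight Lk j q) * cnj (P s2 q j) - of_real b2 * G (z, w)) \<le> b2 * e" if q: "\<beta>1 q \<noteq> 0" for q
    proof -
      have "has_bochner_integral vol (\<lambda>r. of_real (weight Lk j q) * cnj (K q r (s2 r) j)) (of_real (weight Lk j q) * cnj (P s2 q j))"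
        by (intro has_bochner_integral_mult_right has_bochner_integral_cnj P_integral s)
      then have I: "has_bochner_integral vol (\<lambda>r. of_real (\<beta>2 r) * G (r, q)) (of_real (weight Lk j q) * cnj (P s2 q j))"
        unfolding Ks2 G_def by (simp add: mult_ac)
      have "norm ((\<integral>r. of_real (\<beta>2 r) * G (r, q) \<partial>vol) - of_real b2 * G (z, w)) \<le> b2 * e"
        unfolding b2_def
        by (rule average_bound[OF \<beta>2(1,2)])
           (use I has_bochner_integral_iff bd(2) \<beta>2(4) \<beta>1(4)[OF q] in auto)
      then show ?thesis using has_bochner_integral_integral_eq[OF I] by simp
    qed
    have h2: "herm Lk q (P s1 q) (s2 q) = of_real (\<beta>2 q) * (of_real (weight Lk i q) * P s1 q i)" for q
    proof (cases "\<beta>2 q = 0")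
      case True
      then show ?thesis unfolding s2_def herm_def Let_def by simp
    next
      case False
      then have q: "q \<in> triv_dom Lk i" using \<beta>2(4) by blast
      have "s2 q i = of_real (\<beta>2 q)" unfolding s2_def using Lk.frame_self[OF q] by simp
      then show ?thesis
        using Lk.herm_eq[OF Lk.cont_section_fibre[OF P_cont[OF s(1)]] Lk.cont_section_fibre[OF s(2)] q] by simp
    qed
    have h1: "herm Lk q (s1 q) (P s2 q) = of_real (\<beta>1 q) * (of_real (weight Lk j q) * cnj (P s2 q j))" for q
    proof (cases "\<beta>1 q = 0")
      case True
      then show ?thesis unfolding s1_def herm_def Let_def by simp
    next
      case False
      then have q: "q \<in> triv_dom Lk j" using \<beta>1(4) by blast
      have "s1 q j = of_real (\<beta>1 q)" unfolding s1_def using Lk.frame_self[OF q] by simp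
      then show ?thesis
        using Lk.herm_eq[OF Lk.cont_section_fibre[OF s(1)] Lk.cont_section_fibre[OF P_cont[OF s(2)]] q] by simp
    qed
    \<comment> \<open>The second average, now over the remaining variable: both inner products are
      within \<open>b1 * b2 * e\<close> of \<open>b1 * b2\<close> times \<open>F (z, w)\<close> and
      \<open>G (z, w)\<close>, and symmetry of \<open>P\<close> identifies them.\<close>
    have "norm (inner2 (P s1) s2 - of_real b2 * (of_real b1 * F (z, w))) \<le> b2 * (b1 * e)"
      unfolding L2_inner_def h2 b2_def
      by (rule average_bound[OF \<beta>2(1,2) _ in1]) (use integrable_herm[OF P_cont[OF s(1)] s(2)] in \<open>simp add: h2\<close>)
    moreover have "norm (inner2 s1 (P s2) - of_real b1 * (of_real b2 * G (z, w))) \<le> b1 * (b2 * e)"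
      unfolding L2_inner_def h1 b1_def
      by (rule average_bound[OF \<beta>1(1,2) _ in2]) (use integrable_herm[OF s(1) P_cont[OF s(2)]] in \<open>simp add: h1\<close>)
    ultimately have "norm (of_real b1 * (of_real b2 * G (z, w)) - of_real b2 * (of_real b1 * F (z, w))) \<le> b2 * (b1 * e) + b1 * (b2 * e)"
      unfolding P_symmetric[OF s] by (smt (verit) norm_minus_commute norm_triangle_ineq4 norm_diff_triangle_le)
    moreover have "of_real b1 * (of_real b2 * G (z, w)) - of_real b2 * (of_real b1 * F (z, w)) = of_real (b1 * b2) * (G (z, w) - F (z, w))"
      by (simp add: algebra_simps)
    moreover have "norm (complex_of_real (b1 * b2) * (G (z, w) - F (z, w))) = (b1 * b2) * norm (G (z, w) - F (z, w))"
      unfolding norm_mult norm_of_real using b by simp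
    moreover have "b2 * (b1 * e) + b1 * (b2 * e) = (b1 * b2) * (2 * e)" by simp
    ultimately have "(b1 * b2) * norm (G (z, w) - F (z, w)) \<le> (b1 * b2) * (2 * e)" by metis
    then show ?thesis using b by (simp add: norm_minus_commute)
  qed
  then have "norm (F (z, w) - G (z, w)) \<le> 0"
  proof -
    assume b: "\<And>e. e > 0 \<Longrightarrow> norm (F (z, w) - G (z, w)) \<le> 2 * e"
    show ?thesis
    proof (rule field_le_epsilon)
      show "norm (F (z, w) - G (z, w)) \<le> 0 + e" if "e > 0" for e using b[of "e/2"] that by simp
    qed
  qed
  then show ?thesis unfolding F_def G_def by simp
qed

text \<open>Hermitian symmetry moves the kernel from the second slot of the metric to the first,
  where the integral formula for \<open>P s w\<close> appears.\<close>

lemma P_pairing: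
  assumes s: "Lk.cont_section s" and u: "u \<in> fibre Lk w"
  shows "herm Lk w (P s w) u = inner2 s (\<lambda>z. K z w u)"
proof -
  obtain j where j: "w \<in> triv_dom Lk j" using Lk.ex_triv by blast
  have "of_real (weight Lk j w) * cnj (u j) * K w z (s z) j = herm Lk z (s z) (K z w u)" for z
  proof -
    obtain i where i: "z \<in> triv_dom Lk i" using Lk.ex_triv by blast
    have "herm Lk z (s z) (K z w u) = of_real (weight Lk i z) * s z i * cnj (u j * K z w (frame Lk j w) i)"
      using Lk.herm_eq[OF Lk.cont_section_fibre[OF s] K_fibre[OF u] i] K_frame[OF u j] by simp
    also have "\<dots> = s z i * cnj (u j) * cnj (of_real (weight Lk i z) * K z w (frame Lk j w) i)" by simp
    also have "\<dots> = s z i * cnj (u j) * (of_real (weight Lk j w) * K w z (frame Lk i z) j)"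
      unfolding K_hermitian[OF i j] by simp
    also have "\<dots> = of_real (weight Lk j w) * cnj (u j) * K w z (s z) j"
      using K_frame[OF Lk.cont_section_fibre[OF s] i, of w j] by simp
    finally show ?thesis ..
  qed
  moreover have "has_bochner_integral vol (\<lambda>z. of_real (weight Lk j w) * cnj (u j) * K w z (s z) j)
      (of_real (weight Lk j w) * cnj (u j) * P s w j)"
    by (intro has_bochner_integral_mult_right P_integral s)
  ultimately have "has_bochner_integral vol (\<lambda>z. herm Lk z (s z) (K z w u)) (of_real (weight Lk j w) * cnj (u j) * P s w j)"
    by simp
  then have "inner2 s (\<lambda>z. K z w u) = of_real (weight Lk j w) * cnj (u j) * P s w j"
    unfolding L2_inner_def by (rule has_bochner_integral_integral_eq)
  then show ?thesis using Lk.herm_eq[OF Lk.cont_section_fibre[OF P_cont[OF s]] u j] by simp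
qed

lemma reproducing:
  assumes "t \<in> holo_sections A Lk" "u \<in> fibre Lk w"
  shows "inner2 t (\<lambda>z. K z w u) = herm Lk w (t w) u"
  using P_pairing[OF Lk.holo_sections_cont_section[OF assms(1)] assms(2)] P_holo_id[OF assms(1)] by simp

text \<open>
  The difference \<open>\<kappa> - P \<kappa>\<close> is orthogonal to all holomorphic sections, so \<open>P\<close> annihilates it, and
  pairing with \<open>\<kappa>\<close> is evaluation of \<open>P\<close>; hence it is orthogonal to itself.
\<close>

lemma K_holo:
  assumes u: "u \<in> fibre Lk w" shows "(\<lambda>z. K z w u) \<in> holo_sections A Lk"
proof -
  define \<kappa> where "\<kappa> = (\<lambda>z. K z w u)"
  have \<kappa>: "Lk.cont_section \<kappa>" unfolding \<kappa>_def by (rule cont_section_K[OF u])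
  define \<sigma> where "\<sigma> = (\<lambda>z i. \<kappa> z i - P \<kappa> z i)"
  have \<sigma>: "Lk.cont_section \<sigma>" unfolding \<sigma>_def by (intro Lk.cont_section_diff \<kappa> P_cont)
  have orth: "inner2 \<sigma> t = 0" if "t \<in> holo_sections A Lk" for t
    unfolding \<sigma>_def using inner2_diff_left[OF \<kappa> P_cont[OF \<kappa>] Lk.holo_sections_cont_section[OF that]] P_orthogonal[OF \<kappa> that] by simp
  have "inner2 (P \<sigma>) (P \<sigma>) = 0" using P_orthogonal[OF \<sigma> P_holo[OF \<sigma>]] orth[OF P_holo[OF \<sigma>]] by simp
  then have P\<sigma>: "P \<sigma> = (\<lambda>z i. 0)" by (rule inner2_self(3)[OF P_cont[OF \<sigma>]])
  have "inner2 \<sigma> \<kappa> = herm Lk w (P \<sigma> w) u" unfolding \<kappa>_def by (rule P_pairing[OF \<sigma> u, symmetric])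
  then have "inner2 \<sigma> \<kappa> = 0" unfolding P\<sigma> herm_def Let_def by simp
  moreover have "inner2 \<sigma> \<sigma> = inner2 \<sigma> \<kappa> - inner2 \<sigma> (P \<kappa>)"
    using inner2_diff_right[OF \<sigma> \<kappa> P_cont[OF \<kappa>]] unfolding \<sigma>_def[symmetric] .
  ultimately have "inner2 \<sigma> \<sigma> = 0" using orth[OF P_holo[OF \<kappa>]] by simp
  then have "\<sigma> = (\<lambda>z i. 0)" by (rule inner2_self(3)[OF \<sigma>])
  then have "\<kappa> = P \<kappa>" unfolding \<sigma>_def by (simp add: fun_eq_iff)
  then show ?thesis using P_holo[OF \<kappa>] unfolding \<kappa>_def by simp
qed

section \<open>The peak section\<close>

text \<open>At a zero of the field the derivative and the connection term both disappear, leaving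
  multiplication by \<open>H\<close>.\<close>

lemma Hhat_critical:
  assumes zc: "ham zc = (\<lambda>c. 0)" and t: "t \<in> holo_sections A Lk"
  shows "Hhat t zc = (\<lambda>i. of_real (H zc) * t zc i)"
proof
  fix i
  obtain c where c: "c \<in> A" "zc \<in> fst c" using ex_chart by blast
  show "Hhat t zc i = of_real (H zc) * t zc i"
  proof (cases "zc \<in> triv_dom L i")
    case True
    have x: "snd c zc \<in> chart_img c (triv_dom L i)" by (rule chart_img_I[OF c(2) True])
    have "fd ((\<lambda>z. t z i) \<circ> chart_inv c) (snd c zc) 0 = 0"
      using linear_0[OF has_derivative_linear[OF Lk.section_has_derivative[OF t c]]] True by simp
    moreover have "dlogw i c (snd c zc) 0 = 0"
      unfolding dlogw_def using linear_0[OF has_derivative_linear[OF logw_has_derivative[OF c(1) x]]] by simp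
    ultimately show ?thesis unfolding Hhat_eq[OF t c True] zc by simp
  next
    case False
    then show ?thesis
      using Lk.fibre_outside[OF Hhat_fibre[OF t]] Lk.fibre_outside[OF Lk.holo_sections_fibre[OF t]] by simp
  qed
qed

text \<open>Pairing a holomorphic \<open>t\<close> with the kernel section evaluates
  \<open>t\<close> at \<open>zc\<close>. Symmetry of the operator therefore moves it to
  \<open>t\<close>, where it acts as the scalar \<open>H zc\<close>. The difference
  \<open>\<eta>\<close> of the two sides is holomorphic and may serve as its own test
  section.\<close>

lemma Hhat_K:
  assumes zc: "ham zc = (\<lambda>c. 0)" and u: "u \<in> fibre Lk zc"
  shows "Hhat (\<lambda>z. K z zc u) = (\<lambda>z i. of_real (H zc) * K z zc u i)"
proof -
  define \<kappa> where "\<kappa> = (\<lambda>z. K z zc u)"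
  have \<kappa>: "\<kappa> \<in> holo_sections A Lk" unfolding \<kappa>_def by (rule K_holo[OF u])
  have cont: "Lk.cont_section t" if "t \<in> holo_sections A Lk" for t by (rule Lk.holo_sections_cont_section[OF that])
  define E where "E = (\<lambda>z i. of_real (H zc) * \<kappa> z i)"
  have E: "E \<in> holo_sections A Lk" unfolding E_def using Lk.holo_sections_comb[OF \<kappa> \<kappa>, of "of_real (H zc)" 0] by simp
  have Hk: "Hhat \<kappa> \<in> holo_sections A Lk" by (rule Hhat_holo[OF act \<kappa>])
  define \<eta> where "\<eta> = (\<lambda>z i. Hhat \<kappa> z i - E z i)"
  have \<eta>: "\<eta> \<in> holo_sections A Lk" unfolding \<eta>_def using Lk.holo_sections_comb[OF Hk E, of 1 "-1"] by simp
  have "inner2 (Hhat \<kappa>) t = inner2 E t" if t: "t \<in> holo_sections A Lk" for t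
  proof -
    have "inner2 (Hhat \<kappa>) t = inner2 \<kappa> (Hhat t)" by (rule L2_inner_Hhat[OF \<kappa> t])
    also have "\<dots> = cnj (inner2 (Hhat t) \<kappa>)" by (rule inner2_cnj)
    also have "inner2 (Hhat t) \<kappa> = herm Lk zc (Hhat t zc) u"
      unfolding \<kappa>_def by (rule reproducing[OF Hhat_holo[OF act t] u])
    also have "\<dots> = of_real (H zc) * inner2 t \<kappa>"
      unfolding Hhat_critical[OF zc t] Lk.herm_scale_left \<kappa>_def reproducing[OF t u] ..
    \<comment> \<open>Conjugation leaves the scalar \<open>H zc\<close> unchanged because it is
      real.\<close>
    also have "cnj \<dots> = inner2 E t"
      unfolding E_def inner2_scale_left using inner2_cnj[of \<kappa> t] by simp
    finally show ?thesis .
  qed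
  then have "inner2 \<eta> \<eta> = 0"
    using inner2_diff_left[OF cont[OF Hk] cont[OF E] cont[OF \<eta>]] \<eta> unfolding \<eta>_def[symmetric] by simp
  then have "\<eta> = (\<lambda>z i. 0)" by (rule inner2_self(3)[OF cont[OF \<eta>]])
  then show ?thesis unfolding \<eta>_def E_def \<kappa>_def by (simp add: fun_eq_iff)
qed

text \<open>The normalising factor can be moved into the fibre vector, so \<open>\<psi>\<close> is
  again a kernel section and represents evaluation at \<open>zc\<close>. Orthogonality to
  \<open>\<psi>\<close> thus means vanishing at \<open>zc\<close>; and an eigensection with another
  eigenvalue vanishes there, since the operator acts on its value at \<open>zc\<close> as
  \<open>H zc\<close>.\<close>

lemma peak_section_properties:
  assumes zc: "ham zc = (\<lambda>c. 0)" and e: "e \<in> fibre Lk zc" "herm Lk zc e e = 1"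
    and nz: "\<exists>u\<in>fibre Lk zc. K zc zc u \<noteq> (\<lambda>i. 0)"
  defines "\<psi> \<equiv> peak_section Lk vol K zc e"
  shows "L2_norm Lk vol \<psi> = 1"
    and "eigensection A L k H \<psi> (of_real (H zc))"
    and "eigensection A L k H s \<mu> \<Longrightarrow> inner2 s \<psi> = 0 \<Longrightarrow> vanishes_on s {zc}"
    and "eigensection A L k H s \<mu> \<Longrightarrow> \<mu> \<noteq> of_real (H zc) \<Longrightarrow> inner2 s \<psi> = 0"
proof -
  define \<kappa> where "\<kappa> = (\<lambda>z. K z zc e)"
  have \<kappa>: "Lk.cont_section \<kappa>" unfolding \<kappa>_def by (rule cont_section_K[OF e(1)])
  obtain j where j: "zc \<in> triv_dom Lk j" using Lk.ex_triv by blast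
  have ej: "e j \<noteq> 0" using Lk.herm_self[OF e(1) j] e(2) by auto
  \<comment> \<open>The fibre is a line spanned by \<open>e\<close>: if the kernel on the diagonal
    killed \<open>e\<close>, it would kill every fibre vector.\<close>
  have "\<kappa> zc \<noteq> (\<lambda>i. 0)"
  proof
    assume 0: "\<kappa> zc = (\<lambda>i. 0)"
    obtain u where u: "u \<in> fibre Lk zc" "K zc zc u \<noteq> (\<lambda>i. 0)" using nz by blast
    have "e j * K zc zc (frame Lk j zc) i = 0" for i
      using K_frame[OF e(1) j, of zc i] fun_cong[OF 0, of i] unfolding \<kappa>_def by simp
    then have "K zc zc u i = 0" for i using K_frame[OF u(1) j, of zc i] ej by simp
    then show False using u(2) by blast
  qed
  then have \<kappa>0: "\<kappa> \<noteq> (\<lambda>z i. 0)" by metis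
  define N where "N = Re (inner2 \<kappa> \<kappa>)"
  have N: "N > 0" "inner2 \<kappa> \<kappa> = of_real N"
    using inner2_self[OF \<kappa>] \<kappa>0 unfolding N_def by (auto simp: less_le)
  define C where "C = inverse (sqrt N)"
  have C: "C > 0" "C * C * N = 1" unfolding C_def using N(1) by (auto simp: field_simps)
  have \<psi>1: "\<psi> = (\<lambda>z i. of_real C * \<kappa> z i)"
    unfolding \<psi>_def peak_section_def L2_norm_def C_def N_def \<kappa>_def ..
  define e' where "e' = (\<lambda>i. of_real C * e i)"
  have e': "e' \<in> fibre Lk zc" unfolding e'_def using Lk.fibre_add[OF e(1,1), of "of_real C" 0] by simp
  have \<psi>2: "\<psi> = (\<lambda>z. K z zc e')" unfolding \<psi>1 e'_def \<kappa>_def using K_scale[OF e(1)] by simp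
  have "inner2 \<psi> \<psi> = of_real (C * C * N)"
    unfolding \<psi>1 inner2_scale_left inner2_scale_right N(2) by simp
  then show "L2_norm Lk vol \<psi> = 1" unfolding L2_norm_def C(2) by simp
  have \<psi>h: "\<psi> \<in> holo_sections A Lk" unfolding \<psi>2 by (rule K_holo[OF e'])
  have "\<psi> \<noteq> (\<lambda>z i. 0)"
  proof
    assume "\<psi> = (\<lambda>z i. 0)"
    then have "of_real C * \<kappa> z i = 0" for z i unfolding \<psi>1 by (metis)
    then have "\<kappa> = (\<lambda>z i. 0)" using C(1) by (intro ext) auto
    then show False using \<kappa>0 by blast
  qed
  then show "eigensection A L k H \<psi> (of_real (H zc))"
    unfolding eigensection_def using \<psi>h Hhat_K[OF zc e'] unfolding \<psi>2 Hhat_def by simp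
  have pair: "inner2 s \<psi> = herm Lk zc (s zc) e'" if "s \<in> holo_sections A Lk" for s
    unfolding \<psi>2 by (rule reproducing[OF that e'])
  assume es: "eigensection A L k H s \<mu>"
  then have s: "s \<in> holo_sections A Lk" and Hs: "Hhat s = (\<lambda>z i. \<mu> * s z i)"
    unfolding eigensection_def Hhat_def by auto
  have h: "herm Lk zc (s zc) e' = of_real (weight Lk j zc) * s zc j * cnj (of_real C * e j)"
    using Lk.herm_eq[OF Lk.holo_sections_fibre[OF s] e' j] unfolding e'_def by simp
  show "vanishes_on s {zc}" if "inner2 s \<psi> = 0"
  proof -
    have "s zc j = 0" using that pair[OF s] h C(1) ej Lk.weight_pos[OF j] by simp
    then show ?thesis unfolding vanishes_on_def using Lk.fibre_eq_zero_iff[OF Lk.holo_sections_fibre[OF s] j] by simp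
  qed
  show "inner2 s \<psi> = 0" if "\<mu> \<noteq> of_real (H zc)"
  proof -
    have "\<mu> * s zc j = of_real (H zc) * s zc j"
      using fun_cong[OF Hhat_critical[OF zc s], of j] unfolding Hs by simp
    then have "s zc j = 0" using that by simp
    then show ?thesis unfolding pair[OF s] h by simp
  qed
qed

end

theorem proposition1p5:
  fixes A :: "('a::t2_space, 'm::finite) chart set"
    and L :: "('a, 'i) herm_line_bundle"
    and vol :: "'a measure"
    and k :: nat
    and P :: "('a, 'i) sect \<Rightarrow> ('a, 'i) sect"
    and K :: "'a \<Rightarrow> 'a \<Rightarrow> ('i \<Rightarrow> complex) \<Rightarrow> 'i \<Rightarrow> complex"
    and H :: "'a \<Rightarrow> real"
    and zc :: 'a
    and e :: "'i \<Rightarrow> complex"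
  assumes "compact (UNIV :: 'a set)"
    and "polarized_kahler_manifold A L"
    and "is_liouville_measure A L vol"
    and "k \<ge> 1"
    and "is_bergman_projection A (tensor_power L k) vol P"
    and "is_schwartz_kernel (tensor_power L k) vol P K"
    and "smooth_fun A UNIV H"
    and "generates_holo_action A L H"
    and "morse_critical_point A H zc"
    and "e \<in> fibre (tensor_power L k) zc" and "herm (tensor_power L k) zc e e = 1"
  shows
    "((\<exists>u\<in>fibre (tensor_power L k) zc. K zc zc u \<noteq> (\<lambda>i. 0)) \<longrightarrow>
        L2_norm (tensor_power L k) vol (peak_section (tensor_power L k) vol K zc e) = 1 \<and>
        eigensection A L k H (peak_section (tensor_power L k) vol K zc e) (of_real (H zc)) \<and>
        (\<forall>s \<mu>. eigensection A L k H s \<mu> \<and>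
           L2_inner (tensor_power L k) vol s (peak_section (tensor_power L k) vol K zc e) = 0
           \<longrightarrow> vanishes_on s {zc}) \<and>
        (\<forall>s \<mu>. eigensection A L k H s \<mu> \<and> \<mu> \<noteq> of_real (H zc)
           \<longrightarrow> L2_inner (tensor_power L k) vol s (peak_section (tensor_power L k) vol K zc e) = 0))
     \<and> (\<forall>s (\<mu>::real). eigensection A L k H s (of_real \<mu>) \<and> \<mu> < H zc
           \<longrightarrow> vanishes_on s (W_plus A L H zc))
     \<and> (\<forall>s (\<mu>::real). eigensection A L k H s (of_real \<mu>) \<and> \<mu> > H zc
           \<longrightarrow> vanishes_on s (W_minus A L H zc))"
proof -
  interpret bergman A L H k vol P K
    using assms unfolding bergman_def bergman_axioms_def quantization_def quantization_axioms_def
      quantum_system_def quantum_system_axioms_def hamiltonian_system_def hamiltonian_system_axioms_def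
      polarized_manifold_def by blast
  have "ham zc = (\<lambda>c. 0)"
    using assms(9) unfolding morse_critical_point_def by (intro ham_critical) blast
  note peak = peak_section_properties[OF this assms(10,11)]
  show ?thesis
    using peak vanishes_on_W_plus vanishes_on_W_minus by blast
qed

end
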